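(* Let $n\ge 2$ be an integer and $\ell=\lfloor\frac{n-2}{2}\rfloor$. Let $Q=\mathsf{k}[x_1,\dots,x_n]$ (standard graded), where $\mathsf{k}$ is a field with $\operatorname{char}\mathsf{k}>n$ or $\operatorname{char}\mathsf{k}=0$. Let $J=(x_1^2,\dots,x_n^2)$, $I=J+\big((x_1+\dots+x_n)^2\big)$, $G=J:I$, and $R=Q/I$. Then: \begin{enumerate} \item[(1)] The ring $R$ is level, with socle concentrated in degree $n-\ell-1$, and $\dim_{\mathsf{k}}(\operatorname{Soc}(R))=C_{\ell+2}$. \item[(2)] The ideal $G/J$ is generated in degree $\ell+1$ and its minimal number of generators is $C_{\ell+2}$. Consequently, the ideal $G$ is generated in degrees $2$ and $\ell+1$ and, when $n\ge 4$, its minimal number of generators is $n+C_{\ell+2}$. \end{enumerate}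
   Context: A standard graded Artinian $\mathsf{k}$-algebra is level if its socle is concentrated in a single degree. The Catalan numbers are $C_k=\frac{1}{k+1}\binom{2k}{k}$. *)

theory Defs
  imports
    "HOL-Library.Poly_Mapping"
    "HOL-Computational_Algebra.Computational_Algebra"
    "HOL-Algebra.Embedded_Algebras"
    "HOL-Algebra.QuotRing"
begin

section \<open>The polynomial ring in n variables\<close>

text \<open>
  A polynomial is a finitely supported map from exponent vectors to coefficients; an exponent
  vector is a finitely supported map from variable indices to exponents. The ring in the
  variables with indices \<open>1, \<dots>, n\<close> is the subring of polynomials in which no other
  variable occurs.
\<close>

type_synonym 'k mpoly = "(nat \<Rightarrow>\<^sub>0 nat) \<Rightarrow>\<^sub>0 'k"

definition var :: "nat \<Rightarrow> 'k::field mpoly" where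
  "var i = Poly_Mapping.single (Poly_Mapping.single i 1) 1"

definition const :: "'k::field \<Rightarrow> 'k mpoly" where
  "const c = Poly_Mapping.single 0 c"

definition poly_ring :: "nat \<Rightarrow> 'k::field mpoly ring" where
  "poly_ring n =
    \<lparr> carrier = {p. \<forall>m \<in> Poly_Mapping.keys p. Poly_Mapping.keys m \<subseteq> {1..n}},
      monoid.mult = (*), one = 1, zero = 0, add = (+) \<rparr>"

definition mon_deg :: "(nat \<Rightarrow>\<^sub>0 nat) \<Rightarrow> nat" where
  "mon_deg m = (\<Sum>i \<in> Poly_Mapping.keys m. Poly_Mapping.lookup m i)"

definition hom_part :: "nat \<Rightarrow> nat \<Rightarrow> 'k::field mpoly set" where
  "hom_part n d = {p \<in> carrier (poly_ring n). \<forall>m \<in> Poly_Mapping.keys p. mon_deg m = d}"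

lemma cring_poly_ring: "cring (poly_ring n :: 'k::field mpoly ring)"
proof -
  let ?Q = "poly_ring n :: 'k mpoly ring"
  have mult: "p * q \<in> carrier ?Q" if "p \<in> carrier ?Q" "q \<in> carrier ?Q" for p q
  proof -
    have "Poly_Mapping.keys m \<subseteq> {1..n}" if m: "m \<in> Poly_Mapping.keys (p * q)" for m
    proof -
      obtain a b where "a \<in> Poly_Mapping.keys p" "b \<in> Poly_Mapping.keys q" "m = a + b"
        using m keys_mult[of p q] by auto
      moreover have "Poly_Mapping.keys (a + b) \<subseteq> Poly_Mapping.keys a \<union> Poly_Mapping.keys b"
        by (rule keys_add)
      ultimately show ?thesis
        using \<open>p \<in> carrier ?Q\<close> \<open>q \<in> carrier ?Q\<close> unfolding poly_ring_def by fastforce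
    qed
    then show ?thesis by (simp add: poly_ring_def)
  qed
  have add: "p + q \<in> carrier ?Q" if "p \<in> carrier ?Q" "q \<in> carrier ?Q" for p q
    using that keys_add[of p q] unfolding poly_ring_def by auto
  have neg: "- p \<in> carrier ?Q" if "p \<in> carrier ?Q" for p
    using that by (simp add: poly_ring_def)
  show ?thesis
  proof (rule cringI)
    show "abelian_group ?Q"
    proof (rule abelian_groupI)
      show "x \<oplus>\<^bsub>?Q\<^esub> y \<in> carrier ?Q" if "x \<in> carrier ?Q" "y \<in> carrier ?Q" for x y
        using add[OF that] by (simp add: poly_ring_def)
      show "\<exists>y\<in>carrier ?Q. y \<oplus>\<^bsub>?Q\<^esub> x = \<zero>\<^bsub>?Q\<^esub>" if "x \<in> carrier ?Q" for x
        using neg[OF that] by (intro bexI[of _ "- x"]) (simp_all add: poly_ring_def)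
    qed (simp_all add: poly_ring_def add.assoc add.commute)
    show "Group.comm_monoid ?Q"
    proof (rule comm_monoidI)
      show "x \<otimes>\<^bsub>?Q\<^esub> y \<in> carrier ?Q" if "x \<in> carrier ?Q" "y \<in> carrier ?Q" for x y
        using mult[OF that] by (simp add: poly_ring_def)
    qed (simp_all add: poly_ring_def mult.assoc mult.commute)
  qed (simp add: poly_ring_def distrib_right)
qed

section \<open>Ideals and their generators\<close>

definition colon_ideal :: "('a, 'b) ring_scheme \<Rightarrow> 'a set \<Rightarrow> 'a set \<Rightarrow> 'a set" where
  "colon_ideal A J I = {a \<in> carrier A. \<forall>b\<in>I. a \<otimes>\<^bsub>A\<^esub> b \<in> J}"

definition generates :: "('a, 'b) ring_scheme \<Rightarrow> 'a set \<Rightarrow> 'a set \<Rightarrow> bool" where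
  "generates A S I \<longleftrightarrow> S \<subseteq> carrier A \<and> I = Idl\<^bsub>A\<^esub> S"

text \<open>Stated as a relation so that it fails for ideals that are not finitely generated.\<close>

definition min_num_generators :: "('a, 'b) ring_scheme \<Rightarrow> 'a set \<Rightarrow> nat \<Rightarrow> bool" where
  "min_num_generators A I m \<longleftrightarrow>
    (\<exists>S. finite S \<and> card S = m \<and> generates A S I) \<and>
    (\<forall>S. finite S \<longrightarrow> generates A S I \<longrightarrow> m \<le> card S)"

text \<open>\<open>gr d\<close> is the homogeneous component of degree \<open>d\<close> of the ring \<open>A\<close>.\<close>

definition generated_in_degrees ::
    "('a, 'b) ring_scheme \<Rightarrow> (nat \<Rightarrow> 'a set) \<Rightarrow> nat set \<Rightarrow> 'a set \<Rightarrow> bool" where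
  "generated_in_degrees A gr D I \<longleftrightarrow> (\<exists>S \<subseteq> (\<Union>d\<in>D. gr d). generates A S I)"

definition artinian :: "('a, 'b) ring_scheme \<Rightarrow> bool" where
  "artinian A \<longleftrightarrow>
    (\<forall>f :: nat \<Rightarrow> 'a set. (\<forall>i. ideal (f i) A \<and> f (Suc i) \<subseteq> f i) \<longrightarrow> (\<exists>N. \<forall>i\<ge>N. f i = f N))"

section \<open>Graded quotients of the polynomial ring\<close>

definition homogeneous_ideal :: "nat \<Rightarrow> 'k::field mpoly set \<Rightarrow> bool" where
  "homogeneous_ideal n I \<longleftrightarrow> generated_in_degrees (poly_ring n) (hom_part n) UNIV I"

abbreviation quot_ring :: "nat \<Rightarrow> 'k::field mpoly set \<Rightarrow> 'k mpoly set ring" where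
  "quot_ring n I \<equiv> poly_ring n Quot I"

definition quot_image :: "nat \<Rightarrow> 'k::field mpoly set \<Rightarrow> 'k mpoly set \<Rightarrow> 'k mpoly set set" where
  "quot_image n I S = (\<lambda>p. I +>\<^bsub>poly_ring n\<^esub> p) ` S"

definition quot_part :: "nat \<Rightarrow> 'k::field mpoly set \<Rightarrow> nat \<Rightarrow> 'k mpoly set set" where
  "quot_part n I d = quot_image n I (hom_part n d)"

text \<open>The copy of the ground field inside the quotient, over which dimensions are taken.\<close>

definition quot_scalars :: "nat \<Rightarrow> 'k::field mpoly set \<Rightarrow> 'k mpoly set set" where
  "quot_scalars n I = quot_image n I (range const)"

definition quot_max_ideal :: "nat \<Rightarrow> 'k::field mpoly set \<Rightarrow> 'k mpoly set set" where
  "quot_max_ideal n I = Idl\<^bsub>quot_ring n I\<^esub> (\<Union>d\<in>{1..}. quot_part n I d)"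

definition socle :: "nat \<Rightarrow> 'k::field mpoly set \<Rightarrow> 'k mpoly set set" where
  "socle n I = {a \<in> carrier (quot_ring n I).
     \<forall>b \<in> quot_max_ideal n I. a \<otimes>\<^bsub>quot_ring n I\<^esub> b = \<zero>\<^bsub>quot_ring n I\<^esub>}"

text \<open>
  \<open>socle n I\<close> and \<open>level n I\<close> are about the algebra \<open>quot_ring n I\<close>; the standard graded algebras
  with n generators are, up to isomorphism, the quotients by homogeneous ideals.
\<close>

definition level :: "nat \<Rightarrow> 'k::field mpoly set \<Rightarrow> bool" where
  "level n I \<longleftrightarrow> homogeneous_ideal n I \<and> artinian (quot_ring n I) \<and>
     (\<exists>d. socle n I \<subseteq> quot_part n I d)"

section \<open>Catalan numbers\<close>

definition catalan :: "nat \<Rightarrow> nat" where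
  "catalan k = (2 * k choose k) div (k + 1)"

lemma catalan_exact: "(k + 1) * catalan k = (2 * k choose k)"
proof -
  have "Suc k * (2 * k choose Suc k) = (2 * k - k) * (2 * k choose k)"
    by (simp only: binomial_absorption binomial_absorb_comp)
  then have "Suc k * (2 * k choose Suc k) = k * (2 * k choose k)"
    by (simp only: mult_2 add_diff_cancel_left')
  then have "(k + 1) * ((2 * k choose k) - (2 * k choose Suc k)) = (2 * k choose k)"
    by (simp only: diff_mult_distrib2 Suc_eq_plus1 add_mult_distrib)
  then have "k + 1 dvd (2 * k choose k)"
    by (rule dvdI[OF sym])
  then show ?thesis
    unfolding catalan_def by (rule dvd_mult_div_cancel)
qed

end

theory Submission
  imports Defs "HOL-Library.Function_Algebras"
begin

text \<open>
  Let \<open>A = Q/J\<close>. The squarefree monomials \<open>x\<^sub>S\<close> with \<open>S \<subseteq> {1..n}\<close> form a basis of \<open>A\<close>, so an element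
  of \<open>A\<close> is a function on the subsets of \<open>{1..n}\<close>, the variable \<open>x\<^sub>i\<close> acts by \<open>mulX i\<close>, and
  \<open>s = x\<^sub>1 + \<dots> + x\<^sub>n\<close> acts by \<open>raise n\<close>. In this picture \<open>I/J = s\<^sup>2 A\<close> (\<open>sq_multiples\<close>) and \<open>G/J\<close> is
  the annihilator \<open>K\<close> of \<open>s\<^sup>2\<close> (\<open>sq_annihilator\<close>), and both parts of the statement are about the
  operator \<open>s\<^sup>2\<close> on \<open>A\<close>. With \<open>m = \<lfloor>n/2\<rfloor>\<close> one has \<open>l + 1 = m\<close> and \<open>n - l - 1 = n - m\<close>.

  The first ingredient is an \<open>sl\<^sub>2\<close> argument. If \<open>lower\<close> is the sum of the partial derivatives, the
  commutator of \<open>lower\<close> and \<open>raise\<close> is the scalar \<open>n - 2d\<close> on the degree \<open>d\<close> part \<open>A\<^sub>d\<close>. The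
  hypothesis on the characteristic keeps all the resulting constants invertible, and therefore
  \<open>s\<^sup>k\<close> is injective on \<open>A\<^sub>d\<close> whenever \<open>2d + k \<le> n\<close> (\<open>raise_pow_inj\<close>).

  The second ingredient shows that a socle element of \<open>R = A/s\<^sup>2 A\<close> of degree \<open>d < n - m\<close> vanishes
  (\<open>sq_multiples_of_mulX_low_degree\<close>). Suppose \<open>x\<^sub>i a = s\<^sup>2 b\<^sub>i\<close> for all \<open>i\<close>. Summing over \<open>i\<close> and
  cancelling \<open>s\<close> gives \<open>a = s b\<close> with \<open>b = \<Sum> b\<^sub>i\<close>; cancelling \<open>s\<close> again gives \<open>x\<^sub>i b = s b\<^sub>i\<close>. Since
  \<open>x\<^sub>i\<^sup>2 = 0\<close>, cancelling once more shows \<open>x\<^sub>i b\<^sub>i = 0\<close>, that is \<open>b\<^sub>i = x\<^sub>i c\<^sub>i\<close>. Comparing the parts of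
  \<open>x\<^sub>i b = s x\<^sub>i c\<^sub>i\<close> free of \<open>x\<^sub>i\<close> yields \<open>b - s c\<^sub>i = x\<^sub>i \<partial>\<^sub>i b - b\<^sub>i\<close>, and summing over \<open>i\<close> with
  Euler's formula gives \<open>(n + 2 - d) b = s \<Sum> c\<^sub>i\<close>. The scalar is invertible, so \<open>a\<close> lies in \<open>s\<^sup>2 A\<close>.

  The third ingredient is duality. The pairing that multiplies and takes the coefficient of
  \<open>x\<^sub>1 \<cdots> x\<^sub>n\<close> is perfect and makes every \<open>x\<^sub>i\<close> self-adjoint, so \<open>K\<close> and \<open>s\<^sup>2 A\<close> are orthogonal
  complements. Injectivity in low degrees dualizes to \<open>A\<^sub>d \<subseteq> s\<^sup>2 A\<close> for \<open>2d \<ge> n + 2\<close>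
  (\<open>sq_multiples_high_degree\<close>), so \<open>R\<close> lives in degrees at most \<open>n - m\<close> and its socle is exactly
  its top part. The statement on socles dualizes to the statement that \<open>K\<close> is generated by its lowest
  part \<open>K\<^sub>m\<close> (\<open>sq_annihilator_generated\<close>). Rank and nullity of \<open>s\<^sup>2\<close> give both the dimension of
  \<open>K\<^sub>m\<close> and that of the top part of \<open>R\<close> as a difference of two binomial coefficients, which is the
  Catalan number.

  Lower bounds on the number of generators come from a linear map on \<open>G\<close> that kills all \<open>x\<^sub>i G\<close>: its
  image is spanned by the images of any generating set. For \<open>G/J\<close> one takes the degree \<open>m\<close>
  squarefree part; for \<open>G\<close> one adds the coefficients of the squares \<open>x\<^sub>i\<^sup>2\<close>, which is possible
  because \<open>m \<ge> 2\<close> makes \<open>G\<close> vanish in degree one.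
\<close>

section \<open>Functions with values in a field\<close>

text \<open>
  Functions with values in a field form a vector space under \<open>scl\<close>. Its index type is arbitrary, so
  that the same linear algebra serves functions on subsets and the larger coordinate spaces used for
  counting generators.
\<close>

definition scl :: "'k::field \<Rightarrow> ('a \<Rightarrow> 'k) \<Rightarrow> 'a \<Rightarrow> 'k" where
  "scl c f = (\<lambda>x. c * f x)"

interpretation fs: vector_space scl
  by unfold_locales (auto simp: scl_def fun_eq_iff algebra_simps)

lemma scl_apply: "scl c f x = c * f x"
  by (simp add: scl_def)

lemma sum_fun_apply: "(\<Sum>i\<in>A. f i) x = (\<Sum>i\<in>A. f i x)"
  by (induction A rule: infinite_finite_induct) auto

text \<open>
  Orients the definition so that a constant zero function is displayed as zero again after the
  simplifier has evaluated it under a binder.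
\<close>

declare zero_fun_def [symmetric, simp]

section \<open>The squarefree algebra and its sl2 action\<close>

text \<open>
  A function on finite sets of indices stands for \<open>\<Sum>\<^sub>S f(S) x\<^sub>S\<close>, where \<open>x\<^sub>S\<close> is a squarefree
  monomial. Multiplication by \<open>x\<^sub>i\<close> modulo the squares and the partial derivative by \<open>x\<^sub>i\<close> become
  the following two operators; their sums over \<open>i\<close> generate an action of \<open>sl\<^sub>2\<close>.
\<close>

definition mulX :: "nat \<Rightarrow> (nat set \<Rightarrow> 'k::field) \<Rightarrow> nat set \<Rightarrow> 'k" where
  "mulX i f = (\<lambda>S. if i \<in> S then f (S - {i}) else 0)"

definition derX :: "nat \<Rightarrow> (nat set \<Rightarrow> 'k::field) \<Rightarrow> nat set \<Rightarrow> 'k" where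
  "derX i f = (\<lambda>S. if i \<in> S then 0 else f (insert i S))"

definition raise :: "nat \<Rightarrow> (nat set \<Rightarrow> 'k::field) \<Rightarrow> nat set \<Rightarrow> 'k" where
  "raise n f = (\<Sum>i=1..n. mulX i f)"

definition lower :: "nat \<Rightarrow> (nat set \<Rightarrow> 'k::field) \<Rightarrow> nat set \<Rightarrow> 'k" where
  "lower n f = (\<Sum>i=1..n. derX i f)"

text \<open>
  The operators below are linear maps in the sense of the abstract vector space locales; each gets an
  interpretation, which supplies additivity, homogeneity and compatibility with sums.
\<close>

lemma linear_sclI:
  fixes T :: "('a \<Rightarrow> 'k::field) \<Rightarrow> 'b \<Rightarrow> 'k"
  assumes "\<And>f g. T (f + g) = T f + T g" "\<And>c f. T (scl c f) = scl c (T f)"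
  shows "Vector_Spaces.linear scl scl T"
  using assms by (simp add: Vector_Spaces.linear_iff fs.vector_space_axioms)

interpretation mulX: Vector_Spaces.linear scl scl "mulX i" for i
  by (rule linear_sclI) (auto simp: mulX_def fun_eq_iff scl_apply)

interpretation derX: Vector_Spaces.linear scl scl "derX i" for i
  by (rule linear_sclI) (auto simp: derX_def fun_eq_iff scl_apply)

interpretation raise: Vector_Spaces.linear scl scl "raise n" for n
  by (rule linear_sclI) 
     (auto simp: raise_def mulX.add mulX.scale sum.distrib fs.scale_sum_right)

interpretation lower: Vector_Spaces.linear scl scl "lower n" for n
  by (rule linear_sclI) 
     (auto simp: lower_def derX.add derX.scale sum.distrib fs.scale_sum_right)

definition sqf :: "nat \<Rightarrow> (nat set \<Rightarrow> 'k::field) set" where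
  "sqf n = {f. \<forall>S. f S \<noteq> 0 \<longrightarrow> S \<subseteq> {1..n}}"

text \<open>
  The degree is an integer so that lowering a degree needs no case distinction: the parts of negative
  degree are zero.
\<close>

definition sqf_part :: "nat \<Rightarrow> int \<Rightarrow> (nat set \<Rightarrow> 'k::field) set" where
  "sqf_part n d = {f. \<forall>S. f S \<noteq> 0 \<longrightarrow> S \<subseteq> {1..n} \<and> int (card S) = d}"

lemma subspace_support: "fs.subspace {f :: 'a \<Rightarrow> 'k::field. \<forall>x. f x \<noteq> 0 \<longrightarrow> P x}"
proof (rule fs.subspaceI)
  fix f g :: "'a \<Rightarrow> 'k"
  assume "f \<in> {f. \<forall>x. f x \<noteq> 0 \<longrightarrow> P x}" "g \<in> {f. \<forall>x. f x \<noteq> 0 \<longrightarrow> P x}"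
  then have "f x = 0 \<and> g x = 0" if "\<not> P x" for x using that by auto
  then have "(f + g) x = 0" if "\<not> P x" for x using that by simp
  then show "f + g \<in> {f. \<forall>x. f x \<noteq> 0 \<longrightarrow> P x}" by blast
qed (auto simp: scl_apply)

lemma subspace_sqf: "fs.subspace (sqf n)"
  unfolding sqf_def by (rule subspace_support)

lemma subspace_sqf_part: "fs.subspace (sqf_part n d)"
  unfolding sqf_part_def by (rule subspace_support)

lemma sqf_part_subset: "sqf_part n d \<subseteq> sqf n"
  by (auto simp: sqf_def sqf_part_def)

lemma sqf_part_0: "0 \<in> sqf_part n d"
  by (simp add: sqf_part_def)

lemma sqf_part_neg: "f \<in> sqf_part n d \<Longrightarrow> d < 0 \<Longrightarrow> f = 0"
  by (force simp: sqf_part_def fun_eq_iff scl_apply)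

lemma mulX_sqf_part: 
  assumes "f \<in> sqf_part n d" "i \<in> {1..n}"
  shows "mulX i f \<in> sqf_part n (d + 1)"
proof -
  have "S \<subseteq> {1..n} \<and> int (card S) = d + 1" if "mulX i f S \<noteq> 0" for S
  proof -
    have i: "i \<in> S" and f: "f (S - {i}) \<noteq> 0"
      using that by (auto simp: mulX_def split: if_splits)
    have *: "S - {i} \<subseteq> {1..n}" "int (card (S - {i})) = d"
      using f assms(1) by (auto simp: sqf_part_def)
    have "finite (S - {i})" using finite_subset[OF *(1)] by simp
    then have "finite S" by simp
    then show ?thesis using * i assms(2) card_Suc_Diff1[of S i] by auto
  qed
  then show ?thesis by (simp add: sqf_part_def)
qed

lemma derX_sqf_part: 
  assumes "f \<in> sqf_part n d"
  shows "derX i f \<in> sqf_part n (d - 1)"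
proof -
  have "S \<subseteq> {1..n} \<and> int (card S) = d - 1" if "derX i f S \<noteq> 0" for S
  proof -
    have i: "i \<notin> S" and f: "f (insert i S) \<noteq> 0"
      using that by (auto simp: derX_def split: if_splits)
    have *: "insert i S \<subseteq> {1..n}" "int (card (insert i S)) = d"
      using f assms(1) by (auto simp: sqf_part_def)
    have "finite S" using finite_subset[OF *(1)] by simp
    then show ?thesis using * i by auto
  qed
  then show ?thesis by (simp add: sqf_part_def)
qed

lemma mulX_sqf: "f \<in> sqf n \<Longrightarrow> i \<in> {1..n} \<Longrightarrow> mulX i f \<in> sqf n"
proof -
  assume *: "f \<in> sqf n" "i \<in> {1..n}"
  have "S \<subseteq> {1..n}" if "mulX i f S \<noteq> 0" for S
  proof -
    have "f (S - {i}) \<noteq> 0" using that by (simp add: mulX_def split: if_splits)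
    then have "S - {i} \<subseteq> {1..n}" using *(1) by (simp add: sqf_def)
    then show ?thesis using *(2) by blast
  qed
  then show ?thesis by (simp add: sqf_def)
qed

lemma raise_sqf: "f \<in> sqf n \<Longrightarrow> raise n f \<in> sqf n"
  unfolding raise_def by (intro fs.subspace_sum subspace_sqf mulX_sqf)

lemma raise_sqf_part: "f \<in> sqf_part n d \<Longrightarrow> raise n f \<in> sqf_part n (d + 1)"
  unfolding raise_def by (intro fs.subspace_sum subspace_sqf_part mulX_sqf_part)

lemma lower_sqf_part: "f \<in> sqf_part n d \<Longrightarrow> lower n f \<in> sqf_part n (d - 1)"
  unfolding lower_def by (intro fs.subspace_sum subspace_sqf_part derX_sqf_part)

lemma mulX_mulX_same: "mulX i (mulX i f) = 0"
  by (auto simp: mulX_def fun_eq_iff scl_apply)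

lemma mulX_commute: "mulX i (mulX j f) = mulX j (mulX i f)"
proof -
  have "S - {i} - {j} = S - {j} - {i}" for S :: "nat set" by blast
  then show ?thesis by (simp add: mulX_def fun_eq_iff scl_apply)
qed

lemma mulX_raise: "mulX i (raise n f) = raise n (mulX i f)"
  by (simp add: raise_def mulX.sum mulX_commute[of i])

lemma derX_mulX_same: "derX i (mulX i f) = f - mulX i (derX i f)"
  by (auto simp: derX_def mulX_def fun_eq_iff scl_apply insert_absorb)

lemma derX_mulX: "i \<noteq> j \<Longrightarrow> derX i (mulX j f) = mulX j (derX i f)"
  by (auto simp: derX_def mulX_def fun_eq_iff scl_apply insert_Diff_if)

text \<open>
  The derivation \<open>\<partial>\<^sub>i\<close> commutes with every \<open>x\<^sub>j\<close> except \<open>x\<^sub>i\<close>, where \<open>x\<^sub>i\<^sup>2 = 0\<close> turns the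
  Leibniz rule into \<open>\<partial>\<^sub>i x\<^sub>i = 1 - x\<^sub>i \<partial>\<^sub>i\<close>. This is the source of the correction terms.
\<close>

lemma derX_raise:
  assumes "i \<in> {1..n}"
  shows "derX i (raise n f) = raise n (derX i f) + f - scl 2 (mulX i (derX i f))"
proof -
  have "derX i (raise n f) = (\<Sum>j=1..n. mulX j (derX i f) + (if j = i then f - scl 2 (mulX i (derX i f)) else 0))"
    unfolding raise_def derX.sum
    by (intro sum.cong) (auto simp: derX_mulX derX_mulX_same fun_eq_iff scl_apply)
  also have "\<dots> = raise n (derX i f) + f - scl 2 (mulX i (derX i f))"
    using assms by (simp add: sum.distrib raise_def)
  finally show ?thesis .
qed

text \<open>
  Euler's formula: \<open>x\<^sub>i \<partial>\<^sub>i\<close> is the projection to the monomials containing \<open>x\<^sub>i\<close>, so a monomial of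
  degree \<open>d\<close> survives in exactly \<open>d\<close> of the summands.
\<close>

lemma euler_sqf_part:
  assumes "f \<in> sqf_part n d"
  shows "(\<Sum>i=1..n. mulX i (derX i f)) = scl (of_int d) f"
proof
  fix S
  have "(\<Sum>i=1..n. mulX i (derX i f)) S = (\<Sum>i=1..n. if i \<in> S then f S else 0)"
    unfolding sum_fun_apply by (intro sum.cong) (auto simp: mulX_def derX_def insert_absorb)
  also have "\<dots> = of_nat (card ({1..n} \<inter> S)) * f S"
    by (simp flip: sum.inter_restrict)
  also have "\<dots> = scl (of_int d) f S"
  proof (cases "f S = 0")
    case False
    then have "S \<subseteq> {1..n}" "d = int (card S)" using assms by (auto simp: sqf_part_def)
    then show ?thesis by (simp add: inf.absorb2 scl_apply)
  qed (simp add: scl_apply)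
  finally show "(\<Sum>i=1..n. mulX i (derX i f)) S = scl (of_int d) f S" .
qed

lemma lower_raise:
  assumes "f \<in> sqf_part n d"
  shows "lower n (raise n f) = raise n (lower n f) + scl (of_int (int n - 2 * d)) f"
proof -
  have "lower n (raise n f) = (\<Sum>i=1..n. raise n (derX i f) + f - scl 2 (mulX i (derX i f)))"
    unfolding lower_def by (intro sum.cong derX_raise) auto
  also have "\<dots> = raise n (lower n f) + scl (of_nat n) f - scl 2 (\<Sum>i=1..n. mulX i (derX i f))"
    by (simp add: sum.distrib sum_subtractf lower_def raise.sum fs.scale_sum_right)
       (simp add: fun_eq_iff scl_apply sum_fun_apply)
  also have "\<dots> = raise n (lower n f) + scl (of_int (int n - 2 * d)) f"
    unfolding euler_sqf_part[OF assms] by (simp add: fun_eq_iff scl_apply algebra_simps)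
  finally show ?thesis .
qed


text \<open>
  The hypothesis on the characteristic enters only in this form: the scalars that have to be inverted
  are integers between \<open>1\<close> and \<open>n\<close>.
\<close>

lemma of_int_neq_0:
  assumes "CHAR('k::field) > n \<or> CHAR('k) = 0" "0 < k" "k \<le> int n"
  shows "(of_int k :: 'k) \<noteq> 0"
proof
  assume "(of_int k :: 'k) = 0"
  then have "(of_nat (nat k) :: 'k) = 0" using assms(2) by simp
  then have "CHAR('k) dvd nat k" by (simp add: of_nat_eq_0_iff_char_dvd)
  then show False using assms by (auto dest: dvd_imp_le)
qed

lemma raise_pow_sqf_part: "f \<in> sqf_part n d \<Longrightarrow> (raise n ^^ k) f \<in> sqf_part n (d + int k)"
  by (induction k) (auto dest: raise_sqf_part simp: algebra_simps)

lemma raise_pow_0: "(raise n ^^ k) 0 = 0"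
  by (induction k) simp_all

text \<open>
  The standard \<open>sl\<^sub>2\<close> commutator. The constant is the sum of the weights \<open>n - 2(d + j)\<close> for
  \<open>j = 0, \<dots>, k\<close>.
\<close>

lemma lower_raise_pow:
  assumes "f \<in> sqf_part n d"
  shows "lower n ((raise n ^^ Suc k) f) =
    (raise n ^^ Suc k) (lower n f) + scl (of_int (int (Suc k) * (int n - 2 * d - int k))) ((raise n ^^ k) f)"
proof (induction k)
  case 0
  then show ?case using lower_raise[OF assms] by simp
next
  case (Suc k)
  let ?g = "(raise n ^^ Suc k) f"
  have g: "?g \<in> sqf_part n (d + int (Suc k))"
    by (rule raise_pow_sqf_part[OF assms])
  have "lower n ((raise n ^^ Suc (Suc k)) f) = lower n (raise n ?g)"
    by simp
  also have "\<dots> = raise n (lower n ?g) + scl (of_int (int n - 2 * (d + int (Suc k)))) ?g"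
    by (rule lower_raise[OF g])
  also have "raise n (lower n ?g) = (raise n ^^ Suc (Suc k)) (lower n f) +
      scl (of_int (int (Suc k) * (int n - 2 * d - int k))) ?g"
    unfolding Suc.IH raise.add raise.scale by simp
  also have "\<dots> + scl (of_int (int n - 2 * (d + int (Suc k)))) ?g =
      (raise n ^^ Suc (Suc k)) (lower n f) +
      scl (of_int (int (Suc (Suc k)) * (int n - 2 * d - int (Suc k)))) ?g"
    unfolding add.assoc fs.scale_left_distrib[symmetric] of_int_add[symmetric]
    by (simp add: algebra_simps)
  finally show ?case .
qed

text \<open>
  If \<open>s\<^sup>k f = 0\<close> then \<open>s\<^sup>k\<^sup>+\<^sup>1\<close> kills \<open>lower f\<close>, which has smaller degree and hence vanishes by
  induction on the degree. The commutator formula then says that a multiple of \<open>s\<^sup>k\<^sup>-\<^sup>1 f\<close> is zero, and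
  the multiple is nonzero because both of its factors lie between \<open>1\<close> and \<open>n\<close>; induction on \<open>k\<close>
  finishes the proof.
\<close>

lemma raise_pow_inj:
  fixes f :: "nat set \<Rightarrow> 'k::field"
  assumes char: "CHAR('k) > n \<or> CHAR('k) = 0"
  assumes "f \<in> sqf_part n d" "(raise n ^^ k) f = 0" "2 * d + int k \<le> int n"
  shows "f = 0"
  using assms(2-)
proof (induction "nat (d + 1)" arbitrary: d f k)
  case 0
  then show ?case by (intro sqf_part_neg[of f n d]) auto
next
  case (Suc m)
  have IH: "g = 0" if "g \<in> sqf_part n (d - 1)" "(raise n ^^ k) g = 0" "2 * (d - 1) + int k \<le> int n" for g :: "nat set \<Rightarrow> 'k" and k
    using Suc.hyps(1)[of "d - 1" g k] Suc.hyps(2) that by simp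
  have d: "d \<ge> 0" using Suc.hyps(2) by simp
  from Suc.prems show ?case
  proof (induction k)
    case 0
    then show ?case by simp
  next
    case (Suc k)
    have eq: "(raise n ^^ Suc k) (lower n f) =
        - scl (of_int (int (Suc k) * (int n - 2 * d - int k))) ((raise n ^^ k) f)"
      using lower_raise_pow[OF Suc.prems(1), of k] Suc.prems(2)
      by (simp add: lower.zero eq_neg_iff_add_eq_0 del: funpow.simps)
    have "(raise n ^^ Suc (Suc k)) (lower n f) = raise n ((raise n ^^ Suc k) (lower n f))"
      by simp
    also have "\<dots> = - scl (of_int (int (Suc k) * (int n - 2 * d - int k))) ((raise n ^^ Suc k) f)"
      unfolding eq raise.neg raise.scale by simp
    also have "\<dots> = 0"
      unfolding Suc.prems(2) by simp
    finally have z: "(raise n ^^ Suc (Suc k)) (lower n f) = 0" .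
    have "lower n f = 0"
      by (rule IH[OF lower_sqf_part[OF Suc.prems(1)] z]) (use Suc.prems(3) in simp)
    then have "scl (of_int (int (Suc k) * (int n - 2 * d - int k))) ((raise n ^^ k) f) = 0"
      using eq by (simp add: raise_pow_0 raise.zero)
    moreover have "(of_int (int (Suc k)) :: 'k) \<noteq> 0" "(of_int (int n - 2 * d - int k) :: 'k) \<noteq> 0"
      using Suc.prems(3) d by (intro of_int_neq_0[OF char]; simp)+
    ultimately have "(raise n ^^ k) f = 0"
      by (simp del: of_int_of_nat_eq of_int_diff)
    then show ?case
      using Suc.prems by (intro Suc.IH) auto
  qed
qed

lemma raise_inj:
  fixes f :: "nat set \<Rightarrow> 'k::field"
  assumes "CHAR('k) > n \<or> CHAR('k) = 0" "f \<in> sqf_part n d" "raise n f = 0" "2 * d + 1 \<le> int n"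
  shows "f = 0"
  using raise_pow_inj[of n f d 1] assms by simp

lemma raise_raise_inj:
  fixes f :: "nat set \<Rightarrow> 'k::field"
  assumes "CHAR('k) > n \<or> CHAR('k) = 0" "f \<in> sqf_part n d" "raise n (raise n f) = 0" "2 * d + 2 \<le> int n"
  shows "f = 0"
  using raise_pow_inj[of n f d 2] assms by (simp add: numeral_2_eq_2)

section \<open>Multiples and annihilator of the square of the sum\<close>

definition hom_component :: "int \<Rightarrow> (nat set \<Rightarrow> 'k::field) \<Rightarrow> nat set \<Rightarrow> 'k" where
  "hom_component d f = (\<lambda>S. if int (card S) = d then f S else 0)"

interpretation hom_component: Vector_Spaces.linear scl scl "hom_component d" for d
  by (rule linear_sclI) (auto simp: hom_component_def fun_eq_iff scl_apply)

lemma hom_component_sqf_part: "f \<in> sqf n \<Longrightarrow> hom_component d f \<in> sqf_part n d"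
  by (auto simp: sqf_def sqf_part_def hom_component_def split: if_splits)

lemma hom_component_id: "f \<in> sqf_part n d \<Longrightarrow> hom_component d f = f"
  by (auto simp: sqf_part_def hom_component_def fun_eq_iff scl_apply)

lemma hom_component_mulX:
  assumes "f \<in> sqf n"
  shows "hom_component (d + 1) (mulX i f) = mulX i (hom_component d f)"
proof
  fix S
  show "hom_component (d + 1) (mulX i f) S = mulX i (hom_component d f) S"
  proof (cases "i \<in> S \<and> f (S - {i}) \<noteq> 0")
    case True
    then have "S - {i} \<subseteq> {1..n}" using assms by (auto simp: sqf_def)
    then have "finite (S - {i})" by (rule finite_subset) simp
    then have "int (card S) = int (card (S - {i})) + 1"
      using True card_Suc_Diff1[of S i] by simp
    then have iff: "(int (card S) = d + 1) = (int (card (S - {i})) = d)" by linarith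
    have "i \<in> S" using True by blast
    then show ?thesis by (simp only: hom_component_def mulX_def iff if_True)
  qed (auto simp: hom_component_def mulX_def)
qed

lemma hom_component_raise:
  assumes "f \<in> sqf n"
  shows "hom_component (d + 1) (raise n f) = raise n (hom_component d f)"
  unfolding raise_def hom_component.sum by (simp add: hom_component_mulX[OF assms])

lemma sum_hom_component:
  assumes "f \<in> sqf n"
  shows "f = (\<Sum>d=0..int n. hom_component d f)"
proof
  fix S
  have "(\<Sum>d=0..int n. hom_component d f) S = (\<Sum>d=0..int n. if d = int (card S) then f S else 0)"
    unfolding sum_fun_apply by (intro sum.cong) (auto simp: hom_component_def)
  also have "\<dots> = (if card S \<le> n then f S else 0)"
    by simp
  also have "\<dots> = f S"
    using assms card_mono[of "{1..n}" S] by (auto simp: sqf_def)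
  finally show "f S = (\<Sum>d=0..int n. hom_component d f) S" by simp
qed

definition sq_multiples :: "nat \<Rightarrow> (nat set \<Rightarrow> 'k::field) set" where
  "sq_multiples n = (\<lambda>f. raise n (raise n f)) ` sqf n"

definition sq_annihilator :: "nat \<Rightarrow> (nat set \<Rightarrow> 'k::field) set" where
  "sq_annihilator n = {f \<in> sqf n. raise n (raise n f) = 0}"

lemma linear_raise_raise: "Vector_Spaces.linear scl scl (\<lambda>f. raise n (raise n f))"
  by (rule linear_sclI) (simp_all add: raise.add raise.scale)

lemma subspace_sq_multiples: "fs.subspace (sq_multiples n)"
proof -
  interpret r2: Vector_Spaces.linear scl scl "\<lambda>f. raise n (raise n f)"
    by (rule linear_raise_raise)
  show ?thesis unfolding sq_multiples_def by (rule r2.subspace_image[OF subspace_sqf])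
qed

lemma subspace_sq_annihilator: "fs.subspace (sq_annihilator n)"
proof -
  interpret r2: Vector_Spaces.linear scl scl "\<lambda>f. raise n (raise n f)"
    by (rule linear_raise_raise)
  show ?thesis unfolding sq_annihilator_def Collect_conj_eq Collect_mem_eq
    by (rule fs.subspace_inter[OF subspace_sqf r2.subspace_kernel])
qed

lemma hom_component_sq_multiples:
  assumes "f \<in> sq_multiples n"
  shows "hom_component d f \<in> sq_multiples n"
proof -
  obtain g where g: "g \<in> sqf n" "f = raise n (raise n g)"
    using assms by (auto simp: sq_multiples_def)
  have "hom_component d f = raise n (raise n (hom_component (d - 2) g))"
    using hom_component_raise[OF raise_sqf[OF g(1)], of "d - 1"] hom_component_raise[OF g(1), of "d - 2"] g(2) by simp
  then show ?thesis using hom_component_sqf_part[OF g(1)] sqf_part_subset unfolding sq_multiples_def by blast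
qed

lemma hom_component_sq_annihilator:
  assumes "f \<in> sq_annihilator n"
  shows "hom_component d f \<in> sq_annihilator n"
proof -
  have g: "f \<in> sqf n" "raise n (raise n f) = 0"
    using assms by (auto simp: sq_annihilator_def)
  have "raise n (raise n (hom_component d f)) = hom_component (d + 1 + 1) (raise n (raise n f))"
    by (simp only: hom_component_raise[OF raise_sqf[OF g(1)]] hom_component_raise[OF g(1)])
  then have "raise n (raise n (hom_component d f)) = 0"
    by (simp only: g(2) hom_component.zero)
  then show ?thesis using hom_component_sqf_part[OF g(1)] sqf_part_subset
    unfolding sq_annihilator_def by blast
qed

lemma sq_multiples_part:
  assumes "f \<in> sq_multiples n" "f \<in> sqf_part n d"
  obtains g where "g \<in> sqf_part n (d - 2)" "f = raise n (raise n g)"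
proof -
  obtain g where g: "g \<in> sqf n" "f = raise n (raise n g)"
    using assms by (auto simp: sq_multiples_def)
  have "f = hom_component (d - 2 + 1 + 1) f" using hom_component_id[OF assms(2)] by simp
  also have "\<dots> = raise n (raise n (hom_component (d - 2) g))"
    by (simp only: hom_component_raise[OF raise_sqf[OF g(1)]] hom_component_raise[OF g(1)] g(2))
  finally show ?thesis using that hom_component_sqf_part[OF g(1)] by blast
qed

lemma mulX_eq_0_imp: 
  assumes "mulX i f = 0"
  shows "f = mulX i (derX i f)"
  using derX_mulX_same[of i f] assms by (simp add: derX.zero)

text \<open>
  Every cancellation of \<open>s\<close> is an instance of injectivity in degree at most \<open>d\<close>, which is where the
  bound on \<open>d\<close> enters; the scalar inverted in the end comes from Euler's formula. The conclusion says
  that the quotient by \<open>s\<^sup>2\<close> has no socle below its top degree.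
\<close>

lemma sq_multiples_of_mulX_low_degree:
  fixes a :: "nat set \<Rightarrow> 'k::field"
  assumes char: "CHAR('k) > n \<or> CHAR('k) = 0"
  assumes a: "a \<in> sqf_part n d" "2 * d + 1 \<le> int n"
  assumes soc: "\<And>i. i \<in> {1..n} \<Longrightarrow> mulX i a \<in> sq_multiples n"
  shows "a \<in> sq_multiples n"
proof -
  note inj = raise_inj[OF char]
  have "\<exists>b. b \<in> sqf_part n (d - 1) \<and> mulX i a = raise n (raise n b)" if i: "i \<in> {1..n}" for i
  proof -
    obtain g where "g \<in> sqf_part n (d + 1 - 2)" "mulX i a = raise n (raise n g)"
      using sq_multiples_part[OF soc[OF i] mulX_sqf_part[OF a(1) i]] by blast
    then show ?thesis by auto
  qed
  then obtain b where b: "\<And>i. i \<in> {1..n} \<Longrightarrow> b i \<in> sqf_part n (d - 1)"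
     "\<And>i. i \<in> {1..n} \<Longrightarrow> mulX i a = raise n (raise n (b i))" by metis
  \<comment> \<open>Summing \<open>x\<^sub>i a = s\<^sup>2 b\<^sub>i\<close> over \<open>i\<close> lets one factor \<open>s\<close> be cancelled.\<close>
  define B where "B = (\<Sum>i=1..n. b i)"
  have B: "B \<in> sqf_part n (d - 1)"
    unfolding B_def by (intro fs.subspace_sum subspace_sqf_part b)
  have rB: "raise n B \<in> sqf_part n d"
    using raise_sqf_part[OF B] by simp
  have "raise n a = (\<Sum>i=1..n. raise n (raise n (b i)))"
    unfolding raise_def[of n a] by (intro sum.cong b) auto
  then have "raise n (a - raise n B) = 0"
    by (simp add: raise.diff raise.sum B_def)
  then have "a - raise n B = 0"
    by (rule inj[OF fs.subspace_diff[OF subspace_sqf_part a(1) rB] _ a(2)])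
  then have aB: "a = raise n B" by simp
  have XB: "mulX i B = raise n (b i)" if i: "i \<in> {1..n}" for i
  proof -
    have z: "raise n (mulX i B - raise n (b i)) = 0"
      using b(2)[OF i] unfolding aB raise.diff by (simp add: mulX_raise)
    have "mulX i B \<in> sqf_part n d" "raise n (b i) \<in> sqf_part n d"
      using mulX_sqf_part[OF B i] raise_sqf_part[OF b(1)[OF i]] by simp_all
    then have "mulX i B - raise n (b i) = 0"
      by (rule inj[OF fs.subspace_diff[OF subspace_sqf_part] z a(2)])
    then show ?thesis by simp
  qed
  \<comment> \<open>From \<open>s x\<^sub>i b\<^sub>i = x\<^sub>i\<^sup>2 b = 0\<close> it follows that \<open>b\<^sub>i\<close> is a multiple of \<open>x\<^sub>i\<close>.\<close>
  define c where "c i = derX i (b i)" for i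
  have c: "c i \<in> sqf_part n (d - 2)" if i: "i \<in> {1..n}" for i
    using derX_sqf_part[OF b(1)[OF i], of i] by (simp add: c_def)
  have bc: "b i = mulX i (c i)" if i: "i \<in> {1..n}" for i
  proof -
    have "raise n (mulX i (b i)) = mulX i (mulX i B)"
      using XB[OF i] by (simp add: mulX_raise)
    then have z: "raise n (mulX i (b i)) = 0" by (simp add: mulX_mulX_same)
    have "mulX i (b i) \<in> sqf_part n d"
      using mulX_sqf_part[OF b(1)[OF i] i] by simp
    then have "mulX i (b i) = 0"
      by (rule inj[OF _ z a(2)])
    then show ?thesis unfolding c_def by (rule mulX_eq_0_imp)
  qed
  have key: "B - raise n (c i) = mulX i (derX i B) - b i" if i: "i \<in> {1..n}" for i
  proof -
    have "mulX i (B - raise n (c i)) = 0"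
      using XB[OF i] by (simp add: mulX.diff mulX_raise flip: bc[OF i])
    then have *: "B - raise n (c i) = mulX i (derX i (B - raise n (c i)))"
      by (rule mulX_eq_0_imp)
    have "derX i (c i) = 0"
      by (auto simp: c_def derX_def fun_eq_iff scl_apply)
    then have "derX i (raise n (c i)) = c i"
      by (simp add: derX_raise[OF i] raise.zero mulX.zero)
    then show ?thesis using * by (simp add: derX.diff mulX.diff bc[OF i, symmetric])
  qed
  define C where "C = (\<Sum>i=1..n. c i)"
  have C: "C \<in> sqf_part n (d - 2)"
    unfolding C_def by (intro fs.subspace_sum subspace_sqf_part c)
  have "(\<Sum>i=1..n. B - raise n (c i)) = (\<Sum>i=1..n. mulX i (derX i B)) - B"
    unfolding B_def[symmetric] sum_subtractf[symmetric] using key by (simp add: sum_subtractf B_def)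
  moreover have "(\<Sum>i=1..n. B - raise n (c i)) = scl (of_nat n) B - raise n C"
    by (simp add: sum_subtractf raise.sum C_def) (simp add: fun_eq_iff scl_apply sum_fun_apply)
  ultimately have eq: "scl (of_nat n) B - raise n C = scl (of_int (d - 1)) B - B"
    using euler_sqf_part[OF B] by simp
  \<comment> \<open>Here \<open>d - 1\<close> is the degree of \<open>b\<close>, contributed by Euler's formula.\<close>
  have "scl (of_int (int n + 2 - d)) B = raise n C"
  proof
    fix x
    have "of_nat n * B x - raise n C x = of_int (d - 1) * B x - B x"
      using eq by (simp add: fun_eq_iff scl_apply)
    then show "scl (of_int (int n + 2 - d)) B x = raise n C x"
      by (simp add: scl_apply algebra_simps)
  qed
  \<comment> \<open>For \<open>d < 2\<close> the scalar may exceed \<open>n\<close>, but then every \<open>c\<^sub>i\<close> has negative degree.\<close>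
  show ?thesis
  proof (cases "d \<ge> 2")
    case True
    have nz: "(of_int (int n + 2 - d) :: 'k) \<noteq> 0"
      using a(2) True by (intro of_int_neq_0[OF char]) auto
    have "a = raise n (raise n (scl (inverse (of_int (int n + 2 - d))) C))"
      unfolding raise.scale[of _ _ C] \<open>scl _ B = raise n C\<close>[symmetric]
      using nz by (simp add: aB)
    moreover have "scl (inverse (of_int (int n + 2 - d))) C \<in> sqf n"
      using C sqf_part_subset by (intro fs.subspace_scale subspace_sqf) blast
    ultimately show ?thesis unfolding sq_multiples_def by blast
  next
    case False
    then have "c i = 0" if "i \<in> {1..n}" for i
      using c[OF that] by (intro sqf_part_neg) auto
    then have "B = 0" unfolding B_def by (intro sum.neutral) (auto simp: bc mulX.zero)
    then show ?thesis
      using aB fs.subspace_0[OF subspace_sq_multiples] by (simp add: raise.zero)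
  qed
qed

section \<open>Dimensions of subspaces\<close>

text \<open>
  Besides completing a basis, the chosen complement has the property that its vectors can be added one
  at a time, in any order, each leaving the span of the previous ones. This matches the inductive
  definition of dimension in the quotient ring.
\<close>

lemma (in vector_space) finite_complement:
  assumes "subspace U" "subspace W" "U \<subseteq> W" "W \<subseteq> span T" "finite T"
  obtains C where "finite C" "C \<subseteq> W" "dim U + card C = dim W" "span (U \<union> C) = W"
    "\<And>C' c. C' \<subseteq> C \<Longrightarrow> c \<in> C - C' \<Longrightarrow> c \<notin> span (U \<union> C')"
proof -
  obtain B0 where B0: "B0 \<subseteq> U" "independent B0" "U \<subseteq> span B0"
    using maximal_independent_subset[of U] by blast
  have "B0 \<subseteq> W" using B0(1) assms(3) by blast
  then obtain B where B: "B0 \<subseteq> B" "B \<subseteq> W" "independent B" "W \<subseteq> span B"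
    using maximal_independent_subset_extend[OF _ B0(2)] by blast
  have "finite B"
    using independent_span_bound[OF assms(5) B(3)] B(2) assms(4) by blast
  define C where "C = B - B0"
  have C: "finite C" "C \<subseteq> W" using \<open>finite B\<close> B(2) by (auto simp: C_def)
  have "card B0 + card C = card B"
    using \<open>finite B\<close> B(1) by (simp add: C_def card_Diff_subset finite_subset card_mono)
  then have dim: "dim U + card C = dim W"
    using basis_card_eq_dim[OF B0(1,3,2)] basis_card_eq_dim[OF B(2,4,3)] by simp
  have "B \<subseteq> U \<union> C" using B0(1) by (auto simp: C_def)
  then have "W \<subseteq> span (U \<union> C)" using B(4) span_mono by blast
  moreover have "span (U \<union> C) \<subseteq> W"
    using assms(2,3) C(2) by (intro span_minimal) auto
  ultimately have sp: "span (U \<union> C) = W" by blast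
  have flag: "c \<notin> span (U \<union> C')" if "C' \<subseteq> C" "c \<in> C - C'" for C' c
  proof
    assume "c \<in> span (U \<union> C')"
    moreover have "span (U \<union> C') \<subseteq> span (B0 \<union> C')"
      using B0(3) span_mono[of B0 "B0 \<union> C'"] span_superset[of "B0 \<union> C'"]
      by (intro span_minimal subspace_span) auto
    moreover have "span (B0 \<union> C') \<subseteq> span (B - {c})"
      using that B(1) by (intro span_mono) (auto simp: C_def)
    ultimately have "c \<in> span (B - {c})" by blast
    moreover have "c \<in> B" using that by (auto simp: C_def)
    ultimately show False using B(3) dependent_def by blast
  qed
  show ?thesis by (rule that[OF C dim sp flag])
qed

lemma (in vector_space) dim_mono_finite:
  assumes "U \<subseteq> W" "W \<subseteq> span T" "finite T"
  shows "dim U \<le> dim W"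
proof -
  obtain B0 where B0: "B0 \<subseteq> U" "independent B0" "U \<subseteq> span B0"
    using maximal_independent_subset[of U] by blast
  have "B0 \<subseteq> W" using B0(1) assms(1) by blast
  then obtain B where B: "B0 \<subseteq> B" "B \<subseteq> W" "independent B" "W \<subseteq> span B"
    using maximal_independent_subset_extend[OF _ B0(2)] by blast
  have "finite B"
    using independent_span_bound[OF assms(3) B(3)] B(2) assms(2) by blast
  then have "card B0 \<le> card B" using B(1) card_mono by blast
  then show ?thesis
    using basis_card_eq_dim[OF B0(1,3,2)] basis_card_eq_dim[OF B(2,4,3)] by simp
qed

lemma (in vector_space) subspace_eq_of_dim_eq:
  assumes "subspace U" "subspace W" "U \<subseteq> W" "W \<subseteq> span T" "finite T" "dim U = dim W"
  shows "U = W"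
proof -
  obtain C where "finite C" "dim U + card C = dim W" "span (U \<union> C) = W"
    using finite_complement[OF assms(1-5)] by metis
  then have "span U = W" using assms(6) by simp
  then show ?thesis using assms(1) by (metis span_subspace span_superset subset_refl)
qed

text \<open>
  A complement of the kernel is mapped to a basis of the image.
\<close>

lemma dim_kernel_plus_image:
  fixes T :: "('a \<Rightarrow> 'k::field) \<Rightarrow> 'b \<Rightarrow> 'k"
  assumes "Vector_Spaces.linear scl scl T" "fs.subspace W" "W \<subseteq> fs.span X" "finite X"
  shows "fs.dim {w \<in> W. T w = 0} + fs.dim (T ` W) = fs.dim W"
proof -
  interpret T: Vector_Spaces.linear scl scl T by fact
  let ?U = "{w \<in> W. T w = 0}"
  have U: "fs.subspace ?U"
    using fs.subspace_inter[OF assms(2) T.subspace_kernel] by (simp add: Collect_conj_eq)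
  obtain C where C: "finite C" "C \<subseteq> W" "fs.dim ?U + card C = fs.dim W" "fs.span (?U \<union> C) = W"
    and flag: "\<And>C' c. C' \<subseteq> C \<Longrightarrow> c \<in> C - C' \<Longrightarrow> c \<notin> fs.span (?U \<union> C')"
    using fs.finite_complement[OF U assms(2) _ assms(3,4)] by blast
  have "fs.independent (T ` C') \<and> card (T ` C') = card C'" if "C' \<subseteq> C" for C'
    using finite_subset[OF that C(1)] that
  proof (induction C' rule: finite_induct)
    case (insert c D)
    have "T c \<notin> fs.span (T ` D)"
    proof
      assume "T c \<in> fs.span (T ` D)"
      then obtain x where x: "x \<in> fs.span D" "T c = T x"
        by (auto simp: T.span_image)
      have "x \<in> W" using x(1) insert.prems C(2) assms(2) fs.span_minimal[of D W] by blast
      then have "c - x \<in> ?U"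
        using x(2) insert.prems C(2) assms(2) by (auto simp: T.diff fs.subspace_diff)
      then have "c - x \<in> fs.span (?U \<union> D)" by (intro fs.span_base) blast
      moreover have "x \<in> fs.span (?U \<union> D)" using x(1) fs.span_mono[of D "?U \<union> D"] by blast
      ultimately have "c - x + x \<in> fs.span (?U \<union> D)" by (rule fs.span_add)
      then show False using flag[of D c] insert by simp
    qed
    moreover from this have "T c \<notin> T ` D" using fs.span_superset[of "T ` D"] by blast
    moreover have IH: "fs.independent (T ` D)" "card (T ` D) = card D"
      using insert.IH insert.prems by blast+
    ultimately have "fs.independent (insert (T c) (T ` D))" by (intro fs.independent_insertI)
    moreover have "card (insert (T c) (T ` D)) = card (insert c D)"
      using insert.hyps IH(2) \<open>T c \<notin> T ` D\<close> by simp
    ultimately show ?case by (simp only: image_insert simp_thms)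
  qed (simp add: fs.independent_empty)
  then have TC: "fs.independent (T ` C)" "card (T ` C) = card C" by auto
  have "T ` W = fs.span (T ` (?U \<union> C))"
    by (simp only: T.span_image C(4))
  also have "\<dots> = fs.span (T ` C)"
  proof
    have "T ` (?U \<union> C) \<subseteq> fs.span (T ` C)"
      by (auto intro: fs.span_base simp: fs.span_zero)
    then show "fs.span (T ` (?U \<union> C)) \<subseteq> fs.span (T ` C)"
      by (intro fs.span_minimal fs.subspace_span)
  qed (intro fs.span_mono, blast)
  finally have "fs.dim (T ` W) = card C"
    using fs.dim_span_eq_card_independent[OF TC(1)] TC(2) by simp
  then show ?thesis using C(3) by simp
qed

definition delta :: "'a \<Rightarrow> 'a \<Rightarrow> 'k::field" where
  "delta x = (\<lambda>y. if y = x then 1 else 0)"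

lemma expand_delta:
  assumes "finite X" "\<And>x. f x \<noteq> 0 \<Longrightarrow> x \<in> X"
  shows "f = (\<Sum>x\<in>X. scl (f x) (delta x))"
proof
  fix y
  have "(\<Sum>x\<in>X. scl (f x) (delta x)) y = (\<Sum>x\<in>X. if y = x then f x else 0)"
    unfolding sum_fun_apply by (intro sum.cong) (auto simp: delta_def scl_apply)
  also have "\<dots> = f y"
    using assms by auto
  finally show "f y = (\<Sum>x\<in>X. scl (f x) (delta x)) y" by simp
qed

text \<open>
  A function supported away from \<open>x\<close> is not \<open>delta x\<close>, so the basis vectors can be added one by one.
\<close>

lemma independent_delta:
  "finite X \<Longrightarrow> fs.independent (delta ` X :: ('a \<Rightarrow> 'k::field) set)"
proof (induction X rule: finite_induct)
  case (insert x X)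
  have "fs.span (delta ` X :: ('a \<Rightarrow> 'k) set) \<subseteq> {f. \<forall>y. f y \<noteq> 0 \<longrightarrow> y \<noteq> x}"
    using insert(2) by (intro fs.span_minimal subspace_support) (auto simp: delta_def split: if_splits)
  moreover have "(delta x :: 'a \<Rightarrow> 'k) \<notin> {f. \<forall>y. f y \<noteq> 0 \<longrightarrow> y \<noteq> x}"
    by (simp add: delta_def)
  ultimately have "(delta x :: 'a \<Rightarrow> 'k) \<notin> fs.span (delta ` X)" by blast
  then show ?case unfolding image_insert using insert.IH by (rule fs.independent_insertI)
qed (simp add: fs.independent_empty)

lemma delta_eq_iff: "(delta x :: 'a \<Rightarrow> 'k::field) = delta y \<longleftrightarrow> x = y"
proof
  assume "(delta x :: 'a \<Rightarrow> 'k) = delta y"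
  then have "(delta x x :: 'k) = delta y x" by simp
  then show "x = y" by (simp add: delta_def split: if_splits)
qed simp

lemma span_delta:
  assumes "finite X"
  shows "{f :: 'a \<Rightarrow> 'k::field. \<forall>x. f x \<noteq> 0 \<longrightarrow> x \<in> X} = fs.span (delta ` X)"
proof
  show "{f :: 'a \<Rightarrow> 'k. \<forall>x. f x \<noteq> 0 \<longrightarrow> x \<in> X} \<subseteq> fs.span (delta ` X)"
  proof
    fix f :: "'a \<Rightarrow> 'k" assume "f \<in> {f. \<forall>x. f x \<noteq> 0 \<longrightarrow> x \<in> X}"
    then have "f = (\<Sum>x\<in>X. scl (f x) (delta x))" by (intro expand_delta assms) auto
    also have "\<dots> \<in> fs.span (delta ` X)"
      by (intro fs.span_sum fs.span_scale fs.span_base) auto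
    finally show "f \<in> fs.span (delta ` X)" .
  qed
  show "fs.span (delta ` X) \<subseteq> {f :: 'a \<Rightarrow> 'k. \<forall>x. f x \<noteq> 0 \<longrightarrow> x \<in> X}"
    by (intro fs.span_minimal subspace_support) (auto simp: delta_def split: if_splits)
qed

lemma dim_support:
  assumes "finite X"
  shows "fs.dim {f :: 'a \<Rightarrow> 'k::field. \<forall>x. f x \<noteq> 0 \<longrightarrow> x \<in> X} = card X"
  unfolding span_delta[OF assms] fs.dim_span_eq_card_independent[OF independent_delta[OF assms]]
  by (simp add: card_image inj_on_def delta_eq_iff)

lemma sqf_span: "sqf n = fs.span (delta ` Pow {1..n})"
  using span_delta[of "Pow {1..n}"] by (simp add: sqf_def)

lemma sqf_part_span: "sqf_part n d \<subseteq> fs.span (delta ` Pow {1..n})"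
  using sqf_part_subset sqf_span by blast

lemma dim_sqf_part: 
  "fs.dim (sqf_part n d :: (nat set \<Rightarrow> 'k::field) set) = (if d < 0 then 0 else n choose (nat d))"
proof -
  let ?X = "{S. S \<subseteq> {1..n} \<and> int (card S) = d}"
  have "fs.dim (sqf_part n d :: (nat set \<Rightarrow> 'k) set) = card ?X"
    using dim_support[of ?X, where 'k = 'k] by (simp add: sqf_part_def)
  also have "\<dots> = (if d < 0 then 0 else n choose (nat d))"
  proof (cases "d < 0")
    case False
    then have "?X = {S. S \<subseteq> {1..n} \<and> card S = nat d}" by auto
    then show ?thesis using n_subsets[of "{1..n}" "nat d"] False by simp
  qed auto
  finally show ?thesis .
qed

section \<open>The pairing of complementary degrees\<close>

text \<open>
  The coefficient of \<open>x\<^sub>1 \<cdots> x\<^sub>n\<close> in the product of \<open>f\<close> and \<open>g\<close>.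
\<close>

definition pairing :: "nat \<Rightarrow> (nat set \<Rightarrow> 'k::field) \<Rightarrow> (nat set \<Rightarrow> 'k) \<Rightarrow> 'k" where
  "pairing n f g = (\<Sum>S\<in>Pow {1..n}. f S * g ({1..n} - S))"

lemma pairing_commute: "pairing n f g = pairing n g f"
  unfolding pairing_def
  by (rule sum.reindex_bij_witness[of _ "\<lambda>S. {1..n} - S" "\<lambda>S. {1..n} - S"])
     (auto simp: double_diff mult.commute)

lemma pairing_add: "pairing n f (g + h) = pairing n f g + pairing n f h"
  by (simp add: pairing_def algebra_simps sum.distrib)

lemma pairing_zero: "pairing n f 0 = 0"
  by (simp add: pairing_def)

lemma pairing_zero_left: "pairing n 0 f = 0"
  by (simp add: pairing_def)

lemma pairing_sum: "pairing n f (\<Sum>x\<in>X. g x) = (\<Sum>x\<in>X. pairing n f (g x))"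
  by (induction X rule: infinite_finite_induct)
     (simp_all only: sum.infinite sum.empty sum.insert pairing_zero pairing_add not_False_eq_True)

text \<open>
  Both sides are the coefficient of \<open>x\<^sub>1 \<cdots> x\<^sub>n\<close> in \<open>x\<^sub>i f g\<close>; on coefficients this is a
  reindexing by \<open>S \<mapsto> S - {i}\<close>.
\<close>

lemma pairing_mulX:
  assumes "i \<in> {1..n}"
  shows "pairing n (mulX i f) g = pairing n f (mulX i g)"
proof -
  have "pairing n (mulX i f) g = (\<Sum>S\<in>Pow {1..n}. if i \<in> S then f (S - {i}) * g ({1..n} - S) else 0)"
    unfolding pairing_def by (intro sum.cong) (auto simp: mulX_def)
  also have "\<dots> = (\<Sum>S\<in>{S\<in>Pow {1..n}. i \<in> S}. f (S - {i}) * g ({1..n} - S))"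
    by (intro sum.inter_filter[symmetric]) simp
  also have "\<dots> = (\<Sum>S\<in>{S\<in>Pow {1..n}. i \<notin> S}. f S * g ({1..n} - S - {i}))"
  proof (rule sum.reindex_bij_witness[of _ "insert i" "\<lambda>S. S - {i}"])
    fix S assume S: "S \<in> {S \<in> Pow {1..n}. i \<in> S}"
    then have "{1..n} - (S - {i}) - {i} = {1..n} - S" by blast
    then show "f (S - {i}) * g ({1..n} - (S - {i}) - {i}) = f (S - {i}) * g ({1..n} - S)" by simp
  qed (use assms in auto)
  also have "\<dots> = (\<Sum>S\<in>Pow {1..n}. if i \<notin> S then f S * g ({1..n} - S - {i}) else 0)"
    by (intro sum.inter_filter) simp
  also have "\<dots> = pairing n f (mulX i g)"
    unfolding pairing_def using assms by (intro sum.cong) (auto simp: mulX_def)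
  finally show ?thesis .
qed

lemma pairing_raise: "pairing n (raise n f) g = pairing n f (raise n g)"
proof -
  have "pairing n (raise n f) g = (\<Sum>i=1..n. pairing n (mulX i f) g)"
    unfolding raise_def by (subst pairing_commute, subst pairing_sum) (simp add: pairing_commute)
  also have "\<dots> = (\<Sum>i=1..n. pairing n f (mulX i g))"
    by (intro sum.cong pairing_mulX) auto
  also have "\<dots> = pairing n f (raise n g)"
    unfolding raise_def by (simp add: pairing_sum)
  finally show ?thesis .
qed

text \<open>
  Only parts of complementary degree pair nontrivially.
\<close>

lemma pairing_hom_component:
  assumes "f \<in> sqf_part n d"
  shows "pairing n g f = pairing n (hom_component (int n - d) g) f"
  unfolding pairing_def
proof (intro sum.cong refl)
  fix S assume S: "S \<in> Pow {1..n}"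
  show "g S * f ({1..n} - S) = hom_component (int n - d) g S * f ({1..n} - S)"
  proof (cases "f ({1..n} - S) = 0")
    case False
    then have "int (card ({1..n} - S)) = d" using assms by (simp add: sqf_part_def)
    moreover have "card S \<le> n" "card ({1..n} - S) = n - card S"
      using S card_mono[of "{1..n}" S] by (auto simp: card_Diff_subset finite_subset)
    ultimately have "int (card S) = int n - d" by linarith
    then show ?thesis by (simp add: hom_component_def)
  qed simp
qed

lemma pairing_nondegenerate:
  assumes "f \<in> sqf n" "\<And>g. g \<in> sqf n \<Longrightarrow> pairing n f g = 0"
  shows "f = 0"
proof
  fix S show "f S = 0 S"
  proof (cases "S \<subseteq> {1..n}")
    case True
    have "pairing n f (delta ({1..n} - S)) = (\<Sum>T\<in>Pow {1..n}. if T = S then f T else 0)"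
      unfolding pairing_def using True by (intro sum.cong) (auto simp: delta_def)
    also have "\<dots> = f S" using True by simp
    finally have "pairing n f (delta ({1..n} - S)) = f S" .
    moreover have "delta ({1..n} - S) \<in> sqf n" by (auto simp: sqf_def delta_def)
    ultimately have "f S = 0" using assms(2) by metis
    then show ?thesis by simp
  next
    case False
    then show ?thesis using assms(1) by (auto simp: sqf_def)
  qed
qed

text \<open>
  A linear functional that vanishes on \<open>V\<close> but not at \<open>a\<close> exists because a basis of \<open>V\<close> stays
  independent when \<open>a\<close> is added. Every functional is a pairing with some \<open>g\<close>, whose value at \<open>S\<close> is
  the value of the functional at the complementary monomial.
\<close>

lemma pairing_separates:
  fixes a :: "nat set \<Rightarrow> 'k::field"
  assumes "fs.subspace V" "V \<subseteq> sqf n" "a \<in> sqf n" "a \<notin> V"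
  obtains g where "g \<in> sqf n" "\<And>v. v \<in> V \<Longrightarrow> pairing n g v = 0" "pairing n g a \<noteq> 0"
proof -
  interpret vp: vector_space_pair "scl :: 'k \<Rightarrow> (nat set \<Rightarrow> 'k) \<Rightarrow> _" "(*) :: 'k \<Rightarrow> 'k \<Rightarrow> 'k"
    by unfold_locales (simp_all add: algebra_simps)
  obtain B where B: "B \<subseteq> V" "fs.independent B" "V \<subseteq> fs.span B"
    using fs.maximal_independent_subset[of V] by blast
  have "fs.span B \<subseteq> V" using B(1) assms(1) by (rule fs.span_minimal)
  then have a: "a \<notin> fs.span B" using assms(4) by blast
  then have "fs.independent (insert a B)" using B(2) by (rule fs.independent_insertI)
  then obtain \<phi> where \<phi>: "Vector_Spaces.linear scl (*) \<phi>"
      and \<phi>': "\<forall>x\<in>insert a B. \<phi> x = (if x = a then 1 else 0)"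
    using vp.linear_independent_extend[of "insert a B" "\<lambda>x. if x = a then 1 else 0"] by blast
  interpret \<phi>: Vector_Spaces.linear "scl :: 'k \<Rightarrow> (nat set \<Rightarrow> 'k) \<Rightarrow> _" "(*) :: 'k \<Rightarrow> 'k \<Rightarrow> 'k" \<phi> by fact
  have "a \<notin> B" using a fs.span_base by blast
  have V0: "\<phi> v = 0" if "v \<in> V" for v
  proof -
    have "\<phi> b = 0" if "b \<in> B" for b using that \<phi>' \<open>a \<notin> B\<close> by auto
    then show ?thesis by (rule \<phi>.eq_0_on_span[OF _ subsetD[OF B(3) that]])
  qed
  define g where "g S = (if S \<subseteq> {1..n} then \<phi> (delta ({1..n} - S)) else 0)" for S
  have g: "pairing n g f = \<phi> f" if "f \<in> sqf n" for f
  proof -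
    have "pairing n g f = (\<Sum>S\<in>Pow {1..n}. f S * \<phi> (delta S))"
      unfolding pairing_def
      by (rule sum.reindex_bij_witness[of _ "\<lambda>S. {1..n} - S" "\<lambda>S. {1..n} - S"])
         (auto simp: double_diff g_def)
    also have "\<dots> = \<phi> (\<Sum>S\<in>Pow {1..n}. scl (f S) (delta S))"
      by (simp add: \<phi>.sum \<phi>.scale)
    also have "(\<Sum>S\<in>Pow {1..n}. scl (f S) (delta S)) = f"
      using that by (intro expand_delta[symmetric]) (auto simp: sqf_def)
    finally show ?thesis .
  qed
  show ?thesis
  proof (rule that)
    show "g \<in> sqf n" by (simp add: sqf_def g_def)
    show "pairing n g v = 0" if "v \<in> V" for v using that g V0 assms(2) by auto
    show "pairing n g a \<noteq> 0" using g[OF assms(3)] \<phi>' by simp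
  qed
qed

lemma sq_multiples_sqf: "sq_multiples n \<subseteq> sqf n"
  by (auto simp: sq_multiples_def raise_sqf)

lemma sq_annihilator_orthogonal:
  assumes "f \<in> sq_annihilator n" "g \<in> sq_multiples n"
  shows "pairing n f g = 0"
proof -
  obtain h where "g = raise n (raise n h)" using assms(2) by (auto simp: sq_multiples_def)
  then have "pairing n f g = pairing n (raise n (raise n f)) h" by (simp add: pairing_raise)
  also have "raise n (raise n f) = 0" using assms(1) by (simp add: sq_annihilator_def)
  finally show ?thesis by (simp add: pairing_zero_left)
qed

text \<open>
  The orthogonal complement of \<open>s\<^sup>2 A\<close> is contained in the annihilator of \<open>s\<^sup>2\<close>, since \<open>s\<^sup>2\<close> is
  self-adjoint and the pairing is nondegenerate. A separating vector can be replaced by its part of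
  the complementary degree.
\<close>

lemma sq_annihilator_detects:
  assumes "a \<in> sqf_part n d" "a \<notin> sq_multiples n"
  obtains g where "g \<in> sq_annihilator n" "g \<in> sqf_part n (int n - d)" "pairing n g a \<noteq> 0"
proof -
  have "a \<in> sqf n" using assms(1) sqf_part_subset by blast
  then obtain g where g: "g \<in> sqf n" "\<And>v. v \<in> sq_multiples n \<Longrightarrow> pairing n g v = 0" "pairing n g a \<noteq> 0"
    using pairing_separates[OF subspace_sq_multiples sq_multiples_sqf _ assms(2)] by metis
  have "raise n (raise n g) = 0"
  proof (rule pairing_nondegenerate)
    show "raise n (raise n g) \<in> sqf n" using g(1) by (intro raise_sqf)
    show "pairing n (raise n (raise n g)) h = 0" if "h \<in> sqf n" for h
      using that g(2)[of "raise n (raise n h)"] by (simp add: pairing_raise sq_multiples_def)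
  qed
  then have "g \<in> sq_annihilator n" using g(1) by (simp add: sq_annihilator_def)
  then show ?thesis
    using that[of "hom_component (int n - d) g"] hom_component_sq_annihilator hom_component_sqf_part[OF g(1)]
      pairing_hom_component[OF assms(1), of g] g(3) by metis
qed

text \<open>
  Dual to injectivity: an element outside \<open>s\<^sup>2 A\<close> would be detected by an annihilated element of
  degree \<open>n - d\<close>, but \<open>s\<^sup>2\<close> is injective there.
\<close>

lemma sq_multiples_high_degree:
  fixes a :: "nat set \<Rightarrow> 'k::field"
  assumes char: "CHAR('k) > n \<or> CHAR('k) = 0"
    and a: "a \<in> sqf_part n d" "2 * d \<ge> int n + 2"
  shows "a \<in> sq_multiples n"
proof (rule ccontr)
  assume "a \<notin> sq_multiples n"
  then obtain g where g: "g \<in> sq_annihilator n" "g \<in> sqf_part n (int n - d)" "pairing n g a \<noteq> 0"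
    using sq_annihilator_detects[OF a(1)] by metis
  have "g = 0"
    using g(1,2) a(2) by (intro raise_raise_inj[OF char g(2)]) (auto simp: sq_annihilator_def)
  then show False using g(3) by (simp add: pairing_zero_left)
qed

text \<open>
  Dual to the vanishing of the socle below the top degree. If \<open>b\<close> is not reached from degree
  \<open>j - 1\<close>, some \<open>a\<close> of degree \<open>n - j\<close> is orthogonal to everything that is, but not to \<open>b\<close>. Then
  each \<open>x\<^sub>i a\<close> is orthogonal to the annihilator in degree \<open>j - 1\<close> and so lies in \<open>s\<^sup>2 A\<close>. Hence \<open>a\<close>
  itself lies in \<open>s\<^sup>2 A\<close>, which makes it orthogonal to \<open>b\<close>.
\<close>

lemma sq_annihilator_generated_below:
  fixes b :: "nat set \<Rightarrow> 'k::field"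
  assumes char: "CHAR('k) > n \<or> CHAR('k) = 0"
    and b: "b \<in> sq_annihilator n" "b \<in> sqf_part n j" "2 * j \<ge> int n + 1"
  shows "b \<in> fs.span {mulX i k | i k. i \<in> {1..n} \<and> k \<in> sq_annihilator n \<inter> sqf_part n (j - 1)}"
    (is "b \<in> fs.span ?X")
proof (rule ccontr)
  assume nb: "b \<notin> fs.span ?X"
  have X: "?X \<subseteq> sqf_part n j" using mulX_sqf_part[where d = "j - 1"] by auto
  then have V: "fs.span ?X \<subseteq> sqf_part n j" by (intro fs.span_minimal subspace_sqf_part)
  have bs: "b \<in> sqf n" using b(2) sqf_part_subset by blast
  obtain g where g: "g \<in> sqf n" "\<And>v. v \<in> fs.span ?X \<Longrightarrow> pairing n g v = 0" "pairing n g b \<noteq> 0"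
    using pairing_separates[OF fs.subspace_span _ bs nb] V sqf_part_subset by blast
  define a where "a = hom_component (int n - j) g"
  have a: "a \<in> sqf_part n (int n - j)" unfolding a_def by (rule hom_component_sqf_part[OF g(1)])
  have pa: "pairing n a v = pairing n g v" if "v \<in> sqf_part n j" for v
    unfolding a_def by (rule pairing_hom_component[OF that, symmetric])
  have "mulX i a \<in> sq_multiples n" if i: "i \<in> {1..n}" for i
  proof (rule ccontr)
    assume "mulX i a \<notin> sq_multiples n"
    then obtain k where k: "k \<in> sq_annihilator n" "k \<in> sqf_part n (int n - (int n - j + 1))"
        "pairing n k (mulX i a) \<noteq> 0"
      using sq_annihilator_detects[OF mulX_sqf_part[OF a i]] by metis
    have ik: "mulX i k \<in> ?X" using k(1,2) i by (auto simp: algebra_simps)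
    have "pairing n a (mulX i k) = 0"
      unfolding pa[OF subsetD[OF X ik]] by (rule g(2)[OF fs.span_base[OF ik]])
    then show False using k(3) pairing_mulX[OF i, of k a] by (metis pairing_commute)
  qed
  then have "a \<in> sq_multiples n"
    using b(3) by (intro sq_multiples_of_mulX_low_degree[OF char a]) auto
  then have "pairing n b a = 0" using b(1) by (rule sq_annihilator_orthogonal[rotated])
  then show False using g(3) pa[OF b(2)] by (simp add: pairing_commute)
qed

lemma sq_annihilator_low:
  fixes f :: "nat set \<Rightarrow> 'k::field"
  assumes char: "CHAR('k) > n \<or> CHAR('k) = 0"
    and f: "f \<in> sq_annihilator n" and j: "j < int (n div 2)"
  shows "hom_component j f = 0"
proof -
  have "hom_component j f \<in> sqf_part n j" using f by (simp add: sq_annihilator_def hom_component_sqf_part)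
  moreover have "raise n (raise n (hom_component j f)) = 0"
    using hom_component_sq_annihilator[OF f, of j] by (simp add: sq_annihilator_def)
  moreover have "2 * j + 2 \<le> int n"
  proof -
    have "\<not> int n div 2 \<le> j" using j by (simp add: zdiv_int)
    then show ?thesis by presburger
  qed
  ultimately show ?thesis by (rule raise_raise_inj[OF char])
qed

lemma sq_annihilator_generated:
  fixes W :: "(nat set \<Rightarrow> 'k::field) set"
  assumes char: "CHAR('k) > n \<or> CHAR('k) = 0"
    and W: "fs.subspace W" "\<And>i f. i \<in> {1..n} \<Longrightarrow> f \<in> W \<Longrightarrow> mulX i f \<in> W"
    and low: "sq_annihilator n \<inter> sqf_part n (int (n div 2)) \<subseteq> W"
  shows "sq_annihilator n \<subseteq> W"
proof
  fix f :: "nat set \<Rightarrow> 'k" assume f: "f \<in> sq_annihilator n"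
  have part: "sq_annihilator n \<inter> sqf_part n j \<subseteq> W" if "j \<ge> int (n div 2)" for j
    using that
  proof (induction j rule: int_ge_induct)
    case base
    then show ?case by (rule low)
  next
    case (step j)
    have "(sq_annihilator n \<inter> sqf_part n (j + 1) :: (nat set \<Rightarrow> 'k) set) \<subseteq>
        fs.span {mulX i k | i k. i \<in> {1..n} \<and> k \<in> sq_annihilator n \<inter> sqf_part n (j + 1 - 1)}"
    proof
      fix x :: "nat set \<Rightarrow> 'k" assume x: "x \<in> sq_annihilator n \<inter> sqf_part n (j + 1)"
      have "2 * (j + 1) \<ge> int n + 1"
      proof -
        have "int n div 2 \<le> j" using step.hyps by (simp add: zdiv_int)
        then show ?thesis by presburger
      qed
      then show "x \<in> fs.span {mulX i k | i k. i \<in> {1..n} \<and> k \<in> sq_annihilator n \<inter> sqf_part n (j + 1 - 1)}"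
        using x by (intro sq_annihilator_generated_below[OF char]) blast+
    qed
    also have "\<dots> \<subseteq> W"
      using step.IH W(2) by (intro fs.span_minimal W(1)) auto
    finally show ?case .
  qed
  have "hom_component j f \<in> W" for j
  proof (cases "j \<ge> int (n div 2)")
    case True
    have "f \<in> sqf n" using f by (simp add: sq_annihilator_def)
    then show ?thesis using part[OF True] hom_component_sqf_part hom_component_sq_annihilator[OF f] by blast
  next
    case False
    then have "hom_component j f = 0" by (intro sq_annihilator_low[OF char f]) simp
    then show ?thesis using fs.subspace_0[OF W(1)] by simp
  qed
  moreover have "f = (\<Sum>d=0..int n. hom_component d f)"
    using f by (intro sum_hom_component) (simp add: sq_annihilator_def)
  ultimately show "f \<in> W" using fs.subspace_sum[OF W(1)] by metis
qed

section \<open>Catalan numbers as dimensions\<close>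

lemma catalan_plus: "catalan k + (2 * k choose Suc k) = (2 * k choose k)"
proof -
  have "Suc k * (2 * k choose Suc k) = (2 * k - k) * (2 * k choose k)"
    by (simp only: binomial_absorption binomial_absorb_comp)
  then have "Suc k * (2 * k choose Suc k) = k * (2 * k choose k)"
    by simp
  also have "\<dots> = Suc k * (k * catalan k)"
    unfolding catalan_exact[symmetric] by (simp add: algebra_simps)
  finally have "(2 * k choose Suc k) = k * catalan k" by (simp only: mult_cancel1) simp
  then show ?thesis using catalan_exact[of k] by simp
qed

text \<open>
  For \<open>n = 2k\<close> and \<open>n = 2k + 1\<close> this follows from \<open>catalan_plus\<close> at \<open>k + 1\<close> by applying Pascal's rule
  once or twice.
\<close>

lemma catalan_eq_central_binomials:
  "catalan (n div 2 + 1) + (n choose (n div 2 + 2)) = (n choose (n div 2))"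
proof -
  define k where "k = n div 2"
  have cat: "catalan (k + 1) + (2 * k + 2 choose (k + 2)) = (2 * k + 2 choose (k + 1))"
    using catalan_plus[of "k + 1"] by simp
  have p1: "(2 * k + 2 choose (k + 2)) = (2 * k + 1 choose (k + 1)) + (2 * k + 1 choose (k + 2))"
           "(2 * k + 2 choose (k + 1)) = (2 * k + 1 choose k) + (2 * k + 1 choose (k + 1))"
    using binomial_Suc_Suc[of "2 * k + 1" "k + 1"] binomial_Suc_Suc[of "2 * k + 1" "k"] by simp_all
  have odd: "catalan (k + 1) + (2 * k + 1 choose (k + 2)) = (2 * k + 1 choose k)"
    using cat p1 by linarith
  have p2: "(2 * k + 1 choose (k + 2)) = (2 * k choose (k + 1)) + (2 * k choose (k + 2))"
           "(2 * k + 1 choose (k + 1)) = (2 * k choose k) + (2 * k choose (k + 1))"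
    using binomial_Suc_Suc[of "2 * k" "k + 1"] binomial_Suc_Suc[of "2 * k" "k"] by simp_all
  have "(2 * k + 1 choose k) = (2 * k + 1 choose (k + 1))"
    using binomial_symmetric[of k "2 * k + 1"] by simp
  then have even: "catalan (k + 1) + (2 * k choose (k + 2)) = (2 * k choose k)"
    using odd p2 by linarith
  have "n = 2 * k \<or> n = 2 * k + 1" by (auto simp: k_def)
  then show ?thesis
    unfolding k_def[symmetric] using odd even by auto
qed

lemma raise_raise_image_part:
  "(\<lambda>f. raise n (raise n f)) ` sqf_part n d = sq_multiples n \<inter> (sqf_part n (d + 2) :: (nat set \<Rightarrow> 'k::field) set)"
proof (intro subset_antisym subsetI)
  fix x :: "nat set \<Rightarrow> 'k" assume "x \<in> (\<lambda>f. raise n (raise n f)) ` sqf_part n d"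
  then obtain f where f: "f \<in> sqf_part n d" "x = raise n (raise n f)" by blast
  have "x \<in> sqf_part n (d + 2)"
    using raise_sqf_part[OF raise_sqf_part[OF f(1)]] f(2) by (simp add: add.assoc)
  moreover have "x \<in> sq_multiples n"
    using f sqf_part_subset unfolding sq_multiples_def by blast
  ultimately show "x \<in> sq_multiples n \<inter> sqf_part n (d + 2)" by blast
next
  fix x :: "nat set \<Rightarrow> 'k" assume x: "x \<in> sq_multiples n \<inter> sqf_part n (d + 2)"
  then obtain g where "g \<in> sqf_part n (d + 2 - 2)" "x = raise n (raise n g)"
    using sq_multiples_part[of x n "d + 2"] by blast
  then show "x \<in> (\<lambda>f. raise n (raise n f)) ` sqf_part n d" by simp
qed

text \<open>
  The operator \<open>s\<^sup>2\<close> maps degree \<open>\<lfloor>n/2\<rfloor>\<close> onto degree \<open>\<lfloor>n/2\<rfloor> + 2\<close>.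
\<close>

lemma dim_sq_annihilator:
  assumes char: "CHAR('k::field) > n \<or> CHAR('k) = 0"
  shows "fs.dim (sq_annihilator n \<inter> sqf_part n (int (n div 2)) :: (nat set \<Rightarrow> 'k) set) = catalan (n div 2 + 1)"
proof -
  let ?m = "int (n div 2)"
  let ?P = "sqf_part n :: int \<Rightarrow> (nat set \<Rightarrow> 'k) set"
  let ?T = "\<lambda>f :: nat set \<Rightarrow> 'k. raise n (raise n f)"
  have "?T ` ?P ?m = ?P (?m + 2)"
    unfolding raise_raise_image_part
  proof -
    have "2 * (?m + 2) \<ge> int n + 2" unfolding zdiv_int of_nat_numeral by presburger
    then show "sq_multiples n \<inter> ?P (?m + 2) = ?P (?m + 2)"
      using sq_multiples_high_degree[OF char, of _ "?m + 2"] by blast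
  qed
  moreover have "{w \<in> ?P ?m. ?T w = 0} = sq_annihilator n \<inter> ?P ?m"
    using sqf_part_subset by (auto simp: sq_annihilator_def)
  moreover have "fs.dim {w \<in> ?P ?m. ?T w = 0} + fs.dim (?T ` ?P ?m) = fs.dim (?P ?m)"
    by (rule dim_kernel_plus_image[OF linear_raise_raise subspace_sqf_part sqf_part_span]) simp
  ultimately have "fs.dim (sq_annihilator n \<inter> ?P ?m) + fs.dim (?P (?m + 2)) = fs.dim (?P ?m)"
    by (simp only:)
  then have "fs.dim (sq_annihilator n \<inter> ?P ?m) + (n choose (n div 2 + 2)) = (n choose (n div 2))"
    by (simp add: dim_sqf_part nat_add_distrib)
  then show ?thesis using catalan_eq_central_binomials[of n] by linarith
qed

text \<open>
  The operator \<open>s\<^sup>2\<close> is injective on degree \<open>\<lceil>n/2\<rceil> - 2\<close>. This degree is negative for \<open>n \<le> 2\<close>,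
  where both the part and the binomial coefficient vanish.
\<close>

lemma dim_sq_multiples:
  assumes char: "CHAR('k::field) > n \<or> CHAR('k) = 0"
  shows "fs.dim (sq_multiples n \<inter> sqf_part n (int (n - n div 2)) :: (nat set \<Rightarrow> 'k) set) + catalan (n div 2 + 1) =
    fs.dim (sqf_part n (int (n - n div 2)) :: (nat set \<Rightarrow> 'k) set)"
proof -
  define d where "d = int (n - n div 2) - 2"
  let ?P = "sqf_part n :: int \<Rightarrow> (nat set \<Rightarrow> 'k) set"
  let ?T = "\<lambda>f :: nat set \<Rightarrow> 'k. raise n (raise n f)"
  define e where "e = n - n div 2"
  have "2 * e \<le> n + 1" unfolding e_def by presburger
  then have d: "2 * d + 2 \<le> int n" "d + 2 = int (n - n div 2)"
    by (simp_all add: d_def flip: e_def)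
  have "{w \<in> ?P d. ?T w = 0} = {0}"
    using raise_raise_inj[OF char _ _ d(1)] sqf_part_0 by (auto simp: raise.zero)
  then have "fs.dim {w \<in> ?P d. ?T w = 0} = 0"
    using fs.dim_unique[of "{}" "{0 :: nat set \<Rightarrow> 'k}" 0] by (simp add: fs.independent_empty)
  moreover have "fs.dim {w \<in> ?P d. ?T w = 0} + fs.dim (?T ` ?P d) = fs.dim (?P d)"
    by (rule dim_kernel_plus_image[OF linear_raise_raise subspace_sqf_part sqf_part_span]) simp
  ultimately have "fs.dim (sq_multiples n \<inter> ?P (d + 2)) = fs.dim (?P d)"
    unfolding raise_raise_image_part by linarith
  also have "\<dots> = (n choose (n div 2 + 2))"
  proof (cases "d < 0")
    case True
    then have "n - n div 2 < 2" by (simp add: d_def)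
    then have "n < n div 2 + 2" by linarith
    then show ?thesis using True by (simp add: dim_sqf_part)
  next
    case False
    then have "2 \<le> n - n div 2" by (simp add: d_def)
    then have "nat d = n - (n div 2 + 2)" "n div 2 + 2 \<le> n"
      by (simp_all add: d_def nat_diff_distrib)
    then show ?thesis using False binomial_symmetric[of "n div 2 + 2" n] by (simp add: dim_sqf_part)
  qed
  finally have "fs.dim (sq_multiples n \<inter> ?P (d + 2)) = (n choose (n div 2 + 2))" .
  moreover have "fs.dim (?P (d + 2)) = (n choose (n div 2))"
  proof -
    have "fs.dim (?P (int e)) = (n choose e)" by (simp add: dim_sqf_part)
    moreover have "(n choose e) = (n choose (n div 2))"
      unfolding e_def by (rule binomial_symmetric[symmetric]) simp
    ultimately show ?thesis unfolding d(2) e_def by metis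
  qed
  ultimately show ?thesis
    using catalan_eq_central_binomials[of n] unfolding d(2) by linarith
qed

section \<open>Polynomials and their squarefree parts\<close>

lemma carrier_poly_ring: "p \<in> carrier (poly_ring n) \<longleftrightarrow> (\<forall>m\<in>Poly_Mapping.keys p. Poly_Mapping.keys m \<subseteq> {1..n})"
  by (simp add: poly_ring_def)

lemma poly_ring_simps [simp]:
  "x \<otimes>\<^bsub>poly_ring n\<^esub> y = x * y" "x \<oplus>\<^bsub>poly_ring n\<^esub> y = x + y" "\<one>\<^bsub>poly_ring n\<^esub> = 1" "\<zero>\<^bsub>poly_ring n\<^esub> = 0"
  by (simp_all add: poly_ring_def)

interpretation Q: cring "poly_ring n :: 'k::field mpoly ring" for n
  by (rule cring_poly_ring)

lemma carrier_add: "p \<in> carrier (poly_ring n) \<Longrightarrow> q \<in> carrier (poly_ring n) \<Longrightarrow> p + q \<in> carrier (poly_ring n)"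
  using Q.a_closed[of p n q] by simp

lemma carrier_mult: "p \<in> carrier (poly_ring n) \<Longrightarrow> q \<in> carrier (poly_ring n) \<Longrightarrow> p * q \<in> carrier (poly_ring n)"
  using Q.m_closed[of p n q] by simp

lemma carrier_zero: "0 \<in> carrier (poly_ring n)"
  by (simp add: carrier_poly_ring)

lemma carrier_one: "1 \<in> carrier (poly_ring n)"
  by (simp add: carrier_poly_ring)

lemma carrier_uminus: "p \<in> carrier (poly_ring n) \<Longrightarrow> - p \<in> carrier (poly_ring n)"
  by (simp add: carrier_poly_ring)

lemma carrier_minus: "p \<in> carrier (poly_ring n) \<Longrightarrow> q \<in> carrier (poly_ring n) \<Longrightarrow> p - q \<in> carrier (poly_ring n)"
  using carrier_add[OF _ carrier_uminus, of p n q] by simp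

lemma carrier_sum: "(\<And>x. x \<in> X \<Longrightarrow> f x \<in> carrier (poly_ring n)) \<Longrightarrow> (\<Sum>x\<in>X. f x) \<in> carrier (poly_ring n)"
  by (induction X rule: infinite_finite_induct) (simp_all add: carrier_zero carrier_add)

lemma carrier_single: "Poly_Mapping.keys m \<subseteq> {1..n} \<Longrightarrow> Poly_Mapping.single m c \<in> carrier (poly_ring n)"
  by (simp add: carrier_poly_ring)

lemma carrier_const: "const c \<in> carrier (poly_ring n)"
  unfolding const_def by (rule carrier_single) simp

lemma carrier_var: "i \<in> {1..n} \<Longrightarrow> var i \<in> carrier (poly_ring n)"
  unfolding var_def by (rule carrier_single) simp

lemma a_inv_poly_ring: "p \<in> carrier (poly_ring n) \<Longrightarrow> \<ominus>\<^bsub>poly_ring n\<^esub> p = - p"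
  by (rule Q.minus_equality) (simp_all add: carrier_uminus)

lemma poly_mapping_sum_single: "p = (\<Sum>m\<in>Poly_Mapping.keys p. Poly_Mapping.single m (Poly_Mapping.lookup p m))"
proof (rule poly_mapping_eqI)
  fix k
  have "Poly_Mapping.lookup (\<Sum>m\<in>Poly_Mapping.keys p. Poly_Mapping.single m (Poly_Mapping.lookup p m)) k =
      (\<Sum>m\<in>Poly_Mapping.keys p. if m = k then Poly_Mapping.lookup p m else 0)"
    unfolding lookup_sum by (intro sum.cong) (auto simp: lookup_single)
  also have "\<dots> = Poly_Mapping.lookup p k"
    by (simp add: in_keys_iff)
  finally show "Poly_Mapping.lookup p k = Poly_Mapping.lookup (\<Sum>m\<in>Poly_Mapping.keys p. Poly_Mapping.single m (Poly_Mapping.lookup p m)) k" ..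
qed

lemma exponent_split:
  fixes m :: "nat \<Rightarrow>\<^sub>0 nat"
  assumes "Poly_Mapping.lookup m i \<ge> k"
  shows "m = Poly_Mapping.single i k + (m - Poly_Mapping.single i k)"
  using assms by (intro poly_mapping_eqI) (auto simp: lookup_add lookup_minus lookup_single when_def)

lemma keys_diff_exponent: 
  fixes m :: "nat \<Rightarrow>\<^sub>0 nat"
  shows "Poly_Mapping.keys (m - m') \<subseteq> Poly_Mapping.keys m"
  by (auto simp: in_keys_iff lookup_minus)

text \<open>
  The polynomial ring is generated by the constants and the variables, so a property closed under
  addition and under multiplication by these holds everywhere. Ideals and products are treated through
  this induction, which avoids convolution sums.
\<close>

lemma poly_ring_induct [consumes 1, case_names zero one add scale var]:
  fixes p :: "'k::field mpoly"
  assumes "p \<in> carrier (poly_ring n)"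
    and zero: "P 0" and one: "P 1"
    and add: "\<And>p q. P p \<Longrightarrow> P q \<Longrightarrow> P (p + q)"
    and scale: "\<And>c p. P p \<Longrightarrow> P (const c * p)"
    and var: "\<And>i p. i \<in> {1..n} \<Longrightarrow> P p \<Longrightarrow> P (var i * p)"
  shows "P p"
proof -
  have mono: "P (Poly_Mapping.single m 1)" if "Poly_Mapping.keys m \<subseteq> {1..n}" for m :: "nat \<Rightarrow>\<^sub>0 nat"
    using that
  proof (induction "\<Sum>i=1..n. Poly_Mapping.lookup m i" arbitrary: m rule: less_induct)
    case (less m)
    show ?case
    proof (cases "m = 0")
      case True
      then show ?thesis using one by simp
    next
      case False
      then obtain i where i: "i \<in> Poly_Mapping.keys m"
        by (metis all_not_in_conv keys_eq_empty)
      then have i': "i \<in> {1..n}" "Poly_Mapping.lookup m i \<ge> 1"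
        using less.prems by (blast, simp add: in_keys_iff)
      define m' where "m' = m - Poly_Mapping.single i 1"
      have m: "m = Poly_Mapping.single i 1 + m'"
        unfolding m'_def by (rule exponent_split[OF i'(2)])
      have "(\<Sum>j=1..n. Poly_Mapping.lookup m' j) < (\<Sum>j=1..n. Poly_Mapping.lookup m j)"
        using i' by (intro sum_strict_mono_ex1) (auto simp: m lookup_add intro!: bexI[of _ i])
      moreover have "Poly_Mapping.keys m' \<subseteq> {1..n}"
        using keys_diff_exponent[of m "Poly_Mapping.single i 1"] less.prems by (auto simp: m'_def)
      ultimately have "P (Poly_Mapping.single m' 1)" by (rule less.hyps)
      then have "P (var i * Poly_Mapping.single m' 1)" by (rule var[OF i'(1)])
      then show ?thesis unfolding var_def mult_single m[symmetric] by simp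
    qed
  qed
  have monom: "P (Poly_Mapping.single m c)" if "Poly_Mapping.keys m \<subseteq> {1..n}" for m c
    using scale[OF mono[OF that], of c] by (simp add: const_def mult_single)
  have "P (\<Sum>m\<in>M. Poly_Mapping.single m (Poly_Mapping.lookup p m))" if "M \<subseteq> Poly_Mapping.keys p" for M
    using finite_subset[OF that finite_keys] that
  proof (induction M rule: finite_induct)
    case (insert m M)
    have "Poly_Mapping.keys m \<subseteq> {1..n}"
      using assms(1) insert.prems by (auto simp only: carrier_poly_ring)
    then have "P (Poly_Mapping.single m (Poly_Mapping.lookup p m))" by (rule monom)
    then show ?case using insert by (simp add: add)
  qed (simp add: zero)
  then have "P (\<Sum>m\<in>Poly_Mapping.keys p. Poly_Mapping.single m (Poly_Mapping.lookup p m))" by blast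
  then show ?thesis using poly_mapping_sum_single[of p] by simp
qed

lemma poly_ring_idealI:
  fixes W :: "'k::field mpoly set"
  assumes W: "W \<subseteq> carrier (poly_ring n)"
    and zero: "0 \<in> W"
    and add: "\<And>p q. p \<in> W \<Longrightarrow> q \<in> W \<Longrightarrow> p + q \<in> W"
    and scale: "\<And>c p. p \<in> W \<Longrightarrow> const c * p \<in> W"
    and var: "\<And>i p. i \<in> {1..n} \<Longrightarrow> p \<in> W \<Longrightarrow> var i * p \<in> W"
  shows "ideal W (poly_ring n)"
proof (rule idealI)
  show "ring (poly_ring n :: 'k mpoly ring)" by (rule Q.ring_axioms)
  have neg: "- p \<in> W" if "p \<in> W" for p
  proof -
    have "const (- 1) * p = - p"
      by (simp add: const_def single_uminus)
    then show ?thesis using scale[OF that, of "- 1"] by simp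
  qed
  show "subgroup W (add_monoid (poly_ring n))"
  proof (rule group.subgroupI)
    show "group (add_monoid (poly_ring n :: 'k mpoly ring))" by (rule Q.a_group)
    show "inv\<^bsub>add_monoid (poly_ring n)\<^esub> a \<in> W" if "a \<in> W" for a
      using neg[OF that] a_inv_poly_ring[of a n] W that by (auto simp: a_inv_def)
  qed (use W zero add in auto)
  fix a x :: "'k mpoly" assume a: "a \<in> W" and "x \<in> carrier (poly_ring n)"
  from this(2) have xa: "x * a \<in> W"
  proof (induction x rule: poly_ring_induct)
    case (add p q)
    then show ?case using assms(3) by (simp add: distrib_right)
  next
    case (scale c p)
    then show ?case using assms(4) by (simp add: mult.assoc)
  next
    case (var i p)
    then show ?case using assms(5) by (simp add: mult.assoc)
  qed (use a zero in simp_all)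
  then show "x \<otimes>\<^bsub>poly_ring n\<^esub> a \<in> W" by simp
  show "a \<otimes>\<^bsub>poly_ring n\<^esub> x \<in> W" using xa by (simp add: mult.commute)
qed

lemma poly_ideal:
  assumes "ideal W (poly_ring n)"
  shows poly_ideal_zero: "0 \<in> W"
    and poly_ideal_add: "p \<in> W \<Longrightarrow> q \<in> W \<Longrightarrow> p + q \<in> W"
    and poly_ideal_mult: "p \<in> W \<Longrightarrow> r \<in> carrier (poly_ring n) \<Longrightarrow> r * p \<in> W"
    and poly_ideal_diff: "p \<in> W \<Longrightarrow> q \<in> W \<Longrightarrow> p - q \<in> W"
    and poly_ideal_carrier: "W \<subseteq> carrier (poly_ring n)"
proof -
  interpret W: ideal W "poly_ring n" by fact
  show "0 \<in> W" using W.zero_closed by simp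
  show add: "p \<in> W \<Longrightarrow> q \<in> W \<Longrightarrow> p + q \<in> W" for p q using W.a_closed[of p q] by simp
  show mult: "p \<in> W \<Longrightarrow> r \<in> carrier (poly_ring n) \<Longrightarrow> r * p \<in> W" for p r
    using W.I_l_closed[of p r] by simp
  have "- q = const (- 1) * q" for q :: "'a mpoly"
    by (simp add: const_def single_uminus)
  then show "p \<in> W \<Longrightarrow> q \<in> W \<Longrightarrow> p - q \<in> W"
    using add[of p "- q"] mult[of q "const (- 1)"] by (metis carrier_const diff_conv_add_uminus)
  show "W \<subseteq> carrier (poly_ring n)" using W.a_subset .
qed

lemma lookup_single_mult:
  fixes p :: "'k::field mpoly"
  shows "Poly_Mapping.lookup (Poly_Mapping.single k c * p) (k + m) = c * Poly_Mapping.lookup p m"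
    and "\<nexists>m'. m = k + m' \<Longrightarrow> Poly_Mapping.lookup (Poly_Mapping.single k c * p) m = 0"
proof -
  have *: "Poly_Mapping.lookup (Poly_Mapping.single k c * p) m =
      c * (\<Sum>q. Poly_Mapping.lookup p q when m = k + q)" for m
    by (simp add: lookup_mult lookup_single when_mult)
  show "Poly_Mapping.lookup (Poly_Mapping.single k c * p) (k + m) = c * Poly_Mapping.lookup p m"
    by (simp add: *)
  show "\<nexists>m'. m = k + m' \<Longrightarrow> Poly_Mapping.lookup (Poly_Mapping.single k c * p) m = 0"
    by (simp add: *)
qed

lemma lookup_const_mult: "Poly_Mapping.lookup (const c * p) m = c * Poly_Mapping.lookup p m"
  using lookup_single_mult(1)[of 0 c p m] by (simp add: const_def)

lemma lookup_var_mult: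
  "Poly_Mapping.lookup (var i * p) m =
    (if Poly_Mapping.lookup m i = 0 then 0 else Poly_Mapping.lookup p (m - Poly_Mapping.single i 1))"
proof (cases "Poly_Mapping.lookup m i = 0")
  case True
  then have "\<nexists>m'. m = Poly_Mapping.single i 1 + m'" by (auto simp: lookup_add)
  then show ?thesis using True by (simp add: var_def lookup_single_mult(2))
next
  case False
  then have "m = Poly_Mapping.single i 1 + (m - Poly_Mapping.single i 1)"
    by (intro exponent_split) simp
  then show ?thesis using False lookup_single_mult(1)[of "Poly_Mapping.single i 1" 1 p "m - Poly_Mapping.single i 1"]
    by (simp add: var_def)
qed

text \<open>
  The sum is \<open>0\<close> for an infinite \<open>S\<close>, so the restriction to \<open>S \<subseteq> {1..n}\<close> in \<open>sqf_coeffs\<close>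
  below also keeps infinite sets from picking up the constant term.
\<close>

definition sqf_exp :: "nat set \<Rightarrow> nat \<Rightarrow>\<^sub>0 nat" where
  "sqf_exp S = (\<Sum>i\<in>S. Poly_Mapping.single i 1)"

lemma lookup_sqf_exp: "finite S \<Longrightarrow> Poly_Mapping.lookup (sqf_exp S) i = (if i \<in> S then 1 else 0)"
  by (simp add: sqf_exp_def lookup_sum lookup_single when_def)

lemma keys_sqf_exp: "finite S \<Longrightarrow> Poly_Mapping.keys (sqf_exp S) = S"
  by (auto simp: in_keys_iff lookup_sqf_exp split: if_splits)

lemma mon_deg_sqf_exp: "finite S \<Longrightarrow> mon_deg (sqf_exp S) = card S"
  by (simp add: mon_deg_def keys_sqf_exp lookup_sqf_exp)

definition sqf_coeffs :: "nat \<Rightarrow> 'k::field mpoly \<Rightarrow> nat set \<Rightarrow> 'k" where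
  "sqf_coeffs n p = (\<lambda>S. if S \<subseteq> {1..n} then Poly_Mapping.lookup p (sqf_exp S) else 0)"

lemma sqf_coeffs_sqf: "sqf_coeffs n p \<in> sqf n"
  by (simp add: sqf_coeffs_def sqf_def)

lemma sqf_coeffs_add: "sqf_coeffs n (p + q) = sqf_coeffs n p + sqf_coeffs n q"
  by (simp add: sqf_coeffs_def fun_eq_iff lookup_add)

lemma sqf_coeffs_diff: "sqf_coeffs n (p - q) = sqf_coeffs n p - sqf_coeffs n q"
  by (simp add: sqf_coeffs_def fun_eq_iff lookup_minus)

lemma sqf_coeffs_zero: "sqf_coeffs n 0 = 0"
  by (simp add: sqf_coeffs_def fun_eq_iff)

lemma sqf_coeffs_sum: "sqf_coeffs n (\<Sum>x\<in>X. f x) = (\<Sum>x\<in>X. sqf_coeffs n (f x))"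
  by (induction X rule: infinite_finite_induct)
     (simp_all only: sum.infinite sum.empty sum.insert sqf_coeffs_zero sqf_coeffs_add not_False_eq_True)

lemma sqf_coeffs_const: "sqf_coeffs n (const c * p) = scl c (sqf_coeffs n p)"
  by (simp add: sqf_coeffs_def fun_eq_iff scl_apply lookup_const_mult)

lemma sqf_coeffs_var:
  assumes "i \<in> {1..n}"
  shows "sqf_coeffs n (var i * p) = mulX i (sqf_coeffs n p)"
proof
  fix S
  show "sqf_coeffs n (var i * p) S = mulX i (sqf_coeffs n p) S"
  proof (cases "S \<subseteq> {1..n}")
    case True
    then have fin: "finite S" using finite_subset by auto
    show ?thesis
    proof (cases "i \<in> S")
      case i: True
      have "sqf_exp S = Poly_Mapping.single i 1 + sqf_exp (S - {i})"
        unfolding sqf_exp_def by (rule sum.remove[OF fin i])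
      then have "Poly_Mapping.lookup (var i * p) (sqf_exp S) = Poly_Mapping.lookup p (sqf_exp (S - {i}))"
        using lookup_single_mult(1)[of "Poly_Mapping.single i 1" 1 p] by (simp add: var_def)
      moreover have "S - {i} \<subseteq> {1..n}" using True by blast
      ultimately show ?thesis using True i by (simp only: sqf_coeffs_def mulX_def if_True)
    next
      case False
      then show ?thesis using True fin by (simp add: sqf_coeffs_def mulX_def lookup_var_mult lookup_sqf_exp)
    qed
  next
    case False
    then have "\<not> S - {i} \<subseteq> {1..n}" using assms by blast
    then show ?thesis using False by (simp only: sqf_coeffs_def mulX_def if_False if_cancel)
  qed
qed

lemma sqf_coeffs_sum_vars_mult: "sqf_coeffs n ((\<Sum>i=1..n. var i) * p) = raise n (sqf_coeffs n p)"
  unfolding sum_distrib_right sqf_coeffs_sum raise_def by (intro sum.cong sqf_coeffs_var) auto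

text \<open>
  The section of \<open>sqf_coeffs\<close> with values in the squarefree polynomials.
\<close>

definition sqf_lift :: "nat \<Rightarrow> (nat set \<Rightarrow> 'k::field) \<Rightarrow> 'k mpoly" where
  "sqf_lift n f = (\<Sum>S\<in>Pow {1..n}. Poly_Mapping.single (sqf_exp S) (f S))"

lemma sqf_exp_inject: "finite S \<Longrightarrow> finite T \<Longrightarrow> sqf_exp S = sqf_exp T \<longleftrightarrow> S = T"
  by (metis keys_sqf_exp)

lemma sqf_coeffs_lift:
  assumes "f \<in> sqf n"
  shows "sqf_coeffs n (sqf_lift n f) = f"
proof
  fix S
  show "sqf_coeffs n (sqf_lift n f) S = f S"
  proof (cases "S \<subseteq> {1..n}")
    case True
    then have fin: "finite S" using finite_subset by auto
    have "Poly_Mapping.lookup (sqf_lift n f) (sqf_exp S) = (\<Sum>T\<in>Pow {1..n}. if T = S then f T else 0)"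
      unfolding sqf_lift_def lookup_sum
    proof (intro sum.cong refl)
      fix T assume "T \<in> Pow {1..n}"
      then have "finite T" using finite_subset by auto
      then show "Poly_Mapping.lookup (Poly_Mapping.single (sqf_exp T) (f T)) (sqf_exp S) = (if T = S then f T else 0)"
        by (simp add: lookup_single when_def sqf_exp_inject[OF _ fin])
    qed
    then show ?thesis using True by (simp add: sqf_coeffs_def)
  next
    case False
    then show ?thesis using assms by (auto simp: sqf_coeffs_def sqf_def)
  qed
qed

lemma sqf_lift_carrier: "sqf_lift n f \<in> carrier (poly_ring n)"
  unfolding sqf_lift_def
proof (intro carrier_sum carrier_single)
  fix S assume "S \<in> Pow {1..n}"
  moreover from this have "finite S" using finite_subset by auto
  ultimately show "Poly_Mapping.keys (sqf_exp S) \<subseteq> {1..n}" by (simp add: keys_sqf_exp)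
qed

lemma sqf_lift_hom_part:
  assumes "f \<in> sqf_part n (int d)"
  shows "sqf_lift n f \<in> hom_part n d"
proof -
  have "mon_deg m = d" if "m \<in> Poly_Mapping.keys (sqf_lift n f)" for m
  proof -
    have "(\<Sum>S\<in>Pow {1..n}. Poly_Mapping.lookup (Poly_Mapping.single (sqf_exp S) (f S)) m) \<noteq> 0"
      using that by (simp add: sqf_lift_def lookup_sum in_keys_iff)
    then obtain S where S: "S \<in> Pow {1..n}" "Poly_Mapping.lookup (Poly_Mapping.single (sqf_exp S) (f S)) m \<noteq> 0"
      by (rule sum.not_neutral_contains_not_neutral)
    then have "m = sqf_exp S" "f S \<noteq> 0" by (auto simp: lookup_single when_def split: if_splits)
    moreover have "finite S" using S(1) finite_subset by auto
    ultimately show ?thesis using assms by (simp add: mon_deg_sqf_exp sqf_part_def)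
  qed
  then show ?thesis by (simp add: hom_part_def sqf_lift_carrier)
qed

lemma sqf_coeffs_hom_part:
  assumes "p \<in> hom_part n d"
  shows "sqf_coeffs n p \<in> sqf_part n (int d)"
proof -
  have "S \<subseteq> {1..n} \<and> int (card S) = int d" if S: "sqf_coeffs n p S \<noteq> 0" for S
  proof -
    have *: "S \<subseteq> {1..n}" "sqf_exp S \<in> Poly_Mapping.keys p"
      using S by (auto simp: sqf_coeffs_def in_keys_iff split: if_splits)
    then have "mon_deg (sqf_exp S) = d" using assms by (simp add: hom_part_def)
    moreover have "finite S" using *(1) finite_subset by auto
    ultimately show ?thesis using *(1) by (simp add: mon_deg_sqf_exp)
  qed
  then show ?thesis by (simp add: sqf_part_def)
qed

section \<open>The ideals as preimages\<close>

text \<open>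
  All ideals in the statement contain the squares, so they are preimages of subspaces of the
  squarefree algebra.
\<close>

definition sqf_preimage :: "nat \<Rightarrow> (nat set \<Rightarrow> 'k::field) set \<Rightarrow> 'k mpoly set" where
  "sqf_preimage n V = {p \<in> carrier (poly_ring n). sqf_coeffs n p \<in> V}"

lemma sqf_preimageI: "p \<in> carrier (poly_ring n) \<Longrightarrow> sqf_coeffs n p \<in> V \<Longrightarrow> p \<in> sqf_preimage n V"
  by (simp add: sqf_preimage_def)

lemma sqf_preimageD: "p \<in> sqf_preimage n V \<Longrightarrow> p \<in> carrier (poly_ring n)" "p \<in> sqf_preimage n V \<Longrightarrow> sqf_coeffs n p \<in> V"
  by (simp_all add: sqf_preimage_def)

lemma sqf_preimage_mono: "V \<subseteq> W \<Longrightarrow> sqf_preimage n V \<subseteq> sqf_preimage n W"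
  by (auto simp: sqf_preimage_def)

lemma sqf_lift_preimage: "f \<in> V \<Longrightarrow> f \<in> sqf n \<Longrightarrow> sqf_lift n f \<in> sqf_preimage n V"
  by (simp add: sqf_preimage_def sqf_lift_carrier sqf_coeffs_lift)

lemma ideal_sqf_preimage:
  fixes V :: "(nat set \<Rightarrow> 'k::field) set"
  assumes "fs.subspace V" "\<And>i f. i \<in> {1..n} \<Longrightarrow> f \<in> V \<Longrightarrow> mulX i f \<in> V"
  shows "ideal (sqf_preimage n V) (poly_ring n)"
proof (rule poly_ring_idealI)
  show "sqf_preimage n V \<subseteq> carrier (poly_ring n)" by (auto simp: sqf_preimage_def)
  show "0 \<in> sqf_preimage n V"
    using fs.subspace_0[OF assms(1)] by (intro sqf_preimageI) (simp_all add: carrier_zero sqf_coeffs_zero)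
  fix p q :: "'k mpoly" assume p: "p \<in> sqf_preimage n V"
  note pc = sqf_preimageD[OF p]
  show "p + q \<in> sqf_preimage n V" if q: "q \<in> sqf_preimage n V"
    using pc sqf_preimageD[OF q] fs.subspace_add[OF assms(1)]
    by (intro sqf_preimageI carrier_add) (simp_all only: sqf_coeffs_add)
  show "const c * p \<in> sqf_preimage n V" for c
    using pc fs.subspace_scale[OF assms(1)]
    by (intro sqf_preimageI carrier_mult carrier_const) (simp_all only: sqf_coeffs_const)
  show "var i * p \<in> sqf_preimage n V" if i: "i \<in> {1..n}" for i
    using pc assms(2)[OF i] i
    by (intro sqf_preimageI carrier_mult carrier_var) (simp_all only: sqf_coeffs_var)
qed

lemma poly_ideal_sum:
  assumes "ideal W (poly_ring n)" "\<And>x. x \<in> X \<Longrightarrow> f x \<in> W"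
  shows "(\<Sum>x\<in>X. f x) \<in> W"
  using assms(2)
  by (induction X rule: infinite_finite_induct)
     (simp_all add: poly_ideal_zero[OF assms(1)] poly_ideal_add[OF assms(1)])

lemma subspace_image_ideal:
  fixes \<Phi> :: "'k::field mpoly \<Rightarrow> 'x \<Rightarrow> 'k"
  assumes add: "\<And>p q. \<Phi> (p + q) = \<Phi> p + \<Phi> q" and scale: "\<And>c p. \<Phi> (const c * p) = scl c (\<Phi> p)"
    and A: "ideal A (poly_ring n)"
  shows "fs.subspace (\<Phi> ` A)"
proof (rule fs.subspaceI)
  have "\<Phi> 0 = 0" using scale[of 0 0] by simp
  then show "0 \<in> \<Phi> ` A" using poly_ideal_zero[OF A] by (metis imageI)
  show "x + y \<in> \<Phi> ` A" if "x \<in> \<Phi> ` A" "y \<in> \<Phi> ` A" for x y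
    using that poly_ideal_add[OF A] by (auto simp flip: add)
  show "scl c x \<in> \<Phi> ` A" if "x \<in> \<Phi> ` A" for c x
    using that poly_ideal_mult[OF A _ carrier_const] by (auto simp flip: scale)
qed

definition squares :: "nat \<Rightarrow> 'k::field mpoly set" where
  "squares n = {var i ^ 2 | i. i \<in> {1..n}}"

abbreviation squares_ideal :: "nat \<Rightarrow> 'k::field mpoly set" where
  "squares_ideal n \<equiv> Idl\<^bsub>poly_ring n\<^esub> (squares n)"

lemma squares_carrier: "squares n \<subseteq> carrier (poly_ring n)"
  by (auto simp: squares_def power2_eq_square intro!: carrier_mult carrier_var)

lemma mulX_sq_multiples: "i \<in> {1..n} \<Longrightarrow> f \<in> sq_multiples n \<Longrightarrow> mulX i f \<in> sq_multiples n"
proof -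
  assume i: "i \<in> {1..n}" and "f \<in> sq_multiples n"
  then obtain g where g: "g \<in> sqf n" "f = raise n (raise n g)" by (auto simp: sq_multiples_def)
  have "mulX i f = raise n (raise n (mulX i g))" by (simp only: g(2) mulX_raise)
  then show ?thesis unfolding sq_multiples_def using mulX_sqf[OF g(1) i] by blast
qed

lemma mulX_sq_annihilator: "i \<in> {1..n} \<Longrightarrow> f \<in> sq_annihilator n \<Longrightarrow> mulX i f \<in> sq_annihilator n"
  by (simp add: sq_annihilator_def mulX_sqf mulX_raise[symmetric] mulX.zero)

lemma sqf_coeffs_square:
  assumes i: "i \<in> {1..n}"
  shows "sqf_coeffs n (var i ^ 2) = 0"
proof -
  have "sqf_coeffs n (var i ^ 2) = mulX i (mulX i (sqf_coeffs n 1))"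
    using sqf_coeffs_var[OF i, of "var i"] sqf_coeffs_var[OF i, of 1]
    by (metis power2_eq_square mult.right_neutral)
  then show ?thesis by (simp only: mulX_mulX_same)
qed

lemma var_square: "var i ^ 2 = Poly_Mapping.single (Poly_Mapping.single i 2) 1"
  unfolding var_def power2_eq_square mult_single single_add[symmetric] one_add_one by simp

text \<open>
  The kernel of \<open>sqf_coeffs\<close>: a polynomial without squarefree terms is a sum of terms each divisible by
  the square of a variable.
\<close>

lemma squares_ideal_eq: "squares_ideal n = sqf_preimage n {0 :: nat set \<Rightarrow> 'k::field}"
proof
  have "ideal (sqf_preimage n {0 :: nat set \<Rightarrow> 'k}) (poly_ring n)"
    by (rule ideal_sqf_preimage) (simp_all add: fs.subspace_single_0 mulX.zero)
  moreover have "squares n \<subseteq> sqf_preimage n {0 :: nat set \<Rightarrow> 'k}"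
    using squares_carrier by (auto simp: squares_def sqf_preimage_def sqf_coeffs_square)
  ultimately show "squares_ideal n \<subseteq> sqf_preimage n {0 :: nat set \<Rightarrow> 'k}"
    by (rule Q.genideal_minimal)
  show "sqf_preimage n {0 :: nat set \<Rightarrow> 'k} \<subseteq> squares_ideal n"
  proof
    fix p :: "'k mpoly" assume p: "p \<in> sqf_preimage n {0}"
    have id: "ideal (squares_ideal n) (poly_ring n :: 'k mpoly ring)"
      by (rule Q.genideal_ideal[OF squares_carrier])
    have "Poly_Mapping.single m (Poly_Mapping.lookup p m) \<in> squares_ideal n" if m: "m \<in> Poly_Mapping.keys p" for m
    proof -
      have km: "Poly_Mapping.keys m \<subseteq> {1..n}"
        using m p by (auto simp only: sqf_preimage_def carrier_poly_ring)
      have "\<exists>i. Poly_Mapping.lookup m i \<ge> 2"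
      proof (rule ccontr)
        assume "\<not> (\<exists>i. Poly_Mapping.lookup m i \<ge> 2)"
        then have le1: "Poly_Mapping.lookup m i \<le> 1" for i
          by (metis not_less_eq_eq numeral_2_eq_2 One_nat_def)
        have "m = sqf_exp (Poly_Mapping.keys m)"
        proof (rule poly_mapping_eqI)
          fix i show "Poly_Mapping.lookup m i = Poly_Mapping.lookup (sqf_exp (Poly_Mapping.keys m)) i"
            using le1[of i] by (auto simp: lookup_sqf_exp in_keys_iff)
        qed
        then have "sqf_coeffs n p (Poly_Mapping.keys m) = Poly_Mapping.lookup p m"
          using km by (simp add: sqf_coeffs_def)
        moreover have "sqf_coeffs n p = 0" using p by (simp add: sqf_preimage_def)
        ultimately show False using m by (simp add: in_keys_iff)
      qed
      then obtain i where i: "Poly_Mapping.lookup m i \<ge> 2" by blast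
      then have "i \<in> Poly_Mapping.keys m" by (simp add: in_keys_iff)
      then have "i \<in> {1..n}" using km by blast
      then have sq: "var i ^ 2 \<in> squares_ideal n"
        using Q.genideal_self[OF squares_carrier] unfolding squares_def by blast
      let ?r = "Poly_Mapping.single (m - Poly_Mapping.single i 2) (Poly_Mapping.lookup p m)"
      have "Poly_Mapping.single m (Poly_Mapping.lookup p m) = ?r * var i ^ 2"
        unfolding var_square mult_single using exponent_split[OF i] by (metis add.commute mult_1_right)
      moreover have "?r \<in> carrier (poly_ring n)"
        using keys_diff_exponent[of m "Poly_Mapping.single i 2"] km by (intro carrier_single) blast
      ultimately show ?thesis using poly_ideal_mult[OF id sq] by simp
    qed
    then have "(\<Sum>m\<in>Poly_Mapping.keys p. Poly_Mapping.single m (Poly_Mapping.lookup p m)) \<in> squares_ideal n"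
      by (rule poly_ideal_sum[OF id])
    then show "p \<in> squares_ideal n"
      unfolding poly_mapping_sum_single[symmetric] .
  qed
qed

definition sum_vars :: "nat \<Rightarrow> 'k::field mpoly" where
  "sum_vars n = (\<Sum>i=1..n. var i)"

lemma sum_vars_carrier: "sum_vars n \<in> carrier (poly_ring n)"
  unfolding sum_vars_def by (intro carrier_sum carrier_var)

lemma sqf_coeffs_sq_mult: "sqf_coeffs n (sum_vars n ^ 2 * p) = raise n (raise n (sqf_coeffs n p))"
  unfolding power2_eq_square mult.assoc sum_vars_def sqf_coeffs_sum_vars_mult ..

text \<open>
  A polynomial whose squarefree part is \<open>s\<^sup>2 f\<close> differs from \<open>s\<^sup>2\<close> times a lift of \<open>f\<close> by an element of
  the ideal of the squares.
\<close>

lemma squares_and_sq_ideal_eq: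
  "squares_ideal n <+>\<^bsub>poly_ring n\<^esub> Idl\<^bsub>poly_ring n\<^esub> {sum_vars n ^ 2} =
    sqf_preimage n (sq_multiples n :: (nat set \<Rightarrow> 'k::field) set)" (is "?I = ?P")
proof
  let ?s = "sum_vars n ^ 2 :: 'k mpoly"
  have s: "?s \<in> carrier (poly_ring n)"
    unfolding power2_eq_square by (intro carrier_mult sum_vars_carrier)
  have idP: "ideal ?P (poly_ring n)"
    by (rule ideal_sqf_preimage[OF subspace_sq_multiples mulX_sq_multiples])
  have id: "ideal (Idl\<^bsub>poly_ring n\<^esub> {?s}) (poly_ring n)"
    by (rule Q.genideal_ideal) (use s in blast)
  have "?s \<in> ?P"
    using sqf_coeffs_sq_mult[of n 1] sqf_coeffs_sqf[of n 1] by (intro sqf_preimageI s) (auto simp: sq_multiples_def)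
  then have "Idl\<^bsub>poly_ring n\<^esub> {?s} \<subseteq> ?P"
    by (intro Q.genideal_minimal idP) blast
  moreover have "squares_ideal n \<subseteq> ?P"
    unfolding squares_ideal_eq using fs.subspace_0[OF subspace_sq_multiples] by (intro sqf_preimage_mono) blast
  ultimately show "?I \<subseteq> ?P"
    unfolding set_add_def' using poly_ideal_add[OF idP] by auto
  show "?P \<subseteq> ?I"
  proof
    fix p assume p: "p \<in> ?P"
    then obtain f where f: "f \<in> sqf n" "sqf_coeffs n p = raise n (raise n f)"
      by (auto simp: sqf_preimage_def sq_multiples_def)
    let ?q = "sqf_lift n f * ?s"
    have q: "?q \<in> Idl\<^bsub>poly_ring n\<^esub> {?s}"
      using Q.genideal_self'[OF s] by (intro poly_ideal_mult[OF id] sqf_lift_carrier)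
    then have qc: "?q \<in> carrier (poly_ring n)" using poly_ideal_carrier[OF id] by blast
    have "sqf_coeffs n ?q = sqf_coeffs n p"
      using sqf_coeffs_sq_mult[of n "sqf_lift n f"] by (simp add: f sqf_coeffs_lift mult.commute)
    then have "p - ?q \<in> squares_ideal n"
      unfolding squares_ideal_eq using p qc
      by (intro sqf_preimageI carrier_minus) (simp_all add: sqf_preimage_def sqf_coeffs_diff)
    moreover have "p = (p - ?q) + ?q" by simp
    ultimately show "p \<in> ?I"
      unfolding set_add_def' poly_ring_simps using q by blast
  qed
qed

text \<open>
  Membership in the colon ideal only has to be tested on \<open>s\<^sup>2\<close>, because the squares themselves are
  multiplied into their own ideal by every polynomial.
\<close>

lemma colon_ideal_eq:
  "colon_ideal (poly_ring n) (squares_ideal n) (sqf_preimage n (sq_multiples n)) =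
    sqf_preimage n (sq_annihilator n :: (nat set \<Rightarrow> 'k::field) set)" (is "?G = ?P")
proof
  let ?s = "sum_vars n ^ 2 :: 'k mpoly"
  have s: "?s \<in> carrier (poly_ring n)"
    unfolding power2_eq_square by (intro carrier_mult sum_vars_carrier)
  have id: "ideal (squares_ideal n :: 'k mpoly set) (poly_ring n)"
    by (rule Q.genideal_ideal[OF squares_carrier])
  have sI: "?s \<in> sqf_preimage n (sq_multiples n)"
    using sqf_coeffs_sq_mult[of n 1] sqf_coeffs_sqf[of n 1] by (intro sqf_preimageI s) (auto simp: sq_multiples_def)
  show "?G \<subseteq> ?P"
  proof
    fix p assume p: "p \<in> ?G"
    then have pc: "p \<in> carrier (poly_ring n)" and "p * ?s \<in> squares_ideal n"
      using sI by (auto simp: colon_ideal_def)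
    then have "sqf_coeffs n (?s * p) = 0"
      unfolding squares_ideal_eq by (simp add: sqf_preimage_def mult.commute)
    then show "p \<in> ?P"
      using pc by (intro sqf_preimageI) (simp_all add: sq_annihilator_def sqf_coeffs_sqf sqf_coeffs_sq_mult)
  qed
  show "?P \<subseteq> ?G"
  proof
    fix p assume p: "p \<in> ?P"
    have pc: "p \<in> carrier (poly_ring n)" using p by (rule sqf_preimageD)
    have sp: "?s * p \<in> squares_ideal n"
      unfolding squares_ideal_eq using p s
      by (intro sqf_preimageI carrier_mult) (simp_all add: sqf_preimage_def sq_annihilator_def sqf_coeffs_sq_mult)
    have "p * b \<in> squares_ideal n" if b: "b \<in> sqf_preimage n (sq_multiples n)" for b
    proof -
      obtain f where f: "f \<in> sqf n" "sqf_coeffs n b = raise n (raise n f)"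
        using b by (auto simp: sqf_preimage_def sq_multiples_def)
      let ?q = "?s * sqf_lift n f"
      have "sqf_coeffs n ?q = sqf_coeffs n b"
        by (simp add: sqf_coeffs_sq_mult f sqf_coeffs_lift)
      then have "b - ?q \<in> squares_ideal n"
        unfolding squares_ideal_eq using b s
        by (intro sqf_preimageI carrier_minus carrier_mult) (simp_all add: sqf_preimage_def sqf_coeffs_diff sqf_lift_carrier)
      then have "p * (b - ?q) + sqf_lift n f * (?s * p) \<in> squares_ideal n"
        by (intro poly_ideal_add[OF id] poly_ideal_mult[OF id] pc sp sqf_lift_carrier)
      then show ?thesis by (simp add: algebra_simps)
    qed
    then show "p \<in> ?G" using pc by (simp add: colon_ideal_def)
  qed
qed

section \<open>Quotients of the polynomial ring\<close>

lemma quot_carrier: "carrier (poly_ring n Quot I) = (\<lambda>p. I +>\<^bsub>poly_ring n\<^esub> p) ` carrier (poly_ring n)"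
  unfolding FactRing_def A_RCOSETS_def' by auto

lemma coset_eq_iff:
  fixes p q :: "'k::field mpoly"
  assumes "ideal I (poly_ring n)" "p \<in> carrier (poly_ring n)" "q \<in> carrier (poly_ring n)"
  shows "I +>\<^bsub>poly_ring n\<^esub> p = I +>\<^bsub>poly_ring n\<^esub> q \<longleftrightarrow> p - q \<in> I"
  using Q.quotient_eq_iff_same_a_r_cos[OF assms] assms(2,3)
  by (simp add: a_minus_def a_inv_poly_ring)

lemma quot_ops:
  fixes p q :: "'k::field mpoly"
  assumes "ideal I (poly_ring n)" "p \<in> carrier (poly_ring n)" "q \<in> carrier (poly_ring n)"
  shows "(I +>\<^bsub>poly_ring n\<^esub> p) \<otimes>\<^bsub>poly_ring n Quot I\<^esub> (I +>\<^bsub>poly_ring n\<^esub> q) = I +>\<^bsub>poly_ring n\<^esub> (p * q)"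
    and "(I +>\<^bsub>poly_ring n\<^esub> p) \<oplus>\<^bsub>poly_ring n Quot I\<^esub> (I +>\<^bsub>poly_ring n\<^esub> q) = I +>\<^bsub>poly_ring n\<^esub> (p + q)"
    and "\<zero>\<^bsub>poly_ring n Quot I\<^esub> = I +>\<^bsub>poly_ring n\<^esub> 0"
    and "I +>\<^bsub>poly_ring n\<^esub> p = \<zero>\<^bsub>poly_ring n Quot I\<^esub> \<longleftrightarrow> p \<in> I"
proof -
  note hom = ideal.rcos_ring_hom[OF assms(1)]
  show "(I +>\<^bsub>poly_ring n\<^esub> p) \<otimes>\<^bsub>poly_ring n Quot I\<^esub> (I +>\<^bsub>poly_ring n\<^esub> q) = I +>\<^bsub>poly_ring n\<^esub> (p * q)"
    using ring_hom_mult[OF hom assms(2,3)] by simp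
  show "(I +>\<^bsub>poly_ring n\<^esub> p) \<oplus>\<^bsub>poly_ring n Quot I\<^esub> (I +>\<^bsub>poly_ring n\<^esub> q) = I +>\<^bsub>poly_ring n\<^esub> (p + q)"
    using ring_hom_add[OF hom assms(2,3)] by simp
  have "I +>\<^bsub>poly_ring n\<^esub> 0 = I"
    by (rule Q.a_rcos_zero[OF assms(1) poly_ideal_zero[OF assms(1)]])
  then show zero: "\<zero>\<^bsub>poly_ring n Quot I\<^esub> = I +>\<^bsub>poly_ring n\<^esub> 0"
    by (simp add: FactRing_def)
  show "I +>\<^bsub>poly_ring n\<^esub> p = \<zero>\<^bsub>poly_ring n Quot I\<^esub> \<longleftrightarrow> p \<in> I"
    unfolding zero using coset_eq_iff[OF assms(1,2) carrier_zero] by simp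
qed

lemma ideal_coset_preimage:
  fixes I :: "'k::field mpoly set"
  assumes "ideal I (poly_ring n)" "ideal K (poly_ring n Quot I)"
  shows "ideal {p \<in> carrier (poly_ring n). I +>\<^bsub>poly_ring n\<^esub> p \<in> K} (poly_ring n)"
  by (rule ring_hom_ring.ideal_vimage[OF ideal.rcos_ring_hom_ring[OF assms(1)] assms(2)])

text \<open>
  An ideal of the quotient is determined by the squarefree parts of its representatives, which form a
  subspace of the finite-dimensional squarefree algebra. A chain of ideals becomes stationary where
  these dimensions attain their minimum.
\<close>

lemma artinian_quot:
  assumes I: "ideal I (poly_ring n :: 'k::field mpoly ring)" and J: "sqf_preimage n {0} \<subseteq> I"
  shows "artinian (poly_ring n Quot I)"
  unfolding artinian_def
proof (intro allI impI)
  fix f :: "nat \<Rightarrow> 'k mpoly set set"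
  assume f: "\<forall>i. ideal (f i) (poly_ring n Quot I) \<and> f (Suc i) \<subseteq> f i"
  define P where "P i = {p \<in> carrier (poly_ring n). I +>\<^bsub>poly_ring n\<^esub> p \<in> f i}" for i
  define V where "V i = sqf_coeffs n ` P i" for i
  have P: "ideal (P i) (poly_ring n)" for i
    unfolding P_def using f by (intro ideal_coset_preimage[OF I]) blast
  have anti: "f i \<subseteq> f j" if "j \<le> i" for i j
    using f that by (metis lift_Suc_antimono_le)
  then have Vanti: "V i \<subseteq> V j" if "j \<le> i" for i j
    using that by (auto simp: V_def P_def)
  have V: "fs.subspace (V i)" for i
    unfolding V_def by (rule subspace_image_ideal[OF sqf_coeffs_add sqf_coeffs_const P])
  have Vs: "V i \<subseteq> fs.span (delta ` Pow {1..n})" for i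
    unfolding V_def sqf_span[symmetric] using sqf_coeffs_sqf by blast
  obtain N where N: "fs.dim (V N) \<le> fs.dim (V i)" for i
    using ex_has_least_nat[of "\<lambda>_. True" 0 "\<lambda>i. fs.dim (V i)"] by blast
  have "f i = f N" if "i \<ge> N" for i
  proof
    show "f i \<subseteq> f N" by (rule anti[OF that])
    have "fs.dim (V i) \<le> fs.dim (V N)"
      by (rule fs.dim_mono_finite[OF Vanti[OF that] Vs]) simp
    then have "V i = V N"
      by (intro fs.subspace_eq_of_dim_eq[OF V V Vanti[OF that] Vs]) (simp_all add: N le_antisym)
    show "f N \<subseteq> f i"
    proof
      fix a assume a: "a \<in> f N"
      then have "a \<in> carrier (poly_ring n Quot I)"
        using f ideal.Icarr[of "f N" "poly_ring n Quot I" a] by simp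
      then obtain p where p: "p \<in> carrier (poly_ring n)" "a = I +>\<^bsub>poly_ring n\<^esub> p"
        by (auto simp: quot_carrier)
      then have "sqf_coeffs n p \<in> V i"
        using a \<open>V i = V N\<close> by (auto simp: V_def P_def)
      then obtain q where q: "q \<in> P i" "sqf_coeffs n p = sqf_coeffs n q"
        by (auto simp: V_def)
      have qc: "q \<in> carrier (poly_ring n)" using q(1) by (simp add: P_def)
      have "p - q \<in> sqf_preimage n {0}"
        using q(2) by (intro sqf_preimageI carrier_minus p qc) (simp add: sqf_coeffs_diff)
      then have "a = I +>\<^bsub>poly_ring n\<^esub> q"
        using coset_eq_iff[OF I p(1) qc] p(2) J by blast
      then show "a \<in> f i" using q(1) by (simp add: P_def)
    qed
  qed
  then show "\<exists>N. \<forall>i\<ge>N. f i = f N" by blast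
qed

abbreviation sq_ideal :: "nat \<Rightarrow> 'k::field mpoly set" where
  "sq_ideal n \<equiv> sqf_preimage n (sq_multiples n)"

abbreviation sq_colon :: "nat \<Rightarrow> 'k::field mpoly set" where
  "sq_colon n \<equiv> sqf_preimage n (sq_annihilator n)"

lemma ideal_squares_ideal: "ideal (squares_ideal n) (poly_ring n)"
  by (rule Q.genideal_ideal[OF squares_carrier])

lemma ideal_sq_ideal: "ideal (sq_ideal n) (poly_ring n)"
  by (rule ideal_sqf_preimage[OF subspace_sq_multiples mulX_sq_multiples])

lemma ideal_sq_colon: "ideal (sq_colon n) (poly_ring n)"
  by (rule ideal_sqf_preimage[OF subspace_sq_annihilator mulX_sq_annihilator])

lemma squares_ideal_subset:
  assumes "fs.subspace V"
  shows "squares_ideal n \<subseteq> sqf_preimage n V"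
  unfolding squares_ideal_eq using fs.subspace_0[OF assms] by (intro sqf_preimage_mono) blast

lemma hom_part_carrier: "hom_part n d \<subseteq> carrier (poly_ring n)"
  by (auto simp: hom_part_def)

lemma mon_deg_add: "mon_deg (a + b) = mon_deg a + mon_deg b"
  unfolding mon_deg_def by (rule setsum_keys_plus_distrib) simp_all

lemma hom_part_mult: "p \<in> hom_part n d \<Longrightarrow> q \<in> hom_part n e \<Longrightarrow> p * q \<in> hom_part n (d + e)"
  using keys_mult[of p q] by (fastforce simp: hom_part_def mon_deg_add carrier_mult)

lemma hom_part_add: "p \<in> hom_part n d \<Longrightarrow> q \<in> hom_part n d \<Longrightarrow> p + q \<in> hom_part n d"
  using keys_add[of p q] by (auto simp: hom_part_def carrier_add)

lemma hom_part_sum: "(\<And>x. x \<in> X \<Longrightarrow> f x \<in> hom_part n d) \<Longrightarrow> (\<Sum>x\<in>X. f x) \<in> hom_part n d"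
proof (induction X rule: infinite_finite_induct)
  case (insert x X)
  then show ?case by (simp add: hom_part_add)
qed (simp_all add: hom_part_def carrier_zero)

lemma var_hom_part: "i \<in> {1..n} \<Longrightarrow> var i \<in> hom_part n 1"
  using carrier_var[of i n] by (simp add: hom_part_def var_def mon_deg_def)

lemma squares_hom_part: "squares n \<subseteq> hom_part n 2"
proof
  fix p :: "'a mpoly" assume "p \<in> squares n"
  then obtain i where "i \<in> {1..n}" "p = var i ^ 2" by (auto simp: squares_def)
  then show "p \<in> hom_part n 2"
    using hom_part_mult[OF var_hom_part var_hom_part, of i n i] by (simp add: power2_eq_square numeral_2_eq_2)
qed

lemma sum_vars_sq_hom_part: "sum_vars n ^ 2 \<in> hom_part n 2"
proof -
  have "sum_vars n \<in> hom_part n 1"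
    unfolding sum_vars_def by (intro hom_part_sum var_hom_part)
  from hom_part_mult[OF this this] show ?thesis by (simp add: power2_eq_square numeral_2_eq_2)
qed

lemma generates_sq_ideal: "generates (poly_ring n) (insert (sum_vars n ^ 2) (squares n)) (sq_ideal n)"
proof -
  let ?S = "insert (sum_vars n ^ 2) (squares n) :: 'a mpoly set"
  have S: "?S \<subseteq> carrier (poly_ring n)"
    using squares_carrier sum_vars_sq_hom_part hom_part_carrier by blast
  have id: "ideal (Idl\<^bsub>poly_ring n\<^esub> ?S) (poly_ring n)" by (rule Q.genideal_ideal[OF S])
  have eq: "sq_ideal n = squares_ideal n <+>\<^bsub>poly_ring n\<^esub> Idl\<^bsub>poly_ring n\<^esub> {sum_vars n ^ 2 :: 'a mpoly}"
    by (rule squares_and_sq_ideal_eq[symmetric])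
  have 1: "squares_ideal n \<subseteq> Idl\<^bsub>poly_ring n\<^esub> ?S" "Idl\<^bsub>poly_ring n\<^esub> {sum_vars n ^ 2} \<subseteq> Idl\<^bsub>poly_ring n\<^esub> ?S"
    using Q.genideal_self[OF S] by (intro Q.genideal_minimal[OF id]; blast)+
  then have "sq_ideal n \<subseteq> Idl\<^bsub>poly_ring n\<^esub> ?S"
    unfolding eq set_add_def' using poly_ideal_add[OF id] by auto
  moreover have "Idl\<^bsub>poly_ring n\<^esub> ?S \<subseteq> sq_ideal n"
  proof (rule Q.genideal_minimal[OF ideal_sq_ideal])
    have "squares n \<subseteq> (sq_ideal n :: 'a mpoly set)"
      using squares_ideal_subset[OF subspace_sq_multiples] Q.genideal_self[OF squares_carrier] by blast
    moreover have "sum_vars n ^ 2 \<in> (sq_ideal n :: 'a mpoly set)"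
      using sqf_coeffs_sq_mult[of n 1] sqf_coeffs_sqf[of n 1] S
      by (intro sqf_preimageI) (auto simp: sq_multiples_def)
    ultimately show "?S \<subseteq> sq_ideal n" by blast
  qed
  ultimately show ?thesis unfolding generates_def using S by blast
qed

lemma homogeneous_sq_ideal: "homogeneous_ideal n (sq_ideal n)"
  unfolding homogeneous_ideal_def generated_in_degrees_def
  using generates_sq_ideal squares_hom_part sum_vars_sq_hom_part
  by (intro exI[of _ "insert (sum_vars n ^ 2) (squares n)"]) blast

section \<open>The socle of the quotient\<close>

lemma ceiling_half_bounds: "2 * int (n - n div 2) \<ge> int n" "2 * int (n - n div 2) \<le> int n + 1"
proof -
  have "n \<le> 2 * (n - n div 2)" "2 * (n - n div 2) \<le> n + 1" by presburger+
  then show "2 * int (n - n div 2) \<ge> int n" "2 * int (n - n div 2) \<le> int n + 1" by linarith+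
qed

text \<open>
  The inhomogeneous form of the statement on socles: above degree \<open>\<lceil>n/2\<rceil>\<close> everything is a multiple of
  \<open>s\<^sup>2\<close>, and below it socle elements are.
\<close>

lemma sq_multiples_of_mulX_modulo_middle:
  fixes f :: "nat set \<Rightarrow> 'k::field"
  assumes char: "CHAR('k) > n \<or> CHAR('k) = 0"
    and f: "f \<in> sqf n" "\<And>i. i \<in> {1..n} \<Longrightarrow> mulX i f \<in> sq_multiples n"
  shows "f - hom_component (int (n - n div 2)) f \<in> sq_multiples n"
proof -
  define e where "e = int (n - n div 2)"
  have e: "e \<in> {0..int n}" "2 * e \<ge> int n" "2 * e \<le> int n + 1"
    using ceiling_half_bounds[of n] by (auto simp: e_def)
  have "hom_component d f \<in> sq_multiples n" if "d \<noteq> e" for d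
  proof (cases "d > e")
    case True
    then show ?thesis using e by (intro sq_multiples_high_degree[OF char hom_component_sqf_part[OF f(1)]]) linarith
  next
    case False
    show ?thesis
    proof (rule sq_multiples_of_mulX_low_degree[OF char hom_component_sqf_part[OF f(1)]])
      show "2 * d + 1 \<le> int n" using False that e by linarith
      show "mulX i (hom_component d f) \<in> sq_multiples n" if "i \<in> {1..n}" for i
        using hom_component_sq_multiples[OF f(2)[OF that]] hom_component_mulX[OF f(1)] by metis
    qed
  qed
  then have "(\<Sum>d\<in>{0..int n} - {e}. hom_component d f) \<in> sq_multiples n"
    by (intro fs.subspace_sum[OF subspace_sq_multiples]) blast
  moreover have "f = hom_component e f + (\<Sum>d\<in>{0..int n} - {e}. hom_component d f)"
    using sum_hom_component[OF f(1)] sum.remove[OF _ e(1), of "\<lambda>d. hom_component d f"] by simp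
  then have "f - hom_component e f = (\<Sum>d\<in>{0..int n} - {e}. hom_component d f)"
    by (metis add_diff_cancel_left')
  ultimately show ?thesis by (simp only: e_def)
qed

lemma quot_part_carrier: "quot_part n I d \<subseteq> carrier (poly_ring n Quot I)"
  unfolding quot_part_def quot_image_def quot_carrier using hom_part_carrier by blast

lemma ideal_no_constant_term: "ideal {r \<in> carrier (poly_ring n). Poly_Mapping.lookup r 0 = 0} (poly_ring n)"
  by (rule poly_ring_idealI)
     (auto simp: lookup_const_mult lookup_var_mult lookup_add simp del: One_nat_def atLeastAtMost_iff
       intro: carrier_zero carrier_add carrier_mult carrier_const carrier_var)

text \<open>
  The generators have positive degree, hence no constant term, and the classes of polynomials without
  constant term form an ideal.
\<close>

lemma quot_max_ideal_subset:
  assumes "ideal I (poly_ring n)"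
  shows "quot_max_ideal n I \<subseteq> (\<lambda>p. I +>\<^bsub>poly_ring n\<^esub> p) ` {r \<in> carrier (poly_ring n). Poly_Mapping.lookup r 0 = (0 :: 'k::field)}"
  unfolding quot_max_ideal_def
proof (rule ring.genideal_minimal[OF ideal.quotient_is_ring[OF assms]])
  show "ideal ((\<lambda>p. I +>\<^bsub>poly_ring n\<^esub> p) ` {r \<in> carrier (poly_ring n). Poly_Mapping.lookup r 0 = (0 :: 'k)}) (poly_ring n Quot I)"
    by (rule Q.ring_ideal_imp_quot_ideal[OF assms ideal_no_constant_term])
  have "p \<in> {r \<in> carrier (poly_ring n). Poly_Mapping.lookup r 0 = (0 :: 'k)}" if "p \<in> hom_part n d" "d \<ge> 1" for p d
  proof -
    have "mon_deg 0 = 0" by (simp add: mon_deg_def)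
    then have "0 \<notin> Poly_Mapping.keys p" using that by (force simp: hom_part_def)
    then show ?thesis using that(1) hom_part_carrier by (auto simp: in_keys_iff)
  qed
  then show "(\<Union>d\<in>{1..}. quot_part n I d) \<subseteq> (\<lambda>p. I +>\<^bsub>poly_ring n\<^esub> p) ` {r \<in> carrier (poly_ring n). Poly_Mapping.lookup r 0 = (0 :: 'k)}"
    unfolding quot_part_def quot_image_def by fastforce
qed

text \<open>
  For arbitrary \<open>r\<close> with constant term \<open>r\<^sub>0\<close> one shows \<open>r q - r\<^sub>0 q \<in> I\<close> by induction on \<open>r\<close>.
\<close>

lemma mult_no_constant_term_in_ideal:
  fixes r q :: "'k::field mpoly"
  assumes I: "ideal I (poly_ring n)" and q: "\<And>i. i \<in> {1..n} \<Longrightarrow> var i * q \<in> I"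
    and r: "r \<in> carrier (poly_ring n)" "Poly_Mapping.lookup r 0 = 0"
  shows "q * r \<in> I"
proof -
  have "r \<in> carrier (poly_ring n) \<and> r * q - const (Poly_Mapping.lookup r 0) * q \<in> I"
    using r(1)
  proof (induction r rule: poly_ring_induct)
    case zero
    then show ?case using poly_ideal_zero[OF I] by (simp add: carrier_zero const_def)
  next
    case one
    then show ?case using poly_ideal_zero[OF I] by (simp add: carrier_one const_def)
  next
    case (add p r)
    have "(p + r) * q - const (Poly_Mapping.lookup (p + r) 0) * q =
       (p * q - const (Poly_Mapping.lookup p 0) * q) + (r * q - const (Poly_Mapping.lookup r 0) * q)"
      by (simp add: lookup_add const_def single_add algebra_simps)
    then show ?case using add poly_ideal_add[OF I] by (simp add: carrier_add)
  next
    case (scale c p)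
    have "const c * p * q - const (Poly_Mapping.lookup (const c * p) 0) * q =
       const c * (p * q - const (Poly_Mapping.lookup p 0) * q)"
      unfolding lookup_const_mult by (simp add: const_def mult_single[symmetric] algebra_simps flip: mult.assoc)
        (simp add: mult_single)
    then show ?case using scale poly_ideal_mult[OF I _ carrier_const] by (simp add: carrier_mult carrier_const)
  next
    case (var i p)
    have z: "Poly_Mapping.lookup (var i * p) 0 = 0" by (simp add: lookup_var_mult)
    have "var i * p * q - const (Poly_Mapping.lookup (var i * p) 0) * q = p * (var i * q)"
      unfolding z by (simp add: const_def algebra_simps)
    moreover have "p * (var i * q) \<in> I" using var by (intro poly_ideal_mult[OF I q]) auto
    ultimately show ?case using var carrier_mult carrier_var by metis
  qed
  then show ?thesis using r(2) by (simp add: const_def mult.commute)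
qed

lemma socle_eq:
  assumes char: "CHAR('k::field) > n \<or> CHAR('k) = 0"
  shows "socle n (sq_ideal n :: 'k mpoly set) = quot_part n (sq_ideal n) (n - n div 2)"
proof
  let ?I = "sq_ideal n :: 'k mpoly set"
  let ?c = "\<lambda>p. ?I +>\<^bsub>poly_ring n\<^esub> p"
  let ?e = "n - n div 2"
  note I = ideal_sq_ideal[of n, where 'a = 'k]
  have gens: "(\<Union>d\<in>{1..}. quot_part n ?I d) \<subseteq> carrier (poly_ring n Quot ?I)"
    using quot_part_carrier by blast
  show "socle n ?I \<subseteq> quot_part n ?I ?e"
  proof
    fix a assume a: "a \<in> socle n ?I"
    then obtain p where p: "p \<in> carrier (poly_ring n)" "a = ?c p"
      by (auto simp: socle_def quot_carrier)
    have "mulX i (sqf_coeffs n p) \<in> sq_multiples n" if i: "i \<in> {1..n}" for i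
    proof -
      have "?c (var i) \<in> quot_part n ?I 1"
        unfolding quot_part_def quot_image_def using var_hom_part[OF i] by blast
      then have "?c (var i) \<in> quot_max_ideal n ?I"
        unfolding quot_max_ideal_def using ring.genideal_self[OF ideal.quotient_is_ring[OF I] gens] by blast
      then have "?c p \<otimes>\<^bsub>poly_ring n Quot ?I\<^esub> ?c (var i) = \<zero>\<^bsub>poly_ring n Quot ?I\<^esub>"
        using a p(2) by (simp add: socle_def)
      then have "p * var i \<in> ?I"
        using quot_ops(1)[OF I p(1) carrier_var[OF i]] quot_ops(4)[OF I carrier_mult[OF p(1) carrier_var[OF i]] carrier_zero]
        by simp
      then show ?thesis
        using sqf_coeffs_var[OF i, of p] by (simp add: sqf_preimage_def mult.commute)
    qed
    then have *: "sqf_coeffs n p - hom_component (int ?e) (sqf_coeffs n p) \<in> sq_multiples n"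
      by (rule sq_multiples_of_mulX_modulo_middle[OF char sqf_coeffs_sqf])
    define q where "q = sqf_lift n (hom_component (int ?e) (sqf_coeffs n p))"
    have h: "hom_component (int ?e) (sqf_coeffs n p) \<in> sqf_part n (int ?e)"
      by (rule hom_component_sqf_part[OF sqf_coeffs_sqf])
    have q: "q \<in> hom_part n ?e" unfolding q_def by (rule sqf_lift_hom_part[OF h])
    then have qc: "q \<in> carrier (poly_ring n)" using hom_part_carrier by blast
    have "sqf_coeffs n q = hom_component (int ?e) (sqf_coeffs n p)"
      unfolding q_def using h sqf_part_subset by (intro sqf_coeffs_lift) blast
    then have "p - q \<in> ?I"
      using * by (intro sqf_preimageI carrier_minus p(1) qc) (simp only: sqf_coeffs_diff)
    then have "a = ?c q" using coset_eq_iff[OF I p(1) qc] p(2) by simp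
    then show "a \<in> quot_part n ?I ?e"
      unfolding quot_part_def quot_image_def using q by blast
  qed
  show "quot_part n ?I ?e \<subseteq> socle n ?I"
  proof
    fix a assume "a \<in> quot_part n ?I ?e"
    then obtain q where q: "q \<in> hom_part n ?e" "a = ?c q"
      by (auto simp: quot_part_def quot_image_def)
    have qc: "q \<in> carrier (poly_ring n)" using q(1) hom_part_carrier by blast
    have vq: "var i * q \<in> ?I" if i: "i \<in> {1..n}" for i
    proof (intro sqf_preimageI carrier_mult carrier_var i qc)
      have "mulX i (sqf_coeffs n q) \<in> sqf_part n (int ?e + 1)"
        by (rule mulX_sqf_part[OF sqf_coeffs_hom_part[OF q(1)] i])
      then have "mulX i (sqf_coeffs n q) \<in> sq_multiples n"
      proof (rule sq_multiples_high_degree[OF char])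
        have "int n + 2 \<le> 2 * (e + 1)" if "2 * e \<ge> int n" for e :: int using that by presburger
        from this[OF ceiling_half_bounds(1)] show "int n + 2 \<le> 2 * (int ?e + 1)" .
      qed
      then show "sqf_coeffs n (var i * q) \<in> sq_multiples n" by (simp only: sqf_coeffs_var[OF i])
    qed
    have "a \<otimes>\<^bsub>poly_ring n Quot ?I\<^esub> b = \<zero>\<^bsub>poly_ring n Quot ?I\<^esub>" if b: "b \<in> quot_max_ideal n ?I" for b
    proof -
      obtain r where r: "r \<in> carrier (poly_ring n)" "Poly_Mapping.lookup r 0 = 0" "b = ?c r"
        using b quot_max_ideal_subset[OF I] by blast
      have "q * r \<in> ?I" by (rule mult_no_constant_term_in_ideal[OF I vq r(1,2)])
      then show ?thesis
        using quot_ops(1)[OF I qc r(1)] quot_ops(4)[OF I carrier_mult[OF qc r(1)] carrier_zero] q(2) r(3) by simp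
    qed
    then show "a \<in> socle n ?I"
      using q(2) qc by (auto simp: socle_def quot_carrier)
  qed
qed

text \<open>
  The vectors of a complement of \<open>V \<inter> W\<close> in \<open>W\<close> yield the successive line extensions over the ground
  field: each new vector stays outside the previous span even modulo \<open>V\<close>.
\<close>

lemma quot_dimension:
  fixes V W :: "(nat set \<Rightarrow> 'k::field) set" and n :: nat
  defines "c \<equiv> \<lambda>p. sqf_preimage n V +>\<^bsub>poly_ring n\<^esub> p"
  assumes V: "fs.subspace V" "\<And>i f. i \<in> {1..n} \<Longrightarrow> f \<in> V \<Longrightarrow> mulX i f \<in> V"
    and W: "fs.subspace W" "W \<subseteq> sqf n"
    and k: "fs.dim (V \<inter> W) + k = fs.dim W"
  shows "ring.dimension (poly_ring n Quot sqf_preimage n V) k (quot_scalars n (sqf_preimage n V)) (c ` sqf_preimage n W)"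
proof -
  let ?I = "sqf_preimage n V"
  let ?R = "poly_ring n Quot ?I"
  let ?K = "quot_scalars n ?I"
  let ?U = "V \<inter> W"
  have I: "ideal ?I (poly_ring n)" by (rule ideal_sqf_preimage[OF V])
  interpret R: ring ?R by (rule ideal.quotient_is_ring[OF I])
  have U: "fs.subspace ?U" by (rule fs.subspace_inter[OF V(1) W(1)])
  obtain C where C: "finite C" "C \<subseteq> W" "fs.dim ?U + card C = fs.dim W" "fs.span (?U \<union> C) = W"
    and flag: "\<And>C' x. C' \<subseteq> C \<Longrightarrow> x \<in> C - C' \<Longrightarrow> x \<notin> fs.span (?U \<union> C')"
    using fs.finite_complement[OF U W(1) _ W(2)[unfolded sqf_span]] by blast
  have "R.dimension (card C') ?K (c ` sqf_preimage n (fs.span (?U \<union> C')))" if "C' \<subseteq> C" for C'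
    using finite_subset[OF that C(1)] that
  proof (induction C' rule: finite_induct)
    case empty
    have "fs.span (?U \<union> {}) = ?U" using iffD2[OF fs.span_eq_iff U] by (simp only: Un_empty_right)
    moreover have "c p = \<zero>\<^bsub>?R\<^esub>" if "p \<in> sqf_preimage n ?U" for p
      using quot_ops(4)[OF I sqf_preimageD(1)[OF that] carrier_zero] that by (auto simp: sqf_preimage_def c_def)
    moreover have "0 \<in> sqf_preimage n ?U"
      using fs.subspace_0[OF U] by (intro sqf_preimageI carrier_zero) (simp only: sqf_coeffs_zero)
    ultimately have "c ` sqf_preimage n (fs.span (?U \<union> {})) = {\<zero>\<^bsub>?R\<^esub>}"
      by (metis (no_types, lifting) image_cong image_constant)
    then show ?case by (simp only: card.empty R.zero_dim)
  next
    case (insert x D)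
    let ?E = "c ` sqf_preimage n (fs.span (?U \<union> D))"
    let ?x = "sqf_lift n x"
    have x: "x \<in> W" "x \<in> sqf n" using insert.prems C(2) W(2) by blast+
    have sx: "sqf_coeffs n ?x = x" by (rule sqf_coeffs_lift[OF x(2)])
    have "D \<subseteq> W" using insert.prems C(2) by blast
    then have sp: "fs.span (?U \<union> D) \<subseteq> W" by (intro fs.span_minimal W(1)) blast
    have "c ?x \<notin> ?E"
    proof
      assume "c ?x \<in> ?E"
      then obtain p where p: "p \<in> sqf_preimage n (fs.span (?U \<union> D))" "c ?x = c p" by blast
      note pc = sqf_preimageD[OF p(1)]
      have "?x - p \<in> ?I" using p(2) coset_eq_iff[OF I sqf_lift_carrier pc(1)] by (simp add: c_def)
      then have "x - sqf_coeffs n p \<in> V" using sx by (simp add: sqf_preimage_def sqf_coeffs_diff)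
      moreover have "x - sqf_coeffs n p \<in> W" using x(1) pc(2) sp by (intro fs.subspace_diff[OF W(1)]) blast+
      ultimately have "x - sqf_coeffs n p \<in> fs.span (?U \<union> D)" by (intro fs.span_base) blast
      from fs.span_add[OF this pc(2)] have "x \<in> fs.span (?U \<union> D)" by simp
      then show False using flag[of D x] insert.prems insert.hyps(2) by blast
    qed
    moreover have "c ?x \<in> carrier ?R" unfolding quot_carrier c_def using sqf_lift_carrier by blast
    moreover have "R.dimension (card D) ?K ?E" using insert.IH insert.prems by blast
    ultimately have "R.dimension (Suc (card D)) ?K (R.line_extension ?K (c ?x) ?E)"
      by (intro R.Suc_dim)
    moreover have "R.line_extension ?K (c ?x) ?E = c ` sqf_preimage n (fs.span (?U \<union> insert x D))"
    proof (intro subset_antisym subsetI)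
      fix u assume "u \<in> R.line_extension ?K (c ?x) ?E"
      then obtain a p where p: "p \<in> sqf_preimage n (fs.span (?U \<union> D))"
          and u: "u = c (const a) \<otimes>\<^bsub>?R\<^esub> c ?x \<oplus>\<^bsub>?R\<^esub> c p"
        unfolding R.line_extension_mem_iff quot_scalars_def quot_image_def c_def by blast
      note pc = sqf_preimageD[OF p]
      have ax: "const a * ?x \<in> carrier (poly_ring n)" by (intro carrier_mult carrier_const sqf_lift_carrier)
      have "u = c (const a * ?x + p)"
        unfolding u c_def quot_ops(1)[OF I carrier_const sqf_lift_carrier] quot_ops(2)[OF I ax pc(1)] ..
      moreover have "sqf_coeffs n (const a * ?x + p) - scl a x = sqf_coeffs n p"
        by (simp only: sqf_coeffs_add sqf_coeffs_const sx add_diff_cancel_left')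
      then have "sqf_coeffs n (const a * ?x + p) \<in> fs.span (insert x (?U \<union> D))"
        unfolding fs.span_insert using pc(2) by (metis (mono_tags, lifting) mem_Collect_eq)
      then have "const a * ?x + p \<in> sqf_preimage n (fs.span (?U \<union> insert x D))"
        by (intro sqf_preimageI carrier_add ax pc(1)) (simp only: Un_insert_right)
      ultimately show "u \<in> c ` sqf_preimage n (fs.span (?U \<union> insert x D))" by blast
    next
      fix u assume "u \<in> c ` sqf_preimage n (fs.span (?U \<union> insert x D))"
      then obtain p where p: "p \<in> sqf_preimage n (fs.span (?U \<union> insert x D))" "u = c p" by blast
      note pc = sqf_preimageD[OF p(1)]
      obtain a where a: "sqf_coeffs n p - scl a x \<in> fs.span (?U \<union> D)"
        using pc(2) unfolding Un_insert_right fs.span_insert by blast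
      let ?p = "p - const a * ?x"
      have ax: "const a * ?x \<in> carrier (poly_ring n)" by (intro carrier_mult carrier_const sqf_lift_carrier)
      have p': "?p \<in> sqf_preimage n (fs.span (?U \<union> D))"
        using a by (intro sqf_preimageI carrier_minus ax pc(1)) (simp only: sqf_coeffs_diff sqf_coeffs_const sx)
      have "u = c (const a) \<otimes>\<^bsub>?R\<^esub> c ?x \<oplus>\<^bsub>?R\<^esub> c ?p"
        unfolding p(2) c_def quot_ops(1)[OF I carrier_const sqf_lift_carrier]
          quot_ops(2)[OF I ax sqf_preimageD(1)[OF p']] by simp
      moreover have "c (const a) \<in> ?K" unfolding quot_scalars_def quot_image_def c_def by blast
      ultimately show "u \<in> R.line_extension ?K (c ?x) ?E"
        unfolding R.line_extension_mem_iff using p' by blast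
    qed
    ultimately show ?case using insert.hyps by simp
  qed
  moreover have "card C = k" using C(3) k by linarith
  ultimately show ?thesis using C(4) by (metis subset_refl)
qed

lemma quot_part_eq:
  fixes V :: "(nat set \<Rightarrow> 'k::field) set"
  assumes V: "fs.subspace V" "\<And>i f. i \<in> {1..n} \<Longrightarrow> f \<in> V \<Longrightarrow> mulX i f \<in> V"
  shows "quot_part n (sqf_preimage n V) d =
    (\<lambda>p. sqf_preimage n V +>\<^bsub>poly_ring n\<^esub> p) ` sqf_preimage n (sqf_part n (int d))"
proof
  let ?I = "sqf_preimage n V"
  let ?c = "\<lambda>p. ?I +>\<^bsub>poly_ring n\<^esub> p"
  have I: "ideal ?I (poly_ring n)" by (rule ideal_sqf_preimage[OF V])
  show "quot_part n ?I d \<subseteq> ?c ` sqf_preimage n (sqf_part n (int d))"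
    unfolding quot_part_def quot_image_def sqf_preimage_def[of n "sqf_part n (int d)"]
    using hom_part_carrier sqf_coeffs_hom_part by blast
  show "?c ` sqf_preimage n (sqf_part n (int d)) \<subseteq> quot_part n ?I d"
  proof
    fix a assume "a \<in> ?c ` sqf_preimage n (sqf_part n (int d))"
    then obtain p where p: "p \<in> sqf_preimage n (sqf_part n (int d))" "a = ?c p" by blast
    note pc = sqf_preimageD[OF p(1)]
    let ?q = "sqf_lift n (sqf_coeffs n p)"
    have "sqf_coeffs n (p - ?q) = 0"
      by (simp add: sqf_coeffs_diff sqf_coeffs_lift sqf_coeffs_sqf)
    then have "p - ?q \<in> ?I"
      using fs.subspace_0[OF V(1)] by (intro sqf_preimageI carrier_minus pc(1) sqf_lift_carrier) simp
    then have "a = ?c ?q" using coset_eq_iff[OF I pc(1) sqf_lift_carrier] p(2) by simp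
    then show "a \<in> quot_part n ?I d"
      unfolding quot_part_def quot_image_def using sqf_lift_hom_part[OF pc(2)] by blast
  qed
qed

lemma socle_dimension:
  assumes char: "CHAR('k::field) > n \<or> CHAR('k) = 0"
  shows "ring.dimension (poly_ring n Quot sq_ideal n) (catalan (n div 2 + 1))
    (quot_scalars n (sq_ideal n)) (socle n (sq_ideal n :: 'k mpoly set))"
proof -
  have "quot_part n (sq_ideal n :: 'k mpoly set) (n - n div 2) =
      (\<lambda>p. sq_ideal n +>\<^bsub>poly_ring n\<^esub> p) ` sqf_preimage n (sqf_part n (int (n - n div 2)))"
    by (rule quot_part_eq[OF subspace_sq_multiples mulX_sq_multiples])
  then show ?thesis
    unfolding socle_eq[OF char]
    using quot_dimension[OF subspace_sq_multiples _ subspace_sqf_part sqf_part_subset dim_sq_multiples[OF char]]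
      mulX_sq_multiples by metis
qed

lemma level_sq_ideal:
  assumes char: "CHAR('k::field) > n \<or> CHAR('k) = 0"
  shows "level n (sq_ideal n :: 'k mpoly set)"
  unfolding level_def
proof (intro conjI exI)
  show "homogeneous_ideal n (sq_ideal n :: 'k mpoly set)" by (rule homogeneous_sq_ideal)
  show "artinian (quot_ring n (sq_ideal n :: 'k mpoly set))"
    using squares_ideal_subset[OF subspace_sq_multiples] unfolding squares_ideal_eq
    by (rule artinian_quot[OF ideal_sq_ideal])
  show "socle n (sq_ideal n :: 'k mpoly set) \<subseteq> quot_part n (sq_ideal n) (n - n div 2)"
    by (simp add: socle_eq[OF char])
qed

section \<open>Generators\<close>

lemma quot_Idl:
  fixes I :: "'k::field mpoly set"
  assumes I: "ideal I (poly_ring n)" and S: "S \<subseteq> carrier (poly_ring n)"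
  defines "c \<equiv> \<lambda>p. I +>\<^bsub>poly_ring n\<^esub> p"
  shows "Idl\<^bsub>poly_ring n Quot I\<^esub> (c ` S) = c ` (Idl\<^bsub>poly_ring n\<^esub> (S \<union> I))"
proof
  let ?R = "poly_ring n Quot I"
  interpret R: ring ?R by (rule ideal.quotient_is_ring[OF I])
  have SI: "S \<union> I \<subseteq> carrier (poly_ring n)" using S poly_ideal_carrier[OF I] by blast
  have cS: "c ` S \<subseteq> carrier ?R" unfolding quot_carrier c_def using S by blast
  have SI': "S \<union> I \<subseteq> Idl\<^bsub>poly_ring n\<^esub> (S \<union> I)" by (rule Q.genideal_self[OF SI])
  show "Idl\<^bsub>?R\<^esub> (c ` S) \<subseteq> c ` (Idl\<^bsub>poly_ring n\<^esub> (S \<union> I))"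
  proof (rule R.genideal_minimal)
    show "ideal (c ` (Idl\<^bsub>poly_ring n\<^esub> (S \<union> I))) ?R"
      unfolding c_def by (rule Q.ring_ideal_imp_quot_ideal[OF I Q.genideal_ideal[OF SI]])
  qed (use SI' in blast)
  have id: "ideal (Idl\<^bsub>?R\<^esub> (c ` S)) ?R" by (rule R.genideal_ideal[OF cS])
  have "Idl\<^bsub>poly_ring n\<^esub> (S \<union> I) \<subseteq> {p \<in> carrier (poly_ring n). c p \<in> Idl\<^bsub>?R\<^esub> (c ` S)}"
  proof (rule Q.genideal_minimal)
    show "ideal {p \<in> carrier (poly_ring n). c p \<in> Idl\<^bsub>?R\<^esub> (c ` S)} (poly_ring n)"
      unfolding c_def by (rule ideal_coset_preimage[OF I id[unfolded c_def]])
    have "c p \<in> Idl\<^bsub>?R\<^esub> (c ` S)" if p: "p \<in> I" for p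
    proof -
      have "c p = \<zero>\<^bsub>?R\<^esub>"
        using quot_ops(4)[OF I _ carrier_zero, of p] p SI by (auto simp: c_def)
      then show ?thesis using additive_subgroup.zero_closed[OF ideal.axioms(1)[OF id]] by simp
    qed
    then show "S \<union> I \<subseteq> {p \<in> carrier (poly_ring n). c p \<in> Idl\<^bsub>?R\<^esub> (c ` S)}"
      using SI R.genideal_self[OF cS] by blast
  qed
  then show "c ` (Idl\<^bsub>poly_ring n\<^esub> (S \<union> I)) \<subseteq> Idl\<^bsub>?R\<^esub> (c ` S)" by blast
qed

lemma quot_image_inject:
  fixes I :: "'k::field mpoly set"
  assumes I: "ideal I (poly_ring n)"
    and A: "ideal A (poly_ring n)" "I \<subseteq> A" and B: "ideal B (poly_ring n)" "I \<subseteq> B"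
    and eq: "(\<lambda>p. I +>\<^bsub>poly_ring n\<^esub> p) ` A = (\<lambda>p. I +>\<^bsub>poly_ring n\<^esub> p) ` B"
  shows "A = B"
proof -
  have "A \<subseteq> B" if A: "ideal A (poly_ring n)" and B: "ideal B (poly_ring n)" "I \<subseteq> B"
    and eq: "(\<lambda>p. I +>\<^bsub>poly_ring n\<^esub> p) ` A = (\<lambda>p. I +>\<^bsub>poly_ring n\<^esub> p) ` B" for A B
  proof
    fix p assume p: "p \<in> A"
    then obtain q where q: "q \<in> B" "I +>\<^bsub>poly_ring n\<^esub> p = I +>\<^bsub>poly_ring n\<^esub> q" using eq by blast
    have "p \<in> carrier (poly_ring n)" "q \<in> carrier (poly_ring n)"
      using p q(1) poly_ideal_carrier A B(1) by blast+
    then have "p - q \<in> B" using coset_eq_iff[OF I] q(2) B(2) by blast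
    then have "p - q + q \<in> B" using q(1) by (rule poly_ideal_add[OF B(1)])
    then show "p \<in> B" by simp
  qed
  from this[OF A(1) B eq] this[OF B(1) A eq[symmetric]] show ?thesis by blast
qed

text \<open>
  This bounds numbers of generators from below: a linear map that kills the multiples of all variables
  sees only the constant coefficients of a combination of generators, so its image is spanned by the
  images of the generators.
\<close>

lemma image_in_span_of_generators:
  fixes \<Phi> :: "'k::field mpoly \<Rightarrow> 'x \<Rightarrow> 'k"
  assumes add: "\<And>p q. \<Phi> (p + q) = \<Phi> p + \<Phi> q" and scale: "\<And>c p. \<Phi> (const c * p) = scl c (\<Phi> p)"
    and A: "ideal A (poly_ring n)" and var: "\<And>i p. i \<in> {1..n} \<Longrightarrow> p \<in> A \<Longrightarrow> \<Phi> (var i * p) = 0"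
    and S: "S \<subseteq> A" "A = Idl\<^bsub>poly_ring n\<^esub> S"
  shows "\<Phi> ` A \<subseteq> fs.span (\<Phi> ` S)"
proof -
  let ?W = "{p \<in> A. \<Phi> p \<in> fs.span (\<Phi> ` S)}"
  have "ideal ?W (poly_ring n)"
  proof (rule poly_ring_idealI)
    show "?W \<subseteq> carrier (poly_ring n)" using poly_ideal_carrier[OF A] by blast
    have "\<Phi> 0 = 0" using scale[of 0 0] by simp
    then show "0 \<in> ?W" using poly_ideal_zero[OF A] by (simp add: fs.span_zero)
    show "p + q \<in> ?W" if "p \<in> ?W" "q \<in> ?W" for p q
      using that poly_ideal_add[OF A] by (simp add: add fs.span_add)
    show "const c * p \<in> ?W" if "p \<in> ?W" for c p
      using that poly_ideal_mult[OF A _ carrier_const] by (simp add: scale fs.span_scale)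
    show "var i * p \<in> ?W" if i: "i \<in> {1..n}" and p: "p \<in> ?W" for i p
      using p poly_ideal_mult[OF A _ carrier_var[OF i]] var[OF i] by (simp add: fs.span_zero)
  qed
  moreover have "S \<subseteq> ?W" using S(1) fs.span_base by blast
  ultimately have "Idl\<^bsub>poly_ring n\<^esub> S \<subseteq> ?W" by (rule Q.genideal_minimal)
  then show ?thesis using S(2) by blast
qed

text \<open>
  Modulo the squares this is the statement that the annihilator of \<open>s\<^sup>2\<close> is generated by its part in
  degree \<open>\<lfloor>n/2\<rfloor>\<close>.
\<close>

lemma sq_colon_eq_Idl:
  fixes B :: "(nat set \<Rightarrow> 'k::field) set"
  assumes char: "CHAR('k) > n \<or> CHAR('k) = 0"
    and B: "B \<subseteq> sq_annihilator n" "sq_annihilator n \<inter> sqf_part n (int (n div 2)) \<subseteq> fs.span B"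
  shows "Idl\<^bsub>poly_ring n\<^esub> (sqf_lift n ` B \<union> squares n) = sq_colon n"
proof
  let ?S = "sqf_lift n ` B \<union> squares n"
  let ?X = "Idl\<^bsub>poly_ring n\<^esub> ?S"
  have S: "?S \<subseteq> carrier (poly_ring n)" using squares_carrier sqf_lift_carrier by blast
  have X: "ideal ?X (poly_ring n)" by (rule Q.genideal_ideal[OF S])
  have SX: "?S \<subseteq> ?X" by (rule Q.genideal_self[OF S])
  have JX: "squares_ideal n \<subseteq> ?X" using SX by (intro Q.genideal_minimal[OF X]) blast
  have Bs: "B \<subseteq> sqf n" using B(1) by (auto simp: sq_annihilator_def)
  show "?X \<subseteq> sq_colon n"
  proof (rule Q.genideal_minimal[OF ideal_sq_colon])
    have "sqf_lift n ` B \<subseteq> sq_colon n" using B(1) Bs sqf_lift_preimage by blast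
    moreover have "squares n \<subseteq> (sq_colon n :: 'k mpoly set)"
      using squares_ideal_subset[OF subspace_sq_annihilator] Q.genideal_self[OF squares_carrier] by blast
    ultimately show "?S \<subseteq> sq_colon n" by blast
  qed
  let ?V = "sqf_coeffs n ` ?X"
  have V: "fs.subspace ?V"
    by (rule subspace_image_ideal[OF sqf_coeffs_add sqf_coeffs_const X])
  have "B \<subseteq> ?V"
  proof
    fix b assume "b \<in> B"
    then have "b = sqf_coeffs n (sqf_lift n b)" "sqf_lift n b \<in> ?X"
      using Bs SX sqf_coeffs_lift[of b n] by auto
    then show "b \<in> ?V" by blast
  qed
  then have "fs.span B \<subseteq> ?V" by (rule fs.span_minimal[OF _ V])
  then have "sq_annihilator n \<inter> sqf_part n (int (n div 2)) \<subseteq> ?V" using B(2) by blast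
  moreover have "mulX i f \<in> ?V" if i: "i \<in> {1..n}" and f: "f \<in> ?V" for i f
  proof -
    obtain p where p: "p \<in> ?X" "f = sqf_coeffs n p" using f by blast
    have "mulX i f = sqf_coeffs n (var i * p)" by (simp only: sqf_coeffs_var[OF i] p(2))
    then show ?thesis using poly_ideal_mult[OF X p(1) carrier_var[OF i]] by blast
  qed
  ultimately have KV: "sq_annihilator n \<subseteq> ?V" by (intro sq_annihilator_generated[OF char V])
  show "sq_colon n \<subseteq> ?X"
  proof
    fix p :: "'k mpoly" assume p: "p \<in> sq_colon n"
    note pc = sqf_preimageD[OF p]
    obtain q where q: "q \<in> ?X" "sqf_coeffs n p = sqf_coeffs n q" using pc(2) KV by blast
    have "q \<in> carrier (poly_ring n)" using q(1) poly_ideal_carrier[OF X] by blast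
    then have "p - q \<in> squares_ideal n"
      unfolding squares_ideal_eq using q(2) by (intro sqf_preimageI carrier_minus pc(1)) (simp_all add: sqf_coeffs_diff)
    then have "p - q + q \<in> ?X" using JX q(1) by (intro poly_ideal_add[OF X]) blast+
    then show "p \<in> ?X" by simp
  qed
qed

lemma sq_annihilator_basis:
  assumes char: "CHAR('k::field) > n \<or> CHAR('k) = 0"
  obtains B :: "(nat set \<Rightarrow> 'k::field) set" where "finite B" "card B = catalan (n div 2 + 1)"
    "B \<subseteq> sq_annihilator n" "B \<subseteq> sqf_part n (int (n div 2))" "0 \<notin> B"
    "sq_annihilator n \<inter> sqf_part n (int (n div 2)) \<subseteq> fs.span B"
proof -
  let ?K = "sq_annihilator n \<inter> sqf_part n (int (n div 2)) :: (nat set \<Rightarrow> 'k) set"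
  obtain B where B: "B \<subseteq> ?K" "fs.independent B" "?K \<subseteq> fs.span B" "card B = fs.dim ?K"
    using fs.basis_exists[of ?K] by blast
  have "B \<subseteq> fs.span (delta ` Pow {1..n})" using B(1) sqf_part_span by blast
  from conjunct1[OF fs.independent_span_bound[OF _ B(2) this]] have "finite B" by simp
  moreover have "0 \<notin> B" using B(2) fs.dependent_zero by blast
  moreover have "card B = catalan (n div 2 + 1)" using B(4) dim_sq_annihilator[OF char] by simp
  ultimately show ?thesis using that B(1,3) by blast
qed

text \<open>
  The annihilator of \<open>s\<^sup>2\<close> starts in degree \<open>\<lfloor>n/2\<rfloor>\<close>, so a multiple of a variable has no part there.
  This makes the projection to degree \<open>\<lfloor>n/2\<rfloor>\<close> suitable for \<open>image_in_span_of_generators\<close>.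
\<close>

lemma hom_component_mulX_annihilator:
  fixes f :: "nat set \<Rightarrow> 'k::field"
  assumes char: "CHAR('k) > n \<or> CHAR('k) = 0" and f: "f \<in> sq_annihilator n"
  shows "hom_component (int (n div 2)) (mulX i f) = 0"
proof -
  have "f \<in> sqf n" using f by (simp add: sq_annihilator_def)
  then have "hom_component (int (n div 2) - 1 + 1) (mulX i f) = mulX i (hom_component (int (n div 2) - 1) f)"
    by (rule hom_component_mulX)
  moreover have "hom_component (int (n div 2) - 1) f = 0" by (rule sq_annihilator_low[OF char f]) simp
  ultimately show ?thesis by (simp add: mulX.zero)
qed

lemma sq_annihilator_part_in_image:
  "sq_annihilator n \<inter> sqf_part n d \<subseteq> (\<lambda>p. hom_component d (sqf_coeffs n p)) ` (sq_colon n :: 'k::field mpoly set)"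
proof
  fix f :: "nat set \<Rightarrow> 'k" assume f: "f \<in> sq_annihilator n \<inter> sqf_part n d"
  then have fs: "f \<in> sqf n" using sqf_part_subset by blast
  have "f = hom_component d (sqf_coeffs n (sqf_lift n f))"
    using hom_component_id[of f n d] f by (simp only: sqf_coeffs_lift[OF fs] Int_iff)
  moreover have "sqf_lift n f \<in> sq_colon n" using f fs by (intro sqf_lift_preimage) blast+
  ultimately show "f \<in> (\<lambda>p. hom_component d (sqf_coeffs n p)) ` sq_colon n" by blast
qed

lemma dim_span_generators:
  fixes S :: "'k::field mpoly set" and \<Phi> :: "'k mpoly \<Rightarrow> 'x \<Rightarrow> 'k"
  assumes "finite S" "X \<subseteq> fs.span (\<Phi> ` S)"
  shows "fs.dim X \<le> card S"
  using fs.dim_le_card[OF assms(2)] card_image_le[OF assms(1), of \<Phi>] assms(1) by simp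

lemma quot_colon_generators:
  assumes char: "CHAR('k::field) > n \<or> CHAR('k) = 0"
  defines "R \<equiv> poly_ring n Quot (squares_ideal n :: 'k mpoly set)"
  defines "G \<equiv> quot_image n (squares_ideal n) (sq_colon n :: 'k mpoly set)"
  shows "generated_in_degrees R (quot_part n (squares_ideal n)) {n div 2} G"
    and "min_num_generators R G (catalan (n div 2 + 1))"
proof -
  let ?J = "squares_ideal n :: 'k mpoly set"
  let ?c = "\<lambda>p. ?J +>\<^bsub>poly_ring n\<^esub> p"
  note J = ideal_squares_ideal[of n, where 'a = 'k]
  obtain B :: "(nat set \<Rightarrow> 'k) set" where B: "finite B" "card B = catalan (n div 2 + 1)"
      "B \<subseteq> sq_annihilator n" "B \<subseteq> sqf_part n (int (n div 2))" 
      "sq_annihilator n \<inter> sqf_part n (int (n div 2)) \<subseteq> fs.span B"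
    using sq_annihilator_basis[OF char] by metis
  have Bs: "B \<subseteq> sqf n" using B(3) by (auto simp: sq_annihilator_def)
  let ?T = "?c ` sqf_lift n ` B"
  have lc: "sqf_lift n ` B \<subseteq> carrier (poly_ring n)" using sqf_lift_carrier by blast
  have JG: "?J \<subseteq> sq_colon n" by (rule squares_ideal_subset[OF subspace_sq_annihilator])
  have SJ: "sqf_lift n ` B \<union> ?J \<subseteq> carrier (poly_ring n)"
    using lc poly_ideal_carrier[OF J] by blast
  have "Idl\<^bsub>poly_ring n\<^esub> (sqf_lift n ` B \<union> ?J) = sq_colon n"
  proof
    show "Idl\<^bsub>poly_ring n\<^esub> (sqf_lift n ` B \<union> ?J) \<subseteq> sq_colon n"
      using JG B(3) Bs sqf_lift_preimage by (intro Q.genideal_minimal[OF ideal_sq_colon]) blast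
    have "squares n \<subseteq> ?J" by (rule Q.genideal_self[OF squares_carrier])
    then show "sq_colon n \<subseteq> Idl\<^bsub>poly_ring n\<^esub> (sqf_lift n ` B \<union> ?J)"
      unfolding sq_colon_eq_Idl[OF char B(3,5), symmetric]
      using Q.genideal_self[OF SJ] by (intro Q.genideal_minimal[OF Q.genideal_ideal[OF SJ]]) blast
  qed
  then have gen: "generates R ?T G"
    unfolding generates_def R_def G_def quot_image_def quot_Idl[OF J lc]
    using lc unfolding quot_carrier by blast
  have "?T \<subseteq> quot_part n ?J (n div 2)"
    unfolding quot_part_def quot_image_def using B(4) sqf_lift_hom_part by blast
  then show "generated_in_degrees R (quot_part n ?J) {n div 2} G"
    unfolding generated_in_degrees_def using gen by blast
  show "min_num_generators R G (catalan (n div 2 + 1))"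
    unfolding min_num_generators_def
  proof (intro conjI allI impI exI[of _ ?T])
    show "finite ?T" using B(1) by simp
    have "inj_on (\<lambda>b. ?c (sqf_lift n b)) B"
    proof (rule inj_onI)
      fix x y assume xy: "x \<in> B" "y \<in> B" "?c (sqf_lift n x) = ?c (sqf_lift n y)"
      then have "sqf_lift n x - sqf_lift n y \<in> ?J"
        using coset_eq_iff[OF J sqf_lift_carrier sqf_lift_carrier] by simp
      then have "sqf_coeffs n (sqf_lift n x) - sqf_coeffs n (sqf_lift n y) = 0"
        unfolding squares_ideal_eq by (simp add: sqf_preimage_def sqf_coeffs_diff)
      then show "x = y" using xy(1,2) Bs sqf_coeffs_lift by (metis eq_iff_diff_eq_0 subsetD)
    qed
    then have "card ((\<lambda>b. ?c (sqf_lift n b)) ` B) = card B" by (rule card_image)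
    then show "card ?T = catalan (n div 2 + 1)" by (simp only: image_image B(2))
    show "generates R ?T G" by (rule gen)
    fix T assume T: "finite T" "generates R T G"
    then have "T \<subseteq> ?c ` carrier (poly_ring n)" by (simp add: generates_def R_def quot_carrier)
    then obtain S where S: "S \<subseteq> carrier (poly_ring n)" "inj_on ?c S" "T = ?c ` S"
      unfolding subset_image_inj by blast
    have cardS: "card S = card T" "finite S" using S(2,3) T(1) by (simp_all add: card_image finite_image_iff)
    have SJ: "S \<union> ?J \<subseteq> carrier (poly_ring n)" using S(1) poly_ideal_carrier[OF J] by blast
    have SJ': "S \<union> ?J \<subseteq> Idl\<^bsub>poly_ring n\<^esub> (S \<union> ?J)" by (rule Q.genideal_self[OF SJ])
    have "?c ` sq_colon n = ?c ` (Idl\<^bsub>poly_ring n\<^esub> (S \<union> ?J))"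
      using T(2) quot_Idl[OF J S(1)] S(3) unfolding generates_def R_def G_def quot_image_def by simp
    moreover have "?J \<subseteq> Idl\<^bsub>poly_ring n\<^esub> (S \<union> ?J)" using SJ' by blast
    ultimately have eq: "sq_colon n = Idl\<^bsub>poly_ring n\<^esub> (S \<union> ?J)"
      by (intro quot_image_inject[OF J ideal_sq_colon JG Q.genideal_ideal[OF SJ]])
    let ?\<Phi> = "\<lambda>p :: 'k mpoly. hom_component (int (n div 2)) (sqf_coeffs n p)"
    have "?\<Phi> ` sq_colon n \<subseteq> fs.span (?\<Phi> ` (S \<union> ?J))"
    proof (rule image_in_span_of_generators[OF _ _ ideal_sq_colon _ _ eq])
      show "?\<Phi> (var i * p) = 0" if "i \<in> {1..n}" "p \<in> sq_colon n" for i p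
        unfolding sqf_coeffs_var[OF that(1)] by (rule hom_component_mulX_annihilator[OF char sqf_preimageD(2)[OF that(2)]])
      show "S \<union> ?J \<subseteq> sq_colon n" using SJ' eq by blast
    qed (simp_all only: sqf_coeffs_add sqf_coeffs_const hom_component.add hom_component.scale)
    also have "\<dots> \<subseteq> fs.span (insert 0 (?\<Phi> ` S))"
    proof (rule fs.span_mono)
      have "?\<Phi> p = 0" if "p \<in> ?J" for p
        using that unfolding squares_ideal_eq by (simp add: sqf_preimage_def hom_component.zero)
      then show "?\<Phi> ` (S \<union> ?J) \<subseteq> insert 0 (?\<Phi> ` S)" by blast
    qed
    finally have "sq_annihilator n \<inter> sqf_part n (int (n div 2)) \<subseteq> fs.span (?\<Phi> ` S)"
      using sq_annihilator_part_in_image[of n "int (n div 2)", where 'k = 'k] unfolding fs.span_insert_0 by blast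
    from dim_span_generators[OF cardS(2) this] show "catalan (n div 2 + 1) \<le> card T"
      unfolding dim_sq_annihilator[OF char] cardS(1) .
  qed
qed

lemma colon_generators:
  assumes char: "CHAR('k::field) > n \<or> CHAR('k) = 0"
  shows "generated_in_degrees (poly_ring n) (hom_part n) {2, n div 2} (sq_colon n :: 'k mpoly set)"
    and "n \<ge> 4 \<Longrightarrow> min_num_generators (poly_ring n) (sq_colon n :: 'k mpoly set) (n + catalan (n div 2 + 1))"
proof -
  let ?m = "n div 2"
  obtain B :: "(nat set \<Rightarrow> 'k) set" where B: "finite B" "card B = catalan (?m + 1)"
      "B \<subseteq> sq_annihilator n" "B \<subseteq> sqf_part n (int ?m)" "0 \<notin> B"
      "sq_annihilator n \<inter> sqf_part n (int ?m) \<subseteq> fs.span B"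
    using sq_annihilator_basis[OF char] by metis
  have Bs: "B \<subseteq> sqf n" using B(3) by (auto simp: sq_annihilator_def)
  let ?S = "sqf_lift n ` B \<union> squares n"
  have "?S \<subseteq> carrier (poly_ring n)" using squares_carrier sqf_lift_carrier by blast
  then have gen: "generates (poly_ring n) ?S (sq_colon n)"
    unfolding generates_def using sq_colon_eq_Idl[OF char B(3,6)] by simp
  have "sqf_lift n b \<in> hom_part n ?m" if "b \<in> B" for b
    using B(4) that by (intro sqf_lift_hom_part) blast
  then have "?S \<subseteq> hom_part n 2 \<union> (hom_part n ?m :: 'k mpoly set)"
    using squares_hom_part[of n, where 'a = 'k] by blast
  also have "\<dots> = (\<Union>d\<in>{2, ?m}. hom_part n d)" by simp
  finally have "?S \<subseteq> (\<Union>d\<in>{2, ?m}. hom_part n d :: 'k mpoly set)" .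
  then show "generated_in_degrees (poly_ring n) (hom_part n) {2, ?m} (sq_colon n :: 'k mpoly set)"
    unfolding generated_in_degrees_def using gen by blast
  assume n: "n \<ge> 4"
  show "min_num_generators (poly_ring n) (sq_colon n :: 'k mpoly set) (n + catalan (?m + 1))"
    unfolding min_num_generators_def
  proof (intro conjI allI impI exI[of _ ?S])
    have sq: "squares n = (\<lambda>i. var i ^ 2 :: 'k mpoly) ` {1..n}" by (auto simp: squares_def)
    have exp_inj: "Poly_Mapping.single i (2::nat) = Poly_Mapping.single j 2 \<longleftrightarrow> i = j" for i j :: nat
      by (metis lookup_single_eq lookup_single_not_eq zero_neq_numeral)
    have "inj_on (\<lambda>i. var i ^ 2 :: 'k mpoly) {1..n}"
    proof (rule inj_onI)
      fix i j assume "(var i ^ 2 :: 'k mpoly) = var j ^ 2"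
      then have "Poly_Mapping.lookup (var i ^ 2 :: 'k mpoly) (Poly_Mapping.single j 2) = 1"
        by (simp add: var_square)
      then show "i = j" unfolding var_square by (simp add: lookup_single when_def exp_inj split: if_splits)
    qed
    then have c1: "card (squares n :: 'k mpoly set) = n" unfolding sq by (simp add: card_image)
    have "inj_on (sqf_lift n) B" by (rule inj_onI) (metis sqf_coeffs_lift Bs subsetD)
    then have c2: "card (sqf_lift n ` B) = catalan (?m + 1)" using B(2) by (simp add: card_image)
    have fin: "finite (sqf_lift n ` B)" "finite (squares n :: 'k mpoly set)" using B(1) sq by simp_all
    then show "finite ?S" by simp
    have "sqf_lift n b \<notin> squares n" if "b \<in> B" for b
    proof
      assume "sqf_lift n b \<in> squares n"
      then have "sqf_coeffs n (sqf_lift n b) = 0" by (auto simp: squares_def sqf_coeffs_square)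
      then have "b = 0" using sqf_coeffs_lift that Bs by (metis subsetD)
      then show False using that B(5) by blast
    qed
    then have "sqf_lift n ` B \<inter> squares n = {}" by blast
    then show "card ?S = n + catalan (?m + 1)"
      using card_Un_disjoint[OF fin] c1 c2 by simp
    show "generates (poly_ring n) ?S (sq_colon n)" by (rule gen)
    fix S :: "'k mpoly set" assume S: "finite S" "generates (poly_ring n) S (sq_colon n)"
    then have S': "S \<subseteq> sq_colon n" "sq_colon n = Idl\<^bsub>poly_ring n\<^esub> S"
      using Q.genideal_self[of S n] by (simp_all add: generates_def)
    \<comment> \<open>The coordinates: the coefficients of the squares, and the squarefree part of lowest degree.\<close>
    define \<Phi> :: "'k mpoly \<Rightarrow> nat + nat set \<Rightarrow> 'k" where
      "\<Phi> p = case_sum (\<lambda>i. if i \<in> {1..n} then Poly_Mapping.lookup p (Poly_Mapping.single i 2) else 0)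
                (hom_component (int ?m) (sqf_coeffs n p))" for p
    have \<Phi>_Inl: "\<Phi> p (Inl i) = (if i \<in> {1..n} then Poly_Mapping.lookup p (Poly_Mapping.single i 2) else 0)"
      and \<Phi>_Inr: "\<Phi> p (Inr T) = hom_component (int ?m) (sqf_coeffs n p) T" for p i T
      by (simp_all only: \<Phi>_def sum.case)
    have \<Phi>_add: "\<Phi> (p + q) = \<Phi> p + \<Phi> q" for p q
    proof
      fix x show "\<Phi> (p + q) x = (\<Phi> p + \<Phi> q) x"
        by (cases x) (simp_all add: \<Phi>_Inl \<Phi>_Inr lookup_add sqf_coeffs_add hom_component.add)
    qed
    have \<Phi>_scale: "\<Phi> (const a * p) = scl a (\<Phi> p)" for a p
    proof
      fix x show "\<Phi> (const a * p) x = scl a (\<Phi> p) x"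
        by (cases x) (simp_all add: \<Phi>_Inl \<Phi>_Inr lookup_const_mult sqf_coeffs_const hom_component.scale scl_apply)
    qed
    have \<Phi>_var: "\<Phi> (var i * p) = 0" if i: "i \<in> {1..n}" and p: "p \<in> sq_colon n" for i p
    proof
      note f = sqf_preimageD(2)[OF p]
      fix x show "\<Phi> (var i * p) x = 0 x"
      proof (cases x)
        case (Inl j)
        have "Poly_Mapping.lookup (var i * p) (Poly_Mapping.single j 2) = 0"
        proof (cases "i = j")
          case True
          have "Poly_Mapping.single i (2::nat) - Poly_Mapping.single i 1 = sqf_exp {i}"
            by (rule poly_mapping_eqI) (simp add: lookup_minus lookup_single lookup_sqf_exp when_def)
          then have "Poly_Mapping.lookup (var i * p) (Poly_Mapping.single j 2) = sqf_coeffs n p {i}"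
            using i True by (simp add: lookup_var_mult sqf_coeffs_def)
          also have "\<dots> = hom_component 1 (sqf_coeffs n p) {i}" by (simp add: hom_component_def)
          \<comment> \<open>The lowest degree \<open>\<lfloor>n/2\<rfloor>\<close> exceeds one because \<open>n \<ge> 4\<close>.\<close>
          also have "hom_component 1 (sqf_coeffs n p) = 0"
            using n by (intro sq_annihilator_low[OF char f]) simp
          finally show ?thesis by simp
        next
          case False
          then show ?thesis by (simp add: lookup_var_mult lookup_single when_def)
        qed
        then show ?thesis by (simp add: Inl \<Phi>_Inl)
      next
        case (Inr T)
        then show ?thesis
          by (simp only: \<Phi>_Inr sqf_coeffs_var[OF i] hom_component_mulX_annihilator[OF char f] zero_fun_apply)
      qed
    qed
    let ?Y = "\<Phi> ` sq_colon n"
    have YS: "?Y \<subseteq> fs.span (\<Phi> ` S)"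
      by (rule image_in_span_of_generators[OF \<Phi>_add \<Phi>_scale ideal_sq_colon \<Phi>_var S'])
    have Y: "fs.subspace ?Y"
      by (rule subspace_image_ideal[OF \<Phi>_add \<Phi>_scale ideal_sq_colon])
    define \<Psi> :: "(nat + nat set \<Rightarrow> 'k) \<Rightarrow> nat set \<Rightarrow> 'k" where "\<Psi> h = (\<lambda>T. h (Inr T))" for h
    have \<Psi>: "Vector_Spaces.linear scl scl \<Psi>"
      by (rule linear_sclI) (simp_all add: \<Psi>_def fun_eq_iff scl_apply)
    have \<Psi>\<Phi>: "\<Psi> (\<Phi> p) = hom_component (int ?m) (sqf_coeffs n p)" for p
      by (simp add: \<Psi>_def fun_eq_iff \<Phi>_Inr)
    have fin\<Phi>: "finite (\<Phi> ` S)" using S(1) by simp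
    have rank: "fs.dim {h \<in> ?Y. \<Psi> h = 0} + fs.dim (\<Psi> ` ?Y) = fs.dim ?Y"
      by (rule dim_kernel_plus_image[OF \<Psi> Y YS fin\<Phi>])
    have dY: "fs.dim ?Y \<le> card S" by (rule dim_span_generators[OF S(1) YS])
    have "\<Psi> ` ?Y = (\<lambda>p. hom_component (int ?m) (sqf_coeffs n p)) ` sq_colon n"
      unfolding image_image \<Psi>\<Phi> ..
    moreover have "\<Psi> ` ?Y \<subseteq> fs.span (delta ` Pow {1..n})"
      unfolding image_image \<Psi>\<Phi> using hom_component_sqf_part[OF sqf_coeffs_sqf] sqf_part_span by blast
    ultimately have "fs.dim (sq_annihilator n \<inter> sqf_part n (int ?m) :: (nat set \<Rightarrow> 'k) set) \<le> fs.dim (\<Psi> ` ?Y)"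
      using sq_annihilator_part_in_image[of n "int ?m", where 'k = 'k]
      by (intro fs.dim_mono_finite[of _ _ "delta ` Pow {1..n}"]) simp_all
    then have im: "catalan (?m + 1) \<le> fs.dim (\<Psi> ` ?Y)" unfolding dim_sq_annihilator[OF char] .
    \<comment> \<open>Combinations of the squares realize all values of the first \<open>n\<close> coordinates.\<close>
    have "{h. \<forall>x. h x \<noteq> 0 \<longrightarrow> x \<in> Inl ` {1..n}} \<subseteq> {h \<in> ?Y. \<Psi> h = 0}"
    proof
      fix h :: "nat + nat set \<Rightarrow> 'k" assume "h \<in> {h. \<forall>x. h x \<noteq> 0 \<longrightarrow> x \<in> Inl ` {1..n}}"
      then have h: "h x = 0" if "x \<notin> Inl ` {1..n}" for x using that by blast
      define p where "p = (\<Sum>i=1..n. const (h (Inl i)) * var i ^ 2)"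
      have p: "p \<in> squares_ideal n"
        unfolding p_def
      proof (rule poly_ideal_sum[OF ideal_squares_ideal])
        fix i assume "i \<in> {1..n}"
        then have "var i ^ 2 \<in> (squares_ideal n :: 'k mpoly set)"
          using Q.genideal_self[OF squares_carrier] sq by blast
        then show "const (h (Inl i)) * var i ^ 2 \<in> squares_ideal n"
          by (rule poly_ideal_mult[OF ideal_squares_ideal _ carrier_const])
      qed
      then have pG: "p \<in> sq_colon n" using squares_ideal_subset[OF subspace_sq_annihilator] by blast
      have p0: "sqf_coeffs n p = 0" using p unfolding squares_ideal_eq by (simp add: sqf_preimage_def)
      have "\<Phi> p = h"
      proof
        fix x show "\<Phi> p x = h x"
        proof (cases x)
          case (Inl j)
          show ?thesis
          proof (cases "j \<in> {1..n}")
            case True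
            have "Poly_Mapping.lookup p (Poly_Mapping.single j 2) = (\<Sum>i=1..n. if i = j then h (Inl i) else 0)"
              unfolding p_def lookup_sum lookup_const_mult var_square
              by (intro sum.cong) (auto simp: lookup_single when_def exp_inj)
            also have "\<dots> = h (Inl j)" using True by simp
            finally show ?thesis using True by (simp add: Inl \<Phi>_Inl)
          next
            case False
            then have "x \<notin> Inl ` {1..n}" using Inl by blast
            then have "h x = 0" by (rule h)
            then show ?thesis by (simp only: Inl \<Phi>_Inl False if_False)
          qed
        next
          case (Inr T)
          then have "x \<notin> Inl ` {1..n}" by blast
          then show ?thesis using h Inr by (simp add: \<Phi>_Inr p0 hom_component.zero)
        qed
      qed
      moreover have "\<Psi> (\<Phi> p) = 0" unfolding \<Psi>\<Phi> p0 hom_component.zero ..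
      ultimately show "h \<in> {h \<in> ?Y. \<Psi> h = 0}" using pG by blast
    qed
    moreover have "{h \<in> ?Y. \<Psi> h = 0} \<subseteq> fs.span (\<Phi> ` S)" using YS by blast
    ultimately have "fs.dim {h :: nat + nat set \<Rightarrow> 'k. \<forall>x. h x \<noteq> 0 \<longrightarrow> x \<in> Inl ` {1..n}} \<le> fs.dim {h \<in> ?Y. \<Psi> h = 0}"
      using fin\<Phi> by (rule fs.dim_mono_finite)
    then have "n \<le> fs.dim {h \<in> ?Y. \<Psi> h = 0}"
      by (subst (asm) dim_support) (simp_all add: card_image)
    then show "n + catalan (?m + 1) \<le> card S" using rank im dY by linarith
  qed
qed

section \<open>The socle of \<open>R\<close> and the generators of \<open>G\<close>\<close>

theorem corollary4p15:
  fixes n l :: nat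
    and Q :: "'k::field mpoly ring"
    and I J G :: "'k mpoly set"
    and R :: "'k mpoly set ring"
  assumes "n \<ge> 2" and "l = (n - 2) div 2"
    and "CHAR('k) > n \<or> CHAR('k) = 0"
    and "Q = poly_ring n"
    and "J = Idl\<^bsub>Q\<^esub> {var i ^ 2 | i. i \<in> {1..n}}"
    and "I = J <+>\<^bsub>Q\<^esub> Idl\<^bsub>Q\<^esub> {(\<Sum>i=1..n. var i) ^ 2}"
    and "G = colon_ideal Q J I"
    and "R = Q Quot I"
  shows "(level n I \<and> socle n I \<subseteq> quot_part n I (n - l - 1) \<and>
          ring.dimension R (catalan (l + 2)) (quot_scalars n I) (socle n I)) \<and>
         (generated_in_degrees (Q Quot J) (quot_part n J) {l + 1} (quot_image n J G) \<and>
          min_num_generators (Q Quot J) (quot_image n J G) (catalan (l + 2)) \<and>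
          generated_in_degrees Q (hom_part n) {2, l + 1} G \<and>
          (n \<ge> 4 \<longrightarrow> min_num_generators Q G (n + catalan (l + 2))))"
proof -
  have m: "n div 2 = l + 1" using assms(1,2) by linarith
  then have cat: "n div 2 + 1 = l + 2" by simp
  have deg: "n - n div 2 = n - l - 1" unfolding m by simp
  have J: "J = squares_ideal n" unfolding assms(4,5) squares_def ..
  have I: "I = sq_ideal n"
    using squares_and_sq_ideal_eq[of n, where 'k = 'k] unfolding assms(6) J assms(4) sum_vars_def .
  have G: "G = sq_colon n" unfolding assms(7) I J assms(4) by (rule colon_ideal_eq)
  note char = assms(3)
  have "socle n I = quot_part n I (n - l - 1)" unfolding I using socle_eq[OF char] unfolding deg .
  then have "level n I \<and> socle n I \<subseteq> quot_part n I (n - l - 1) \<and>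
      ring.dimension R (catalan (l + 2)) (quot_scalars n I) (socle n I)"
    using level_sq_ideal[OF char] socle_dimension[OF char] unfolding assms(8) assms(4) I cat by simp
  moreover have "generated_in_degrees (Q Quot J) (quot_part n J) {l + 1} (quot_image n J G) \<and>
      min_num_generators (Q Quot J) (quot_image n J G) (catalan (l + 2))"
    using quot_colon_generators[OF char] unfolding m cat J G assms(4) by simp
  moreover have "generated_in_degrees Q (hom_part n) {2, l + 1} G \<and>
      (n \<ge> 4 \<longrightarrow> min_num_generators Q G (n + catalan (l + 2)))"
    using colon_generators[OF char] unfolding m cat G assms(4) by simp
  ultimately show ?thesis by blast
qed

end
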